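(* Let $d=1$, $N\ge1$, let $(\Lambda_k)_{k\ge1}$ be complex variables and $t_k:=e^{\Lambda_k}-1$. Let $A(z):=\sqrt{1-4z^2}$ and $B(z):=\frac{2z}{1+A(z)}$. Let $W_{2N}$ be the set of closed walks on $\mathbb{Z}$ which start and end in $0$ and have length between $1$ and $2N$. Then $$\sum_{w\in W_{2N}}\exp\Big(\sum_{k=1}^\infty\Lambda_kN_{2k}(w)\Big)z^{\mathrm{length}(w)}=z\frac{\partial}{\partial z}\Bigg[T_0(z)+\sum_{k=1}^\infty t_kT_1(z)^{(k)}+\sum_{k_1,k_2=1}^\infty t_{k_1}t_{k_2}T_2(z)^{(k_1),(k_2)}+\sum_{k_1,k_2,k_3=1}^\infty t_{k_1}t_{k_2}t_{k_3}T_{\ge3}(z)^{(k_1),(k_2),(k_3)}\Bigg],$$ where $$T_0(z):=\Big(\log\frac{2}{1+A(z)}\Big)_{z\diamond2N},\qquad T_1(z)^{(k)}:=\Big(\frac1k(1-A(z))^k\Big)_{z\diamond2N},$$ $$T_2(z)^{(k_1),(k_2)}:=\Bigg(\sum_{l_1=0}^{k_1-1}\sum_{l_2=0}^{k_2-1}\binom{k_1-1}{l_1}\binom{k_2-1}{l_2}(1-A(z))^{l_1+l_2}G_{k_1-l_1,k_2-l_2}(z)\Bigg)_{z\diamond2N},$$ $$T_{\ge3}(z)^{(k_1),(k_2),(k_3)}:=\Big\langle\Psi(k_1,z)\,\Big|\,\Big(\mathbf I-\sum_{k=1}^\infty t_kQ(k,z)\Big)^{-1}\Phi(k_2,k_3,z)\Big\rangle_{z\diamond2N}.$$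 Here $$G_{i,j}(z):=\Bigg((-1)^{i+j}A(z)^{i+j}\sum_{f=\max(i,j)}^\infty\frac1f\binom fi\binom fj\frac{B(z)^{2f}}{1-B(z)^{2f}}\Bigg)_{z\diamond2N},\qquad H_{i,j}(z):=\Bigg(A(z)^j\sum_{f=j-i}^\infty\binom{f+i-1}{j-1}\frac{B(z)^{2f}}{1-B(z)^{2f}}\Bigg)_{z\diamond2N},$$ the vectors $\Psi(k,z)$, $\Phi(k_1,k_2,z)$ and the matrices $Q(k,z)$ are indexed by pairs $(\varrho,t)$ with $0\le\varrho,t<N$ (so they have size $N^2$ and $N^2\times N^2$), with entries $$\Psi_{(\varrho,t)}(k,z):=\Bigg(\delta_{t,0}(-1)^{\varrho+1}\sum_{l=0}^{k-1}\binom{k-1}l(1-A(z))^lG_{\varrho+1,k-l}(z)\Bigg)_{z\diamond2N},$$ $$\Phi_{(\varrho,t)}(k_1,k_2,z):=\Bigg(\frac{(-1)^{\varrho+1}(k_1-1)!}{\varrho!\,(k_1-2-\varrho-t)!}\,T_2(z)^{(k_1-1-\varrho-t),(k_2)}\Bigg)_{z\diamond2N},$$ $$Q_{(\varrho,t),(\tilde\varrho,\tilde t)}(k,z):=\Bigg(\frac1{\tilde t!\,(\tilde t+1)!\,\varrho!}\sum_{\eta=0}^{k-2-\varrho-t-\tilde t}\frac{(k-1)!\,(1-A(z))^{k-2-\varrho-t-\tilde t-\eta}(-1)^{\varrho+\eta}}{\eta!\,(k-2-\varrho-t-\tilde t-\eta)!}\,H_{\tilde t+1,\tilde\varrho+\eta+2\tilde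 t+2}(z)\Bigg)_{z\diamond2N},$$ where $\Phi_{(\varrho,t)}(k_1,k_2,z):=0$ if $\varrho+t>k_1-2$ and $Q_{(\varrho,t),(\tilde\varrho,\tilde t)}(k,z):=0$ if $\varrho+t+\tilde t>k-2$.
   Context: A walk of length $n$ on $\mathbb{Z}$ is a pair $w=(p,s)$ with starting point $p\in\mathbb{Z}$ and steps $s=(s_1,\dots,s_n)$, $s_i\in\{1,-1\}$; its points are $p_0=p$, $p_i=p+\sum_{j=1}^is_j$. It is closed if $p_n=p$. The multiplicity of $q\in\mathbb{Z}$ is $mu(q,w)=\delta_{q,p}+\delta_{q,p_n}+2\sum_{i=1}^{n-1}\delta_{q,p_i}$, and for a closed walk $w$ and $k\ge1$, $N_{2k}(w):=\#\{q\in\mathbb{Z}:mu(q,w)=2k\}$. For a formal power series $g(z)=\sum_{n\ge0}a_nz^n$, $(g(z))_{z\diamond k}:=\sum_{n=0}^ka_nz^n$. All functions of $z$ ($A$, $B$, etc.) are understood as power series in $z$ at $0$ with $A(0)=1$. $\mathbf I$ is the unit $N^2\times N^2$ matrix, $\langle\cdot|\cdot\rangle$ is the standard bilinear scalar product $\langle u|v\rangle=\sum_{(\varrho,t)}u_{(\varrho,t)}v_{(\varrho,t)}$; $(\cdot)^{-1}$ is shorthand for the geometric series $\sum_{m\ge0}(\sum_kt_kQ(k,z))^m$, of which, because of the truncation $z\diamond2N$, only finitely many terms contribute (likewise the sums over $k$, $k_i$ are effectively finite). *)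

theory Defs
  imports "HOL-Analysis.Analysis" "HOL-Computational_Algebra.Formal_Power_Series"
begin

section \<open>Walks on the integers\<close>

text \<open>A walk is its starting point together with the list of its steps.\<close>

type_synonym walk = "int \<times> int list"

definition is_walk :: "walk \<Rightarrow> bool" where
  "is_walk w \<longleftrightarrow> set (snd w) \<subseteq> {1, -1}"

definition walk_length :: "walk \<Rightarrow> nat" where
  "walk_length w = length (snd w)"

definition walk_point :: "walk \<Rightarrow> nat \<Rightarrow> int" where
  "walk_point w i = fst w + sum_list (take i (snd w))"

definition closed_walk :: "walk \<Rightarrow> bool" where
  "closed_walk w \<longleftrightarrow> is_walk w \<and> walk_point w (walk_length w) = fst w"

definition mu :: "int \<Rightarrow> walk \<Rightarrow> nat" where
  "mu q w = of_bool (q = fst w) + of_bool (q = walk_point w (walk_length w))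
     + 2 * (\<Sum>i\<in>{1..<walk_length w}. of_bool (q = walk_point w i))"

text \<open>\<open>num_mult m w\<close> is $N_m(w)$; it is only used for even $m \ge 2$, where the set is finite.\<close>

definition num_mult :: "nat \<Rightarrow> walk \<Rightarrow> nat" where
  "num_mult m w = card {q. mu q w = m}"

text \<open>\<open>walks0 n\<close> is $W_n$.\<close>

definition walks0 :: "nat \<Rightarrow> walk set" where
  "walks0 n = {w. closed_walk w \<and> fst w = 0 \<and> 1 \<le> walk_length w \<and> walk_length w \<le> n}"

lemma finite_walks0: "finite (walks0 n)"
proof (rule finite_subset)
  show "walks0 n \<subseteq> {0} \<times> {xs. set xs \<subseteq> {1, -1} \<and> length xs \<le> n}"
    by (auto simp: walks0_def closed_walk_def is_walk_def walk_length_def)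
  show "finite ({0::int} \<times> {xs::int list. set xs \<subseteq> {1, -1} \<and> length xs \<le> n})"
    by (intro finite_cartesian_product finite_lists_length_le) auto
qed


section \<open>Formal power series\<close>

text \<open>
  All functions of $z$ are elements of \<open>complex fps\<close> with \<open>fps_X\<close> as $z$. Every infinite sum of
  power series below is an \<open>infsum\<close> with respect to the library's topology on \<open>fps\<close>, which is
  the $z$-adic one (a net converges iff each of its coefficients is eventually constant).
\<close>

text \<open>\<open>ztrunc k g\<close> is $(g(z))_{z\diamond k}$, which keeps the coefficient of $z^k$.\<close>

definition ztrunc :: "nat \<Rightarrow> complex fps \<Rightarrow> complex fps" where
  "ztrunc k g = fps_cutoff (Suc k) g"

text \<open>The branch of the square root is fixed by \<open>csqrt 1 = 1\<close>, i.e. $A(0) = 1$.\<close>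

definition A_ser :: "complex fps" where
  "A_ser = fps_radical (\<lambda>_. csqrt) 2 (1 - 4 * fps_X ^ 2)"

lemma A_ser_nth_0: "fps_nth A_ser 0 = 1"
  by (simp add: A_ser_def)

lemma A_ser_power2: "A_ser ^ 2 = 1 - 4 * fps_X ^ 2"
  using power_radical[of "1 - 4 * fps_X ^ 2 :: complex fps" "\<lambda>_. csqrt" 1]
  by (simp add: A_ser_def numeral_2_eq_2)

definition B_ser :: "complex fps" where
  "B_ser = 2 * fps_X / (1 + A_ser)"

text \<open>Logarithm of a series with constant coefficient 1; \<open>fps_ln 1\<close> is the series of
  $\log(1 + X)$.\<close>

definition log_ser :: "complex fps \<Rightarrow> complex fps" where
  "log_ser g = fps_ln 1 oo (g - 1)"

definition G_ser :: "nat \<Rightarrow> nat \<Rightarrow> nat \<Rightarrow> complex fps" where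
  "G_ser N i j = ztrunc (2 * N)
     ((-1) ^ (i + j) * A_ser ^ (i + j) *
      (\<Sum>\<^sub>\<infinity>f\<in>{max i j..}.
         fps_const (1 / of_nat f * of_nat (f choose i) * of_nat (f choose j)) *
         (B_ser ^ (2 * f) / (1 - B_ser ^ (2 * f)))))"

text \<open>Only used for $j > i \ge 1$, so that none of the subtractions truncates.\<close>

definition H_ser :: "nat \<Rightarrow> nat \<Rightarrow> nat \<Rightarrow> complex fps" where
  "H_ser N i j = ztrunc (2 * N)
     (A_ser ^ j *
      (\<Sum>\<^sub>\<infinity>f\<in>{j - i..}.
         of_nat ((f + i - 1) choose (j - 1)) * (B_ser ^ (2 * f) / (1 - B_ser ^ (2 * f)))))"

definition T0 :: "nat \<Rightarrow> complex fps" where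
  "T0 N = ztrunc (2 * N) (log_ser (2 / (1 + A_ser)))"

definition T1 :: "nat \<Rightarrow> nat \<Rightarrow> complex fps" where
  "T1 N k = ztrunc (2 * N) (fps_const (1 / of_nat k) * (1 - A_ser) ^ k)"

definition T2 :: "nat \<Rightarrow> nat \<Rightarrow> nat \<Rightarrow> complex fps" where
  "T2 N k1 k2 = ztrunc (2 * N)
     (\<Sum>l1 = 0..k1 - 1. \<Sum>l2 = 0..k2 - 1.
        of_nat ((k1 - 1) choose l1) * of_nat ((k2 - 1) choose l2) *
        (1 - A_ser) ^ (l1 + l2) * G_ser N (k1 - l1) (k2 - l2))"


section \<open>Vectors and matrices indexed by pairs\<close>

text \<open>Vectors and matrices are functions on pairs; only their entries at indices in
  \<open>idx N\<close> matter.\<close>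

definition idx :: "nat \<Rightarrow> (nat \<times> nat) set" where
  "idx N = {0..<N} \<times> {0..<N}"

type_synonym pvec = "nat \<times> nat \<Rightarrow> complex fps"
type_synonym pmat = "nat \<times> nat \<Rightarrow> nat \<times> nat \<Rightarrow> complex fps"

definition pinner :: "nat \<Rightarrow> pvec \<Rightarrow> pvec \<Rightarrow> complex fps" where
  "pinner N u v = (\<Sum>a\<in>idx N. u a * v a)"

definition pmat_vec :: "nat \<Rightarrow> pmat \<Rightarrow> pvec \<Rightarrow> pvec" where
  "pmat_vec N M v = (\<lambda>a. \<Sum>b\<in>idx N. M a b * v b)"

definition pmat_mult :: "nat \<Rightarrow> pmat \<Rightarrow> pmat \<Rightarrow> pmat" where
  "pmat_mult N M M' = (\<lambda>a b. \<Sum>c\<in>idx N. M a c * M' c b)"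

definition pmat_one :: pmat where
  "pmat_one = (\<lambda>a b. if a = b then 1 else 0)"

primrec pmat_pow :: "nat \<Rightarrow> pmat \<Rightarrow> nat \<Rightarrow> pmat" where
  "pmat_pow N M 0 = pmat_one"
| "pmat_pow N M (Suc m) = pmat_mult N M (pmat_pow N M m)"

text \<open>$(\mathbf I - M)^{-1}$, as the geometric series $\sum_{m \ge 0} M^m$ taken entrywise.\<close>

definition pmat_geom :: "nat \<Rightarrow> pmat \<Rightarrow> pmat" where
  "pmat_geom N M = (\<lambda>a b. \<Sum>\<^sub>\<infinity>m\<in>{0..}. pmat_pow N M m a b)"

definition Psi :: "nat \<Rightarrow> nat \<Rightarrow> pvec" where
  "Psi N k = (\<lambda>(r, t). ztrunc (2 * N)
     (if t = 0 then
        (-1) ^ (r + 1) *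
        (\<Sum>l = 0..k - 1. of_nat ((k - 1) choose l) * (1 - A_ser) ^ l * G_ser N (r + 1) (k - l))
      else 0))"

text \<open>The conditions \<open>k < r + t + 2\<close> etc. below are $\varrho + t > k - 2$ etc., rearranged because
  subtraction of natural numbers truncates.\<close>

definition Phi :: "nat \<Rightarrow> nat \<Rightarrow> nat \<Rightarrow> pvec" where
  "Phi N k1 k2 = (\<lambda>(r, t).
     if k1 < r + t + 2 then 0
     else ztrunc (2 * N)
       (fps_const ((-1) ^ (r + 1) * fact (k1 - 1) / (fact r * fact (k1 - 2 - r - t))) *
        T2 N (k1 - 1 - r - t) k2))"

definition Q_mat :: "nat \<Rightarrow> nat \<Rightarrow> pmat" where
  "Q_mat N k = (\<lambda>(r, t) (r', t').
     if k < r + t + t' + 2 then 0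
     else ztrunc (2 * N)
       (fps_const (1 / (fact t' * fact (t' + 1) * fact r)) *
        (\<Sum>e = 0..k - 2 - r - t - t'.
           fps_const (fact (k - 1) / (fact e * fact (k - 2 - r - t - t' - e))) *
           (1 - A_ser) ^ (k - 2 - r - t - t' - e) * (-1) ^ (r + e) *
           H_ser N (t' + 1) (r' + e + 2 * t' + 2))))"

definition tvar :: "(nat \<Rightarrow> complex) \<Rightarrow> nat \<Rightarrow> complex" where
  "tvar \<Lambda> k = exp (\<Lambda> k) - 1"

definition T3 :: "(nat \<Rightarrow> complex) \<Rightarrow> nat \<Rightarrow> nat \<Rightarrow> nat \<Rightarrow> nat \<Rightarrow> complex fps" where
  "T3 \<Lambda> N k1 k2 k3 = ztrunc (2 * N)
     (pinner N (Psi N k1)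
        (pmat_vec N
           (pmat_geom N (\<lambda>a b. \<Sum>\<^sub>\<infinity>k\<in>{1..}. fps_const (tvar \<Lambda> k) * Q_mat N k a b))
           (Phi N k2 k3)))"

end

theory Submission
  imports Defs
begin

text \<open>
  A closed walk from the origin is a sequence of excursions, that is, a plane forest with a side
  chosen for every tree; the visits at distance $m$ are the nodes at depths $m - 1$ and $m$.
  Expand the weight $\prod_q (1 + t_{v(q)})$, with $v(q)$ the number of visits at $q$, over sets of
  marked points and reroot the walk at the second largest marked point. What remains are the moments
  $U_i$ of $i$ excursions to the left, where every point may be marked, and $R_j$ of $j$ excursions to
  the right, where exactly one point is marked.

  Write $U_i = \mathcal L(L^i)$ for a linear functional $\mathcal L$. Passing to the
  neighbouring point substitutes $L \mapsto z^2 / (1 - L)$. This Moebius map fixes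
  $\lambda = (1 - A) / 2$, and $u = (L - \lambda) / (1 - \lambda - L)$ conjugates it to multiplication
  by $B^2$. Hence the unmarked points between two marked ones contribute
  $\sum_{d \ge 1} B^{2fd} = B^{2f} / (1 - B^{2f})$ to $\mathcal L(u^f)$, and re-expanding $u^f$ in powers
  of $L - \lambda$ yields a linear system for the centred moments $\mathcal L((L - \lambda)^i)$. Its
  Neumann series is $T_{\ge 3}$, where a pair $(\varrho, t)$ stands for $i = \varrho + t + 1$.
\<close>

section \<open>Infinite sums of formal power series\<close>

text \<open>The second largest mark is chosen because everything to its right then carries exactly
  one mark and enters linearly, so that only the left side needs a system of equations. Sets with no
  mark and with one mark give \<open>T0\<close> and \<open>T1\<close>. Rerooting a walk of length n
  at one of the k visits to a mark produces the factor n/k, the source of z d/dz and of 1/k. Without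
  marks the functional is evaluation at \<lambda>, so all its centred moments of positive order
  vanish; this is the reason for centring. The centred moment of order 0 is 1 and yields
  \<open>T2\<close>; the orders i >= 1 yield \<open>T3\<close>. Pairs arise because the system in i
  alone has coefficients with a product of two binomials in f. Writing it as a combination of single
  binomials binom(f + t, i + s - 1) brings in H and the second index t. The enlarged system is not
  inverted: an explicit row vector is shown to solve it modulo z^(2N+1). The centred moment of order
  i is divisible by z^(2i), so orders above N are invisible there, and every pair with r + t + 1 <=
  N lies in the N by N index set.\<close>

instance fps :: (ab_group_add) topological_ab_group_add
proof
  fix a b :: "'a fps"
  have 1: "\<forall>\<^sub>F x in nhds a. fps_nth x n = fps_nth a n" for a :: "'a fps" and n
    using tendsto_ident_at[of a UNIV] tendsto_fps_iff[of "\<lambda>x. x" a "nhds a"] filterlim_ident by blast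
  show "LIM x nhds a \<times>\<^sub>F nhds b. fst x + snd x :> nhds (a + b)"
  proof (rule tendsto_fpsI)
    fix n
    show "\<forall>\<^sub>F x in nhds a \<times>\<^sub>F nhds b. fps_nth (fst x + snd x) n = fps_nth (a + b) n"
      using eventually_prodI[OF 1[of n a] 1[of n b]] by eventually_elim simp
  qed
  show "(uminus \<longlongrightarrow> - a) (nhds a)"
  proof (rule tendsto_fpsI)
    fix n
    show "\<forall>\<^sub>F x in nhds a. fps_nth (- x) n = fps_nth (- a) n"
      using 1[of n a] by eventually_elim simp
  qed
qed

text \<open>The n-th coefficient of a product involves only the coefficients up to n of the factors,
  so it is eventually constant when these are. The two instances give access to the laws of
  \<open>infsum\<close> for sums and for constant factors.\<close>

instance fps :: (ring) topological_semigroup_mult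
proof
  fix a b :: "'a fps"
  have 1: "\<forall>\<^sub>F x in nhds a. \<forall>i\<in>{0..n}. fps_nth x i = fps_nth a i" for a :: "'a fps" and n
    using tendsto_fps_iff[of "\<lambda>x. x" a "nhds a"] filterlim_ident
    by (intro eventually_ball_finite) blast+
  show "LIM x nhds a \<times>\<^sub>F nhds b. fst x * snd x :> nhds (a * b)"
  proof (rule tendsto_fpsI)
    fix n
    show "\<forall>\<^sub>F x in nhds a \<times>\<^sub>F nhds b. fps_nth (fst x * snd x) n = fps_nth (a * b) n"
      using eventually_prodI[OF 1[where n=n and a=a] 1[where n=n and a=b]]
      by eventually_elim (auto simp: fps_mult_nth intro!: sum.cong)
  qed
qed

text \<open>In the z-adic topology a coefficient converges only by becoming constant, so each
  coefficient may receive only finitely many nonzero contributions.\<close>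

lemma fps_summable_on_iff:
  fixes F :: "'i \<Rightarrow> 'b :: ab_group_add fps"
  shows "F summable_on A \<longleftrightarrow> (\<forall>n. finite {x\<in>A. fps_nth (F x) n \<noteq> 0})"
proof
  assume "F summable_on A"
  then show "\<forall>n. finite {x\<in>A. fps_nth (F x) n \<noteq> 0}"
    using has_sum_fpsD(1) unfolding summable_on_def by metis
next
  assume *: "\<forall>n. finite {x\<in>A. fps_nth (F x) n \<noteq> 0}"
  have "(F has_sum Abs_fps (\<lambda>n. \<Sum>x | x \<in> A \<and> fps_nth (F x) n \<noteq> 0. fps_nth (F x) n)) A"
    by (rule has_sum_fpsI) (use * in auto)
  then show "F summable_on A" by (rule has_sum_imp_summable)
qed

lemma fps_nth_infsum:
  fixes F :: "'i \<Rightarrow> 'b :: ab_group_add fps"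
  assumes "F summable_on A" "finite S" "S \<subseteq> A" "\<And>x. x \<in> A - S \<Longrightarrow> fps_nth (F x) n = 0"
  shows "fps_nth (infsum F A) n = (\<Sum>x\<in>S. fps_nth (F x) n)"
proof -
  have "fps_nth (infsum F A) n = (\<Sum>x | x \<in> A \<and> fps_nth (F x) n \<noteq> 0. fps_nth (F x) n)"
    using assms(1) has_sum_fpsD(2) has_sum_infsum by blast
  also have "\<dots> = (\<Sum>x\<in>S. fps_nth (F x) n)"
    using assms by (intro sum.mono_neutral_left) auto
  finally show ?thesis .
qed

section \<open>Iterated sums and exchange of summations\<close>

lemma fps_summable_on_section:
  fixes F :: "'i \<times> 'j \<Rightarrow> 'b :: ab_group_add fps"
  assumes "F summable_on A \<times> B" "x \<in> A"
  shows "(\<lambda>y. F (x, y)) summable_on B"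
  unfolding fps_summable_on_iff
proof
  fix n
  have "finite (snd ` {p \<in> A \<times> B. fps_nth (F p) n \<noteq> 0})"
    using assms(1) unfolding fps_summable_on_iff by auto
  moreover have "{y \<in> B. fps_nth (F (x, y)) n \<noteq> 0} \<subseteq> snd ` {p \<in> A \<times> B. fps_nth (F p) n \<noteq> 0}"
    using assms(2) by force
  ultimately show "finite {y \<in> B. fps_nth (F (x, y)) n \<noteq> 0}"
    by (rule finite_subset[rotated])
qed

lemma fps_has_sum_iterated:
  fixes F :: "'i \<times> 'j \<Rightarrow> 'b :: ab_group_add fps"
  assumes "F summable_on A \<times> B"
  shows "((\<lambda>x. infsum (\<lambda>y. F (x, y)) B) has_sum infsum F (A \<times> B)) A"
  by (rule has_sum_SigmaD[OF has_sum_infsum[OF assms]])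
     (intro has_sum_infsum fps_summable_on_section[OF assms])

lemmas fps_infsum_iterated = infsumI[OF fps_has_sum_iterated, symmetric]

lemma bij_betw_prod_swap: "bij_betw prod.swap (A \<times> B) (B \<times> A)"
  by (simp add: bij_betw_def product_swap)

lemma fps_summable_on_swap:
  fixes F :: "'i \<times> 'j \<Rightarrow> 'b :: ab_group_add fps"
  shows "F summable_on A \<times> B \<longleftrightarrow> (\<lambda>(y, x). F (x, y)) summable_on B \<times> A"
  using summable_on_reindex_bij_betw[OF bij_betw_prod_swap, of F B A]
  by (simp add: case_prod_unfold prod.swap_def)

text \<open>Both orders equal the sum over the product set. Later exchanges of infinite sums rest on
  this; the joint summability is supplied by divisibility by powers of z.\<close>

lemma fps_infsum_swap:
  fixes F :: "'i \<Rightarrow> 'j \<Rightarrow> 'b :: ab_group_add fps"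
  assumes "(\<lambda>(x, y). F x y) summable_on A \<times> B"
  shows "infsum (\<lambda>x. infsum (F x) B) A = infsum (\<lambda>y. infsum (\<lambda>x. F x y) A) B"
proof -
  have "infsum (\<lambda>x. infsum (F x) B) A = infsum (\<lambda>(x, y). F x y) (A \<times> B)"
    using fps_infsum_iterated[OF assms] by simp
  also have "\<dots> = infsum (\<lambda>(y, x). F x y) (B \<times> A)"
    using infsum_reindex_bij_betw[OF bij_betw_prod_swap, of "\<lambda>(x, y). F x y" B A]
    by (simp add: case_prod_unfold prod.swap_def)
  also have "\<dots> = infsum (\<lambda>y. infsum (\<lambda>x. F x y) A) B"
    using fps_infsum_iterated[of "\<lambda>(y, x). F x y" B A] assms fps_summable_on_swap[of "\<lambda>(x, y). F x y" A B]
    by simp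
  finally show ?thesis .
qed

section \<open>Orders of series, expressed as divisibility by powers of z\<close>

lemma fps_X_power_dvd_iff:
  fixes F :: "'a :: comm_ring_1 fps"
  shows "fps_X ^ m dvd F \<longleftrightarrow> (\<forall>n<m. fps_nth F n = 0)"
proof
  assume "fps_X ^ m dvd F"
  then obtain G where "F = fps_X ^ m * G" by (elim dvdE)
  then show "\<forall>n<m. fps_nth F n = 0" by (simp add: fps_X_power_mult_nth)
next
  assume *: "\<forall>n<m. fps_nth F n = 0"
  have "F = fps_X ^ m * fps_shift m F"
    using * by (auto simp: fps_eq_iff fps_X_power_mult_nth)
  then show "fps_X ^ m dvd F" by (rule dvdI)
qed

text \<open>\<open>h\<close> bounds the orders of the terms from below, so only finitely many terms
  reach a given coefficient. With orders written as divisibility, summability reduces to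
  \<open>dvd\<close> rules.\<close>

lemma fps_summable_onI:
  fixes F :: "'i \<Rightarrow> 'a :: comm_ring_1 fps"
  assumes "\<And>x. x \<in> A \<Longrightarrow> fps_X ^ h x dvd F x" "\<And>n. finite {x\<in>A. h x \<le> n}"
  shows "F summable_on A"
  unfolding fps_summable_on_iff
proof
  fix n
  have "{x\<in>A. fps_nth (F x) n \<noteq> 0} \<subseteq> {x\<in>A. h x \<le> n}"
    using assms(1) unfolding fps_X_power_dvd_iff by (auto simp flip: not_less)
  then show "finite {x\<in>A. fps_nth (F x) n \<noteq> 0}"
    using assms(2) finite_subset by blast
qed

lemma fps_summable_on_natI:
  fixes F :: "nat \<Rightarrow> 'a :: comm_ring_1 fps"
  assumes "\<And>i. i \<in> A \<Longrightarrow> fps_X ^ i dvd F i"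
  shows "F summable_on A"
  by (rule fps_summable_onI[where h = "\<lambda>i. i"]) (use assms in auto)

lemma fps_summable_on_shiftI:
  fixes F :: "nat \<Rightarrow> 'a :: comm_ring_1 fps"
  assumes "\<And>k. k \<in> A \<Longrightarrow> fps_X ^ (k - c) dvd F k"
  shows "F summable_on A"
proof (rule fps_summable_onI[where h = "\<lambda>k. k - c"])
  show "finite {k \<in> A. k - c \<le> n}" for n
    by (rule finite_subset[of _ "{..n + c}"]) auto
qed (rule assms)

text \<open>A sum that exists has coefficients below m that are sums of zeros; a sum that does not
  exist is 0 by convention and hence divisible as well.\<close>

lemma fps_X_power_dvd_infsum:
  fixes F :: "'i \<Rightarrow> 'a :: comm_ring_1 fps"
  assumes "\<And>x. x \<in> A \<Longrightarrow> fps_X ^ m dvd F x"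
  shows "fps_X ^ m dvd infsum F A"
proof (cases "F summable_on A")
  case True
  show ?thesis unfolding fps_X_power_dvd_iff
  proof (intro allI impI)
    fix n assume "n < m"
    then show "fps_nth (infsum F A) n = 0"
      using fps_nth_infsum[OF True, of "{}" n] assms by (auto simp: fps_X_power_dvd_iff)
  qed
qed (simp add: infsum_not_exists)

section \<open>Closed walks and plane forests\<close>

text \<open>A tree encodes one excursion: a step away, the excursions of the children one level
  further out, and the step back. A node thus stands for two steps, and the length of the walk is
  twice the number of nodes.\<close>

datatype tree = Node (children: "tree list")

fun tsize :: "tree \<Rightarrow> nat" where
  "tsize (Node ts) = Suc (sum_list (map tsize ts))"

definition fsize :: "tree list \<Rightarrow> nat" where
  "fsize ts = sum_list (map tsize ts)"

definition sub :: "tree list \<Rightarrow> tree list" where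
  "sub ts = concat (map children ts)"

lemma fsize_simps [simp]: "fsize [] = 0" "fsize (t # ts) = tsize t + fsize ts"
  "fsize (ts @ us) = fsize ts + fsize us"
  by (simp_all add: fsize_def)

lemma sub_simps [simp]: "sub [] = []" "sub (t # ts) = children t @ sub ts"
  "sub (ts @ us) = sub ts @ sub us"
  by (simp_all add: sub_def)

lemma tsize_children: "tsize t = Suc (fsize (children t))"
  by (cases t) (simp add: fsize_def)

lemma fsize_sub: "fsize ts = length ts + fsize (sub ts)"
  by (induction ts) (auto simp: tsize_children)

lemma length_le_fsize: "length ts \<le> fsize ts"
  using fsize_sub[of ts] by linarith

definition lev :: "tree list \<Rightarrow> nat \<Rightarrow> nat" where
  "lev ts m = length ((sub ^^ m) ts)"

lemma lev_0 [simp]: "lev ts 0 = length ts"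
  by (simp add: lev_def)

lemma lev_Suc: "lev ts (Suc m) = lev (sub ts) m"
  by (simp add: lev_def funpow_swap1)

lemma lev_append: "lev (ts @ us) m = lev ts m + lev us m"
  by (induction m arbitrary: ts us) (simp_all add: lev_Suc)

lemma lev_Nil [simp]: "lev [] m = 0"
  by (induction m) (simp_all add: lev_Suc)

text \<open>The number of visits at signed distance \<open>x\<close> from the origin of the contour walk of a
  forest: both the steps away from the origin and those back to it start at a visited point.\<close>

definition fvis :: "tree list \<Rightarrow> int \<Rightarrow> nat" where
  "fvis ts x = (if x < 0 then 0 else if x = 0 then length ts else lev ts (nat x) + lev ts (nat (x - 1)))"

lemma fvis_append: "fvis (ts @ us) x = fvis ts x + fvis us x"
  by (simp add: fvis_def lev_append)

lemma fvis_Nil [simp]: "fvis [] x = 0"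
  by (simp add: fvis_def)

lemma fvis_Cons: "fvis (t # ts) x = fvis [t] x + fvis ts x"
  using fvis_append[of "[t]" ts] by simp

lemma lev_single_Suc: "lev [Node ts] (Suc m) = lev ts m"
  by (simp add: lev_Suc)

text \<open>The step away starts at distance 0, the walk of \<open>ts\<close> runs one level further
  out, and the step back starts at distance 1.\<close>

lemma fvis_Node: "fvis [Node ts] x = of_bool (x = 0) + fvis ts (x - 1) + of_bool (x = 1)"
proof -
  consider "x < 0" | "x = 0" | "x = 1" | m where "x = 2 + int m"
  proof -
    have "x < 0 \<or> x = 0 \<or> x = 1 \<or> x = 2 + int (nat (x - 2))" by linarith
    then show ?thesis using that by blast
  qed
  then show ?thesis
  proof cases
    case 4
    have "nat x = Suc (Suc m)" "nat (x - 1) = Suc m" "nat (x - 1 - 1) = m" using 4 by auto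
    then show ?thesis using 4 by (simp add: fvis_def lev_single_Suc)
  next
    case 3
    then show ?thesis using lev_single_Suc[of ts 0] by (simp add: fvis_def)
  qed (auto simp: fvis_def)
qed

text \<open>Only starting points of steps are counted, so the final point of a walk is left out. A
  closed walk then counts its base point once per visit, and the count is compatible with cyclic
  rotation.\<close>

primrec vis :: "int \<Rightarrow> int list \<Rightarrow> int \<Rightarrow> nat" where
  "vis p [] q = 0"
| "vis p (x # xs) q = of_bool (p = q) + vis (p + x) xs q"

lemma vis_append: "vis p (xs @ ys) q = vis p xs q + vis (p + sum_list xs) ys q"
  by (induction xs arbitrary: p) (simp_all add: add.assoc)

lemma vis_shift: "vis (p + c) xs q = vis p xs (q - c)"
proof (induction xs arbitrary: p)
  case (Cons x xs)
  have "p + c + x = (p + x) + c" by simp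
  then have "vis (p + c + x) xs q = vis (p + x) xs (q - c)" using Cons[of "p + x"] by metis
  then show ?case by (simp add: eq_diff_eq)
qed simp

fun steps :: "int \<Rightarrow> tree \<Rightarrow> int list" where
  "steps d (Node ts) = d # concat (map (steps d) ts) @ [-d]"

definition fsteps :: "int \<Rightarrow> tree list \<Rightarrow> int list" where
  "fsteps d ts = concat (map (steps d) ts)"

lemma fsteps_simps [simp]: "fsteps d [] = []" "fsteps d (t # ts) = steps d t @ fsteps d ts"
  by (simp_all add: fsteps_def)

lemma steps_Node: "steps d (Node ts) = d # fsteps d ts @ [-d]"
  by (simp add: fsteps_def)

declare steps.simps [simp del]

lemma steps_basic:
  shows "sum_list (steps d t) = 0 \<and> length (steps d t) = 2 * tsize t \<and> set (steps d t) \<subseteq> {d, -d}"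
proof (induction t)
  case (Node ts)
  then have "sum_list (fsteps d ts) = 0 \<and> length (fsteps d ts) = 2 * fsize ts \<and> set (fsteps d ts) \<subseteq> {d, -d}"
    by (induction ts) auto
  then show ?case by (auto simp: steps_Node fsize_def)
qed

lemma vis_steps:
  assumes "d = 1 \<or> d = -1"
  shows "vis p (steps d t) q = fvis [t] (d * (q - p))"
proof (induction t arbitrary: p)
  case (Node ts)
  have "vis p (fsteps d ts) q = fvis ts (d * (q - p))" for p
    using Node
  proof (induction ts)
    case (Cons t ts)
    have "vis p (fsteps d (t # ts)) q = fvis [t] (d * (q - p)) + fvis ts (d * (q - p))"
      using Cons steps_basic[of d t] by (simp add: vis_append)
    then show ?case by (simp flip: fvis_append)
  qed simp
  moreover have "sum_list (fsteps d ts) = 0"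
    using steps_basic by (induction ts) auto
  ultimately show ?case using assms
    by (auto simp: steps_Node vis_append fvis_Node algebra_simps)
qed

text \<open>Decoding is deterministic: inside a node, the letter \<open>d\<close> announces a
  further child and \<open>-d\<close> closes the node. The two letters differ since \<open>d\<close>
  is nonzero.\<close>

lemma steps_prefix_free:
  assumes "d \<noteq> 0" "steps d t @ xs = steps d t' @ ys"
  shows "t = t' \<and> xs = ys"
  using assms(2)
proof (induction t arbitrary: t' xs ys)
  case (Node ts)
  obtain ts' where t': "t' = Node ts'" by (cases t')
  have hd: "\<exists>zs. steps d t = d # zs" for t by (cases t) (simp add: steps_Node)
  have "fsteps d ts @ -d # xs = fsteps d ts' @ -d # ys"
    using Node.prems t' by (simp add: steps_Node)
  then have "ts = ts' \<and> xs = ys" using Node.IH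
  proof (induction ts arbitrary: ts')
    case Nil
    then show ?case using hd[of "hd ts'"] assms(1) by (cases ts') auto
  next
    case (Cons t ts)
    show ?case
    proof (cases ts')
      case Nil
      then show ?thesis using Cons.prems hd[of t] assms(1) by auto
    next
      case (Cons u us)
      then have "steps d t @ (fsteps d ts @ -d # xs) = steps d u @ (fsteps d us @ -d # ys)"
        using Cons.prems(1) by simp
      then have "t = u" "fsteps d ts @ -d # xs = fsteps d us @ -d # ys"
        using Cons.prems(2)[of t] by auto
      then show ?thesis using Cons.IH[of us] Cons.prems(2) Cons by auto
    qed
  qed
  then show ?case using t' by simp
qed

text \<open>A walk that ends behind its start has to step behind it for a first time; what precedes
  is a sequence of excursions. If the first step is \<open>d\<close>, the induction hypothesis is
  used twice: once to find the matching step back, and once for the remainder, which still ends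
  behind the start.\<close>

lemma parse_excursions:
  assumes d: "d = 1 \<or> d = (-1 :: int)" and "set xs \<subseteq> {1, -1}" "d * sum_list xs < 0"
  shows "\<exists>ts ys. xs = fsteps d ts @ -d # ys"
  using assms(2,3)
proof (induction xs rule: length_induct)
  case (1 xs)
  then obtain x xs' where xs: "xs = x # xs'" by (cases xs) auto
  show ?case
  proof (cases "x = -d")
    case True
    then show ?thesis using xs by (intro exI[of _ "[]"] exI[of _ xs']) simp
  next
    case False
    then have x: "x = d" using 1(2) xs d by auto
    have "d * sum_list xs' < -1" using 1(3) xs x d by auto
    then obtain ts ys where ts: "xs' = fsteps d ts @ -d # ys"
      using 1(1)[rule_format, of xs'] 1(2) xs by auto
    have "sum_list (fsteps d ts) = 0" using steps_basic by (induction ts) auto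
    then have "d * sum_list ys < 0" using \<open>d * sum_list xs' < -1\<close> ts d by auto
    then obtain us zs where us: "ys = fsteps d us @ -d # zs"
      using 1(1)[rule_format, of ys] 1(2) xs ts by auto
    have "xs = fsteps d (Node ts # us) @ -d # zs"
      using xs x ts us by (simp add: steps_Node)
    then show ?thesis by blast
  qed
qed

section \<open>Two-sided forests and closed walks\<close>

definition dir :: "bool \<Rightarrow> int" where "dir b = (if b then 1 else -1)"

definition wsteps :: "(bool \<times> tree) list \<Rightarrow> int list" where
  "wsteps sf = concat (map (\<lambda>(b, t). steps (dir b) t) sf)"

definition right :: "(bool \<times> tree) list \<Rightarrow> tree list" where
  "right sf = map snd (filter fst sf)"

definition left :: "(bool \<times> tree) list \<Rightarrow> tree list" where
  "left sf = map snd (filter (\<lambda>x. \<not> fst x) sf)"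

definition cwalks :: "nat \<Rightarrow> int list set" where
  "cwalks n = {s. set s \<subseteq> {1, -1} \<and> length s = n \<and> sum_list s = 0}"

definition sforests :: "nat \<Rightarrow> nat \<Rightarrow> (bool \<times> tree) list set" where
  "sforests k n = {sf. length sf = k \<and> 2 * fsize (map snd sf) = n}"

lemma wsteps_simps [simp]: "wsteps [] = []" "wsteps ((b, t) # sf) = steps (dir b) t @ wsteps sf"
  by (simp_all add: wsteps_def)

lemma wsteps_basic:
  "sum_list (wsteps sf) = 0 \<and> length (wsteps sf) = 2 * fsize (map snd sf) \<and> set (wsteps sf) \<subseteq> {1, -1}"
proof (induction sf)
  case (Cons a sf)
  then show ?case using steps_basic[of "dir (fst a)" "snd a"]
    by (cases a) (auto simp: dir_def split: if_splits)
qed simp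

text \<open>At the origin the two terms count the right and the left roots, together all of them.
  Elsewhere one of the two arguments is negative and its term is 0.\<close>

lemma vis_wsteps: "vis 0 (wsteps sf) q = fvis (right sf) q + fvis (left sf) (-q)"
proof (induction sf)
  case (Cons a sf)
  obtain b t where a: "a = (b, t)" by (cases a)
  have "vis 0 (wsteps (a # sf)) q = fvis [t] (dir b * q) + (fvis (right sf) q + fvis (left sf) (-q))"
    using Cons a steps_basic[of "dir b" t] vis_steps[of "dir b" 0 t q]
    by (simp add: vis_append dir_def)
  also have "\<dots> = fvis (right (a # sf)) q + fvis (left (a # sf)) (-q)"
    using a fvis_Cons[of t "right sf"] fvis_Cons[of t "left sf"]
    by (cases b) (simp_all add: right_def left_def dir_def)
  finally show ?case .
qed (simp add: right_def left_def)

lemma length_right_left: "length (right sf) + length (left sf) = length sf"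
  by (simp add: right_def left_def sum_length_filter_compl)

lemma vis_wsteps_0: "vis 0 (wsteps sf) 0 = length sf"
  using length_right_left[of sf] by (simp add: vis_wsteps fvis_def)

text \<open>The first letter of the walk fixes the side of the first tree, and
  \<open>steps_prefix_free\<close> then cuts this tree off.\<close>

lemma inj_wsteps: "inj wsteps"
proof (rule injI)
  fix sf sf'
  show "wsteps sf = wsteps sf' \<Longrightarrow> sf = sf'"
  proof (induction sf arbitrary: sf')
    case Nil
    then have "length (map snd sf') \<le> 0"
      using wsteps_basic[of sf'] length_le_fsize[of "map snd sf'"] by simp
    then show ?case by simp
  next
    case (Cons a sf)
    obtain b t where a: "a = (b, t)" by (cases a)
    have hd: "\<exists>zs. steps d t = d # zs" for d t by (cases t) (simp add: steps_Node)
    obtain b' t' us where sf': "sf' = (b', t') # us"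
      using Cons.prems a hd[of "dir b" t] by (cases sf') auto
    have "dir b = dir b'"
      using Cons.prems a sf' hd[of "dir b" t] hd[of "dir b'" t'] by auto
    then have b: "b = b'" by (auto simp: dir_def split: if_splits)
    have "t = t' \<and> wsteps sf = wsteps us"
      by (rule steps_prefix_free[of "dir b"]) (use Cons.prems a sf' b in \<open>auto simp: dir_def\<close>)
    then show ?case using Cons.IH a sf' b by auto
  qed
qed

text \<open>After its first step the walk has to cross back, so \<open>parse_excursions\<close>
  finds the end of the first excursion; what follows is closed again and shorter.\<close>

lemma surj_wsteps:
  assumes "set s \<subseteq> {1, -1}" "sum_list s = 0"
  shows "\<exists>sf. s = wsteps sf"
  using assms
proof (induction s rule: length_induct)
  case (1 s)
  show ?case
  proof (cases s)
    case Nil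
    then show ?thesis by (intro exI[of _ "[]"]) simp
  next
    case (Cons x xs)
    define b where "b = (x = 1)"
    have x: "x = dir b" using Cons 1(2) by (auto simp: b_def dir_def)
    have d: "dir b = 1 \<or> dir b = -1" by (auto simp: dir_def)
    have "dir b * sum_list xs < 0" using 1(3) Cons x d by auto
    then obtain ts ys where ts: "xs = fsteps (dir b) ts @ - dir b # ys"
      using parse_excursions[OF d, of xs] Cons 1(2) by auto
    have "sum_list (fsteps (dir b) ts) = 0" using steps_basic by (induction ts) auto
    then have "sum_list ys = 0" using ts 1(3) Cons x by simp
    then obtain sf where "ys = wsteps sf" using 1(1)[rule_format, of ys] 1(2) Cons ts by auto
    then have "s = wsteps ((b, Node ts) # sf)" using Cons x ts by (simp add: steps_Node)
    then show ?thesis by blast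
  qed
qed

lemma bij_betw_wsteps: "bij_betw wsteps (sforests k n) {s \<in> cwalks n. vis 0 s 0 = k}"
  unfolding bij_betw_def
proof
  show "inj_on wsteps (sforests k n)" using inj_wsteps by (rule inj_on_subset) simp
  show "wsteps ` sforests k n = {s \<in> cwalks n. vis 0 s 0 = k}"
  proof
    show "wsteps ` sforests k n \<subseteq> {s \<in> cwalks n. vis 0 s 0 = k}"
      using wsteps_basic vis_wsteps_0 by (auto simp: sforests_def cwalks_def)
    show "{s \<in> cwalks n. vis 0 s 0 = k} \<subseteq> wsteps ` sforests k n"
    proof
      fix s assume s: "s \<in> {s \<in> cwalks n. vis 0 s 0 = k}"
      then obtain sf where "s = wsteps sf" using surj_wsteps by (auto simp: cwalks_def)
      then show "s \<in> wsteps ` sforests k n"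
        using s wsteps_basic[of sf] vis_wsteps_0[of sf] by (auto simp: sforests_def cwalks_def)
    qed
  qed
qed

lemma finite_cwalks: "finite (cwalks n)"
  by (rule finite_subset[OF _ finite_lists_length_eq[of "{1, -1}" n]]) (auto simp: cwalks_def)

section \<open>Generating functions of forests\<close>

lemma fps_of_nat_mult_nth: "fps_nth (of_nat c * F) n = of_nat c * fps_nth (F :: complex fps) n"
  by (metis fps_mult_left_const_nth fps_of_nat)

definition forests :: "nat \<Rightarrow> nat \<Rightarrow> tree list set" where
  "forests i n = {ts. length ts = i \<and> 2 * fsize ts = n}"

lemma finite_forests: "finite (forests i n)"
proof -
  have "(\<lambda>ts. wsteps (map (Pair True) ts)) ` forests i n \<subseteq> cwalks n"
    using wsteps_basic by (auto simp: forests_def cwalks_def o_def)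
  moreover have "inj (\<lambda>ts. wsteps (map (Pair True) ts))"
  proof (rule injI)
    fix ts us assume "wsteps (map (Pair True) ts) = wsteps (map (Pair True) us)"
    then have "map snd (map (Pair True) ts) = map snd (map (Pair True) us)"
      using inj_wsteps unfolding inj_def by metis
    then show "ts = us" by (simp add: o_def)
  qed
  ultimately show ?thesis
    using finite_cwalks finite_imageD finite_subset inj_on_subset by (metis subset_UNIV)
qed

lemma forests_empty: "n < 2 * i \<Longrightarrow> forests i n = {}"
proof (rule ccontr)
  assume "n < 2 * i" "forests i n \<noteq> {}"
  then obtain ts where "length ts = i" "2 * fsize ts = n" by (auto simp: forests_def)
  then show False using length_le_fsize[of ts] \<open>n < 2 * i\<close> by simp
qed

text \<open>The moment of order i: walks made of i excursions to one side, weighted by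
  \<open>W\<close>, where z marks single steps.\<close>

definition forest_gf :: "(tree list \<Rightarrow> complex) \<Rightarrow> nat \<Rightarrow> complex fps" where
  "forest_gf W i = Abs_fps (\<lambda>n. \<Sum>ts\<in>forests i n. W ts)"

lemma forest_gf_nth: "fps_nth (forest_gf W i) n = (\<Sum>ts\<in>forests i n. W ts)"
  by (simp add: forest_gf_def)

lemma forest_gf_dvd: "fps_X ^ (2 * i) dvd forest_gf W i"
  by (simp add: fps_X_power_dvd_iff forest_gf_nth forests_empty)

lemma forest_gf_dvd': "fps_X ^ i dvd forest_gf W i"
  by (rule dvd_trans[OF le_imp_power_dvd forest_gf_dvd]) simp

lemma forest_gf_0: "forest_gf W 0 = fps_const (W [])"
proof -
  have "forests 0 n = (if n = 0 then {[]} else {})" for n by (auto simp: forests_def)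
  then show ?thesis by (simp add: fps_eq_iff forest_gf_nth)
qed

lemma concat_eq_lengths:
  "map length xss = map length yss \<Longrightarrow> concat xss = concat yss \<Longrightarrow> xss = yss"
proof (induction xss arbitrary: yss)
  case (Cons xs xss)
  then show ?case by (cases yss) auto
qed simp

lemma concat_lengths_ex: "sum_list ns = length xs \<Longrightarrow> \<exists>xss. map length xss = ns \<and> concat xss = xs"
proof (induction ns arbitrary: xs)
  case (Cons n ns)
  then obtain xss where "map length xss = ns" "concat xss = drop n xs"
    using Cons.IH[of "drop n xs"] by (metis add_diff_cancel_left' length_drop sum_list.Cons)
  then show ?case using Cons.prems
    by (intro exI[of _ "take n xs # xss"]) auto
qed simp

text \<open>A forest of i trees with \<open>c\<close> as its list of children is a division of
  \<open>c\<close> into i consecutive, possibly empty blocks. It is determined by the block lengths,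
  so stars and bars applies.\<close>

lemma card_sub_fiber:
  assumes "i \<ge> 1"
  shows "card {ts. length ts = i \<and> sub ts = c} = (i + length c - 1) choose length c"
proof -
  have "bij_betw (map (\<lambda>t. length (children t))) {ts. length ts = i \<and> sub ts = c}
      {l. length l = i \<and> sum_list l = length c}" (is "bij_betw ?f ?S ?T")
    unfolding bij_betw_def
  proof
    show "inj_on ?f ?S"
    proof (rule inj_onI)
      fix ts us assume "ts \<in> ?S" "us \<in> ?S" "?f ts = ?f us"
      then have "map children ts = map children us"
        by (intro concat_eq_lengths) (auto simp: sub_def o_def)
      moreover have "inj children" by (rule injI) (rule tree.expand)
      ultimately show "ts = us" using map_injective by blast
    qed
    show "?f ` ?S = ?T"
    proof
      show "?f ` ?S \<subseteq> ?T" by (auto simp: sub_def length_concat o_def)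
      show "?T \<subseteq> ?f ` ?S"
      proof
        fix l assume l: "l \<in> ?T"
        then obtain xss where "map length xss = l" "concat xss = c" using concat_lengths_ex[of l c] by auto
        then have "map Node xss \<in> ?S" "l = ?f (map Node xss)"
          using l by (auto simp: sub_def o_def)
        then show "l \<in> ?f ` ?S" by blast
      qed
    qed
  qed
  then have "card ?S = card ?T" by (rule bij_betw_same_card)
  then show ?thesis using card_length_sum_list[of i "length c"] assms by (simp add: add.commute)
qed

text \<open>Removing the i roots costs z^(2i), and a list of b children can be attached to them in
  binom(i + b - 1, b) ways. These are the coefficients of (1 - L)^(-i), so umbrally L becomes z^2 /
  (1 - L).\<close>

lemma forest_gf_step:
  assumes "i \<ge> 1" and W: "\<And>ts. length ts = i \<Longrightarrow> W ts = g (sub ts)"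
  shows "forest_gf W i = fps_X ^ (2 * i) * (\<Sum>\<^sub>\<infinity>b. of_nat ((i + b - 1) choose b) * forest_gf g b)"
proof (rule fps_ext)
  fix n
  have summable: "(\<lambda>b. of_nat ((i + b - 1) choose b) * forest_gf g b) summable_on UNIV"
    by (intro fps_summable_on_natI dvd_mult forest_gf_dvd')
  show "fps_nth (forest_gf W i) n = fps_nth (fps_X ^ (2 * i) * (\<Sum>\<^sub>\<infinity>b. of_nat ((i + b - 1) choose b) * forest_gf g b)) n"
  proof (cases "n < 2 * i")
    case True
    then show ?thesis by (simp add: forest_gf_nth forests_empty fps_X_power_mult_nth)
  next
    case False
    define m where "m = n - 2 * i"
    have n: "n = 2 * i + m" using False by (simp add: m_def)
    \<comment> \<open>Each tree costs at least two steps, so a forest with i roots and length 2i + m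
      has at most m children.\<close>
    have sub: "sub ts \<in> (\<Union>b\<le>m. forests b m)" if "ts \<in> forests i n" for ts
    proof -
      have "2 * fsize (sub ts) = m" "length (sub ts) \<le> m"
        using that n fsize_sub[of ts] length_le_fsize[of "sub ts"] unfolding forests_def mem_Collect_eq
        by linarith+
      then show ?thesis by (auto simp: forests_def)
    qed
    have fiber: "{ts \<in> forests i n. sub ts = c} = {ts. length ts = i \<and> sub ts = c}" if "c \<in> forests b m" for b c
    proof -
      have "2 * fsize ts = n" if "length ts = i" "sub ts = c" for ts
        using that \<open>c \<in> forests b m\<close> n fsize_sub[of ts] unfolding forests_def by simp
      then show ?thesis by (auto simp: forests_def)
    qed
    have "fps_nth (forest_gf W i) n = (\<Sum>ts\<in>forests i n. g (sub ts))"
      unfolding forest_gf_nth by (rule sum.cong) (auto simp: forests_def W)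
    also have "\<dots> = (\<Sum>c\<in>(\<Union>b\<le>m. forests b m). \<Sum>ts\<in>{ts \<in> forests i n. sub ts = c}. g (sub ts))"
      by (rule sum.group[symmetric]) (use sub finite_forests in auto)
    also have "\<dots> = (\<Sum>b\<le>m. \<Sum>c\<in>forests b m. \<Sum>ts\<in>{ts \<in> forests i n. sub ts = c}. g (sub ts))"
      by (rule sum.UNION_disjoint) (use finite_forests in \<open>auto simp: forests_def\<close>)
    also have "\<dots> = (\<Sum>b\<le>m. \<Sum>c\<in>forests b m. of_nat ((i + b - 1) choose b) * g c)"
    proof (intro sum.cong refl)
      fix b c assume "c \<in> forests b m"
      moreover have "length c = b" using \<open>c \<in> forests b m\<close> by (simp add: forests_def)
      ultimately show "(\<Sum>ts\<in>{ts \<in> forests i n. sub ts = c}. g (sub ts)) = of_nat ((i + b - 1) choose b) * g c"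
        using fiber[of c b] card_sub_fiber[OF assms(1), of c] by simp
    qed
    also have "\<dots> = (\<Sum>b\<le>m. fps_nth (of_nat ((i + b - 1) choose b) * forest_gf g b) m)"
      by (simp add: forest_gf_nth sum_distrib_left fps_of_nat_mult_nth)
    also have "\<dots> = fps_nth (\<Sum>\<^sub>\<infinity>b. of_nat ((i + b - 1) choose b) * forest_gf g b) m"
      by (rule fps_nth_infsum[OF summable, symmetric])
         (auto simp: forest_gf_nth forests_empty fps_of_nat_mult_nth)
    also have "\<dots> = fps_nth (fps_X ^ (2 * i) * (\<Sum>\<^sub>\<infinity>b. of_nat ((i + b - 1) choose b) * forest_gf g b)) n"
      using n by (simp add: fps_X_power_mult_nth)
    finally show ?thesis .
  qed
qed

text \<open>In \<open>wt\<close> every point away from the origin may be marked, in \<open>mk\<close> exactly one is. A point visited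
  $k$ times carries the mark \<open>\<tau> k\<close>.\<close>

function wt :: "(nat \<Rightarrow> complex) \<Rightarrow> tree list \<Rightarrow> complex" where
  "wt \<tau> ts = (if ts = [] then 1 else (1 + \<tau> (length ts + length (sub ts))) * wt \<tau> (sub ts))"
  by auto
termination
proof (relation "Wellfounded.measure (\<lambda>(\<tau>, ts). fsize ts)")
  fix \<tau> :: "nat \<Rightarrow> complex" and ts :: "tree list"
  assume "ts \<noteq> []"
  then show "((\<tau>, sub ts), (\<tau>, ts)) \<in> Wellfounded.measure (\<lambda>(\<tau>, ts). fsize ts)"
    using fsize_sub[of ts] by (cases ts) auto
qed simp

function mk :: "(nat \<Rightarrow> complex) \<Rightarrow> tree list \<Rightarrow> complex" where
  "mk \<tau> ts = (if ts = [] then 0 else \<tau> (length ts + length (sub ts)) + mk \<tau> (sub ts))"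
  by auto
termination
proof (relation "Wellfounded.measure (\<lambda>(\<tau>, ts). fsize ts)")
  fix \<tau> :: "nat \<Rightarrow> complex" and ts :: "tree list"
  assume "ts \<noteq> []"
  then show "((\<tau>, sub ts), (\<tau>, ts)) \<in> Wellfounded.measure (\<lambda>(\<tau>, ts). fsize ts)"
    using fsize_sub[of ts] by (cases ts) auto
qed simp

declare wt.simps [simp del] mk.simps [simp del]

lemma fvis_1: "fvis ts 1 = length ts + length (sub ts)"
  using lev_Suc[of ts 0] by (simp add: fvis_def)

lemma fvis_Suc_Suc: "fvis ts (int (Suc (Suc m))) = fvis (sub ts) (int (Suc m))"
proof -
  have "nat (int (Suc (Suc m)) - 1) = Suc m" "nat (int (Suc m) - 1) = m"
    "nat (int (Suc (Suc m))) = Suc (Suc m)" "nat (int (Suc m)) = Suc m"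
    by linarith+
  then show ?thesis unfolding fvis_def by (simp add: lev_Suc)
qed

text \<open>The recursion of \<open>wt\<close> strips one level at a time, and the nearest point is
  visited once per root and once per child. Since \<open>\<tau> 0 = 0\<close>, the factors beyond
  the height of the forest are 1, so any \<open>M\<close> from the size on may serve as the upper
  end.\<close>

lemma wt_eq_prod:
  assumes "\<tau> 0 = 0" "fsize ts \<le> M"
  shows "wt \<tau> ts = (\<Prod>m=1..M. 1 + \<tau> (fvis ts (int m)))"
  using assms(2)
proof (induction M arbitrary: ts)
  case 0
  then show ?case using length_le_fsize[of ts] by (simp add: wt.simps[of \<tau> "[]"])
next
  case (Suc M)
  show ?case
  proof (cases "ts = []")
    case False
    then have "fsize (sub ts) \<le> M" using Suc.prems fsize_sub[of ts] by (cases ts) auto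
    then have "wt \<tau> ts = (1 + \<tau> (fvis ts (int 1))) * (\<Prod>m=1..M. 1 + \<tau> (fvis (sub ts) (int m)))"
      using False Suc.IH by (simp add: wt.simps[of \<tau> ts] fvis_1)
    also have "(\<Prod>m=1..M. 1 + \<tau> (fvis (sub ts) (int m))) = (\<Prod>m=1..M. 1 + \<tau> (fvis ts (int (Suc m))))"
      by (intro prod.cong refl) (metis Suc_pred' atLeastAtMost_iff fvis_Suc_Suc less_eq_Suc_le One_nat_def)
    also have "(1 + \<tau> (fvis ts (int 1))) * \<dots> = (\<Prod>m=1..Suc M. 1 + \<tau> (fvis ts (int m)))"
      by (subst prod.atLeast_Suc_atMost) (simp_all only: prod.shift_bounds_cl_Suc_ivl One_nat_def le_add1 plus_1_eq_Suc Suc_le_mono le0)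
    finally show ?thesis .
  qed (simp add: wt.simps assms(1))
qed

lemma mk_eq_sum:
  assumes "\<tau> 0 = 0" "fsize ts \<le> M"
  shows "mk \<tau> ts = (\<Sum>m=1..M. \<tau> (fvis ts (int m)))"
  using assms(2)
proof (induction M arbitrary: ts)
  case 0
  then show ?case using length_le_fsize[of ts] by (simp add: mk.simps[of \<tau> "[]"])
next
  case (Suc M)
  show ?case
  proof (cases "ts = []")
    case False
    then have "fsize (sub ts) \<le> M" using Suc.prems fsize_sub[of ts] by (cases ts) auto
    then have "mk \<tau> ts = \<tau> (fvis ts (int 1)) + (\<Sum>m=1..M. \<tau> (fvis (sub ts) (int m)))"
      using False Suc.IH by (simp add: mk.simps[of \<tau> ts] fvis_1)
    also have "(\<Sum>m=1..M. \<tau> (fvis (sub ts) (int m))) = (\<Sum>m=1..M. \<tau> (fvis ts (int (Suc m))))"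
      by (intro sum.cong refl) (metis Suc_pred' atLeastAtMost_iff fvis_Suc_Suc less_eq_Suc_le One_nat_def)
    also have "\<tau> (fvis ts (int 1)) + \<dots> = (\<Sum>m=1..Suc M. \<tau> (fvis ts (int m)))"
      by (subst sum.atLeast_Suc_atMost) (simp_all only: sum.shift_bounds_cl_Suc_ivl One_nat_def le_add1 plus_1_eq_Suc Suc_le_mono le0)
    finally show ?thesis .
  qed (simp add: mk.simps assms(1))
qed

section \<open>Interleavings of the two sides\<close>

lemma sforests_fiber:
  "{sf. right sf = r \<and> left sf = l} = shuffles (map (Pair True) r) (map (Pair False) l)"
proof -
  have R: "filter (\<lambda>x. fst x) sf = map (Pair True) (right sf)" for sf :: "(bool \<times> tree) list"
    unfolding right_def map_map by (rule map_idI[symmetric]) auto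
  have L: "filter (\<lambda>x. \<not> fst x) sf = map (Pair False) (left sf)" for sf :: "(bool \<times> tree) list"
    unfolding left_def map_map by (rule map_idI[symmetric]) auto
  have inj: "map (Pair c) xs = map (Pair c) ys \<longleftrightarrow> xs = ys" for c :: bool and xs ys :: "tree list"
    by (rule inj_map_eq_map) (simp add: inj_def)
  have "{sf. right sf = r \<and> left sf = l} = partition fst -` {(map (Pair True) r, map (Pair False) l)}"
    unfolding vimage_def partition_filter_conv comp_def R L by (simp add: inj)
  also have "\<dots> = shuffles (map (Pair True) r) (map (Pair False) l)"
    by (rule inv_image_partition) auto
  finally show ?thesis .
qed

text \<open>The side tags make the two lists disjoint, so their shuffles are counted by a binomial
  coefficient.\<close>

lemma card_sforests_fiber: "card {sf. right sf = r \<and> left sf = l} = (length r + length l) choose length r"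
  unfolding sforests_fiber by (subst card_disjoint_shuffles) auto

lemma fsize_right_left: "fsize (right sf) + fsize (left sf) = fsize (map snd sf)"
  by (induction sf) (auto simp: right_def left_def)

lemma finite_sforests: "finite (sforests k n)"
  using bij_betw_finite[OF bij_betw_wsteps] finite_cwalks by simp

text \<open>A two-sided forest is a left forest, a right forest and an interleaving of their trees.
  Hence weights that factor over the sides give a binomial convolution of moments, with i trees on
  the left.\<close>

lemma sum_sforests:
  "(\<Sum>sf\<in>sforests k n. L (left sf) * R (right sf)) =
   fps_nth (\<Sum>i\<le>k. of_nat (k choose i) * (forest_gf L i * forest_gf R (k - i))) n"
proof -
  define T where "T = (\<Union>i\<le>k. \<Union>j\<le>n. forests i j \<times> forests (k - i) (n - j))"
  have T: "(left sf, right sf) \<in> T" if "sf \<in> sforests k n" for sf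
    using that length_right_left[of sf] fsize_right_left[of sf]
    by (auto simp: T_def sforests_def forests_def intro!: bexI[of _ "length (left sf)"] bexI[of _ "2 * fsize (left sf)"])
  have fiber: "{sf \<in> sforests k n. (left sf, right sf) = (l, r)} = {sf. right sf = r \<and> left sf = l}"
    if "(l, r) \<in> T" for l r
  proof -
    have "sf \<in> sforests k n" if "right sf = r" "left sf = l" for sf
      using that \<open>(l, r) \<in> T\<close> length_right_left[of sf] fsize_right_left[of sf]
      by (auto simp: T_def sforests_def forests_def)
    then show ?thesis by auto
  qed
  have fin: "finite T" unfolding T_def using finite_forests by auto
  have "(\<Sum>sf\<in>sforests k n. L (left sf) * R (right sf)) =
     (\<Sum>p\<in>T. \<Sum>sf\<in>{sf \<in> sforests k n. (left sf, right sf) = p}. L (left sf) * R (right sf))"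
    by (rule sum.group[symmetric]) (use T fin finite_sforests in auto)
  also have "\<dots> = (\<Sum>(l, r)\<in>T. of_nat (k choose length l) * (L l * R r))"
  proof (intro sum.cong refl)
    fix p assume p: "p \<in> T"
    obtain l r where lr: "p = (l, r)" by (cases p)
    have len: "length r + length l = k" "length l \<le> k" using p lr by (auto simp: T_def forests_def)
    then have "k choose length r = k choose length l"
      by (subst binomial_symmetric) auto
    then have "card {sf \<in> sforests k n. (left sf, right sf) = p} = k choose length l"
      using p lr fiber[of l r] card_sforests_fiber[of r l] len by simp
    moreover have "(\<Sum>sf\<in>{sf \<in> sforests k n. (left sf, right sf) = p}. L (left sf) * R (right sf))
      = (\<Sum>sf\<in>{sf \<in> sforests k n. (left sf, right sf) = p}. L l * R r)"
      using lr by (intro sum.cong) auto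
    ultimately show "(\<Sum>sf\<in>{sf \<in> sforests k n. (left sf, right sf) = p}. L (left sf) * R (right sf)) =
      (case p of (l, r) \<Rightarrow> of_nat (k choose length l) * (L l * R r))"
      using lr by simp
  qed
  also have "\<dots> = (\<Sum>i\<le>k. \<Sum>j\<le>n. \<Sum>(l, r)\<in>forests i j \<times> forests (k - i) (n - j). of_nat (k choose length l) * (L l * R r))"
    unfolding T_def
    apply (subst sum.UNION_disjoint)
       apply (use finite_forests in \<open>auto simp: forests_def\<close>)[3]
    apply (intro sum.cong refl)
    apply (subst sum.UNION_disjoint)
       apply (use finite_forests in \<open>auto simp: forests_def\<close>)
    done
  also have "\<dots> = (\<Sum>i\<le>k. \<Sum>j\<le>n. of_nat (k choose i) * ((\<Sum>l\<in>forests i j. L l) * (\<Sum>r\<in>forests (k - i) (n - j). R r)))"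
  proof (intro sum.cong refl)
    fix i j
    have "(\<Sum>(l, r)\<in>forests i j \<times> forests (k - i) (n - j). of_nat (k choose length l) * (L l * R r)) =
      (\<Sum>(l, r)\<in>forests i j \<times> forests (k - i) (n - j). of_nat (k choose i) * (L l * R r))"
      by (intro sum.cong) (auto simp: forests_def)
    also have "\<dots> = of_nat (k choose i) * ((\<Sum>l\<in>forests i j. L l) * (\<Sum>r\<in>forests (k - i) (n - j). R r))"
      unfolding sum_product sum.cartesian_product by (simp add: sum_distrib_left case_prod_unfold)
    finally show "(\<Sum>(l, r)\<in>forests i j \<times> forests (k - i) (n - j). of_nat (k choose length l) * (L l * R r)) =
      of_nat (k choose i) * ((\<Sum>l\<in>forests i j. L l) * (\<Sum>r\<in>forests (k - i) (n - j). R r))" .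
  qed
  also have "\<dots> = fps_nth (\<Sum>i\<le>k. of_nat (k choose i) * (forest_gf L i * forest_gf R (k - i))) n"
    unfolding fps_sum_nth fps_of_nat_mult_nth
    unfolding fps_mult_nth forest_gf_nth atLeast0AtMost sum_distrib_left by (rule refl)
  finally show ?thesis .
qed

section \<open>Rerooting and marked points\<close>

lemma vis_eq_sum: "vis p s q = (\<Sum>j<length s. of_bool (p + sum_list (take j s) = q))"
  by (induction s arbitrary: p) (simp_all add: sum.lessThan_Suc_shift add.assoc del: sum.lessThan_Suc)

lemma abs_sum_list_le: "set s \<subseteq> {1, -1} \<Longrightarrow> \<bar>sum_list s\<bar> \<le> int (length s)"
  by (induction s) auto

lemma position_bound:
  assumes "s \<in> cwalks n" "j < n"
  shows "sum_list (take j s) \<in> {- int n..int n}"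
proof -
  have "set (take j s) \<subseteq> {1, -1}" using assms set_take_subset[of j s] unfolding cwalks_def by blast
  then show ?thesis using abs_sum_list_le[of "take j s"] assms by (auto simp: cwalks_def)
qed

lemma vis_outside: "s \<in> cwalks n \<Longrightarrow> q \<notin> {- int n..int n} \<Longrightarrow> vis 0 s q = 0"
  using position_bound by (fastforce simp: vis_eq_sum cwalks_def)

lemma vis_le: "s \<in> cwalks n \<Longrightarrow> vis 0 s q \<le> n"
  using sum_bounded_above[of "{..<n}" "\<lambda>j. of_bool (sum_list (take j s) = q)" "1::nat"]
  by (auto simp: vis_eq_sum cwalks_def)

lemma sum_list_rotate: "sum_list (rotate j s) = sum_list (s :: int list)"
proof (induction j)
  case (Suc j)
  have "sum_list (rotate1 t) = sum_list t" for t :: "int list" by (cases t) auto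
  then show ?case using Suc by simp
qed simp

lemma vis_rotate:
  assumes "s \<in> cwalks n" "j \<le> n"
  shows "vis 0 (rotate j s) q = vis 0 s (q + sum_list (take j s))"
  using assms(2)
proof (induction j arbitrary: q)
  case (Suc j)
  have n: "length s = n" "sum_list s = 0" using assms(1) by (auto simp: cwalks_def)
  obtain x xs where r: "rotate j s = x # xs"
    using Suc.prems n by (cases "rotate j s") auto
  have "x = s ! j"
    using hd_rotate_conv_nth[of s j] r n Suc.prems by (cases "s = []") auto
  then have take: "sum_list (take (Suc j) s) = sum_list (take j s) + x"
    using Suc.prems n by (simp add: take_Suc_conv_app_nth)
  have "sum_list (rotate j s) = 0" using n(2) by (simp add: sum_list_rotate)
  then have "sum_list xs = - x" using r by simp
  \<comment> \<open>Moving one step from the front to the end recentres the walk by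
    \<open>x\<close>: the visit that was counted at the start is now counted at the last step, which
    begins at \<open>-x\<close>.\<close>
  then have "vis 0 (rotate (Suc j) s) q = vis 0 (rotate j s) (q + x)"
    using r vis_shift[of 0 x xs "q + x"] by (auto simp: vis_append)
  then show ?case using Suc take by (simp add: algebra_simps)
qed simp

lemma bij_betw_rotate: "bij_betw (rotate j) (cwalks n) (cwalks n)"
proof -
  have "inj_on (rotate j) (cwalks n)"
  proof (rule inj_on_subset[OF _ subset_UNIV])
    show "inj (rotate j)"
      unfolding rotate_def by (rule inj_fn[OF inj_rotate1])
  qed
  moreover have "rotate j ` cwalks n \<subseteq> cwalks n"
    by (auto simp: cwalks_def sum_list_rotate)
  ultimately show ?thesis
    unfolding bij_betw_def using endo_inj_surj[OF finite_cwalks] by blast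
qed

text \<open>Rerooting a closed walk at one of its visits to \<open>q\<close> moves \<open>q\<close> to the origin.\<close>

lemma sum_cwalks_reroot:
  fixes \<tau> :: "nat \<Rightarrow> complex" and g :: "(int \<Rightarrow> nat) \<Rightarrow> complex"
  assumes "\<tau> 0 = 0"
  shows "(\<Sum>s\<in>cwalks n. \<Sum>q\<in>{- int n..int n}. \<tau> (vis 0 s q) * g (\<lambda>x. vis 0 s (q + x)))
       = of_nat n * (\<Sum>s\<in>cwalks n. \<tau> (vis 0 s 0) / of_nat (vis 0 s 0) * g (vis 0 s))"
proof -
  \<comment> \<open>The weight of \<open>q\<close> is spread evenly over the times at which the walk
    is at \<open>q\<close>; summing over these times restores it. Unvisited points cause no trouble
    because \<open>\<tau> 0 = 0\<close>.\<close>
  define h where "h s q = \<tau> (vis 0 s q) / of_nat (vis 0 s q) * g (\<lambda>x. vis 0 s (q + x))" for s q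
  have "(\<Sum>q\<in>{- int n..int n}. \<tau> (vis 0 s q) * g (\<lambda>x. vis 0 s (q + x))) = (\<Sum>j<n. h (rotate j s) 0)"
    if s: "s \<in> cwalks n" for s
  proof -
    have "\<tau> (vis 0 s q) * g (\<lambda>x. vis 0 s (q + x)) = (\<Sum>j<n. of_bool (sum_list (take j s) = q) * h s q)" for q
    proof -
      have "(\<Sum>j<n. of_bool (sum_list (take j s) = q) * h s q) = of_nat (vis 0 s q) * h s q"
        using s unfolding sum_distrib_right[symmetric] by (simp add: vis_eq_sum cwalks_def)
      then show ?thesis using assms by (simp add: h_def)
    qed
    then have "(\<Sum>q\<in>{- int n..int n}. \<tau> (vis 0 s q) * g (\<lambda>x. vis 0 s (q + x)))
      = (\<Sum>q\<in>{- int n..int n}. \<Sum>j<n. of_bool (sum_list (take j s) = q) * h s q)" by simp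
    also have "\<dots> = (\<Sum>j<n. \<Sum>q\<in>{- int n..int n}. of_bool (sum_list (take j s) = q) * h s q)"
      by (rule sum.swap)
    also have "\<dots> = (\<Sum>j<n. h (rotate j s) 0)"
    proof (rule sum.cong)
      fix j assume "j \<in> {..<n}"
      then have j: "j < n" by simp
      have "(\<Sum>q\<in>{- int n..int n}. of_bool (sum_list (take j s) = q) * h s q) = h s (sum_list (take j s))"
        using position_bound[OF s j] by (subst sum.remove[of _ "sum_list (take j s)"]) auto
      also have "\<dots> = h (rotate j s) 0"
        using vis_rotate[OF s less_imp_le[OF j]] by (simp add: h_def add.commute)
      finally show "(\<Sum>q\<in>{- int n..int n}. of_bool (sum_list (take j s) = q) * h s q) = h (rotate j s) 0" .
    qed simp
    finally show ?thesis .
  qed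
  then have "(\<Sum>s\<in>cwalks n. \<Sum>q\<in>{- int n..int n}. \<tau> (vis 0 s q) * g (\<lambda>x. vis 0 s (q + x)))
    = (\<Sum>j<n. \<Sum>s\<in>cwalks n. h (rotate j s) 0)" by (simp add: sum.swap[of _ "cwalks n"])
  \<comment> \<open>Each rotation permutes the closed walks, so all n starting times contribute
    equally. This is the factor that becomes z d/dz.\<close>
  also have "\<dots> = (\<Sum>j<n. \<Sum>s\<in>cwalks n. h s 0)"
    by (intro sum.cong refl sum.reindex_bij_betw bij_betw_rotate)
  finally show ?thesis by (simp add: h_def)
qed

text \<open>Nonempty subsets are classified by their largest element.\<close>

lemma telescoping_prod:
  fixes x :: "nat \<Rightarrow> 'a :: comm_ring_1"
  shows "(\<Sum>m<M. x m * (\<Prod>i<m. 1 + x i)) = (\<Prod>m<M. 1 + x m) - 1"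
  by (induction M) (simp_all add: algebra_simps)

text \<open>Every subset with at least two elements is classified by its second largest element.\<close>

lemma prod_second_largest:
  fixes x :: "nat \<Rightarrow> 'a :: comm_ring_1"
  shows "(\<Prod>m<M. 1 + x m) =
    1 + (\<Sum>m<M. x m) + (\<Sum>m<M. x m * ((\<Prod>i<m. 1 + x i) * (\<Sum>i\<in>{m<..<M}. x i)))"
proof (induction M)
  case (Suc M)
  have ivl: "{m<..<Suc M} = insert M {m<..<M}" if "m < M" for m using that by auto
  have "(\<Sum>m<Suc M. x m * ((\<Prod>i<m. 1 + x i) * (\<Sum>i\<in>{m<..<Suc M}. x i)))
    = (\<Sum>m<M. x m * ((\<Prod>i<m. 1 + x i) * (\<Sum>i\<in>{m<..<Suc M}. x i)))"
  proof -
    have "{M<..<Suc M} = {}" by auto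
    then show ?thesis by simp
  qed
  also have "\<dots> = (\<Sum>m<M. x m * ((\<Prod>i<m. 1 + x i) * (\<Sum>i\<in>{m<..<M}. x i)) + (x m * (\<Prod>i<m. 1 + x i)) * x M)"
    by (intro sum.cong refl) (simp add: ivl algebra_simps)
  also have "\<dots> = (\<Sum>m<M. x m * ((\<Prod>i<m. 1 + x i) * (\<Sum>i\<in>{m<..<M}. x i))) + ((\<Prod>m<M. 1 + x m) - 1) * x M"
    by (simp add: sum.distrib telescoping_prod flip: sum_distrib_right)
  finally show ?case using Suc by (simp add: algebra_simps)
qed simp

text \<open>The window is shifted to the indices 0, ..., 2n and \<open>prod_second_largest\<close>
  is applied. The inner ranges are the same for every \<open>q\<close>, so the summand is a function
  of the walk as seen from \<open>q\<close>, which is what rerooting asks for; off the window the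
  factors are 1 and the terms 0.\<close>

lemma prod_marks:
  fixes x :: "int \<Rightarrow> complex"
  assumes x: "\<And>q. q \<notin> {- int n..int n} \<Longrightarrow> x q = 0"
  shows "(\<Prod>q\<in>{- int n..int n}. 1 + x q) = 1 + (\<Sum>q\<in>{- int n..int n}. x q) +
    (\<Sum>q\<in>{- int n..int n}. x q * ((\<Prod>e=1..2*n. 1 + x (q + - int e)) * (\<Sum>e=1..2*n. x (q + int e))))"
proof -
  define y where "y m = x (int m - int n)" for m
  have bij: "bij_betw (\<lambda>m. int m - int n) {..<2*n+1} {- int n..int n}"
    by (rule bij_betw_byWitness[where f' = "\<lambda>q. nat (q + int n)"]) auto
  have P: "(\<Prod>e=1..2*n. 1 + x (int m - int n + - int e)) = (\<Prod>i<m. 1 + y i)" if "m < 2*n+1" for m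
  proof -
    have "(\<Prod>e=1..2*n. 1 + x (int m - int n + - int e)) = (\<Prod>e=1..m. 1 + x (int m - int n + - int e))"
      by (rule prod.mono_neutral_right) (use that x in auto)
    also have "\<dots> = (\<Prod>i<m. 1 + y i)"
      by (rule prod.reindex_bij_witness[where i = "\<lambda>i. m - i" and j = "\<lambda>e. m - e"])
         (auto simp: y_def of_nat_diff algebra_simps)
    finally show ?thesis .
  qed
  have S: "(\<Sum>e=1..2*n. x (int m - int n + int e)) = (\<Sum>i\<in>{m<..<2*n+1}. y i)" if "m < 2*n+1" for m
  proof -
    have "(\<Sum>e=1..2*n. x (int m - int n + int e)) = (\<Sum>e=1..2*n-m. x (int m - int n + int e))"
      by (rule sum.mono_neutral_right) (use that x in auto)
    also have "\<dots> = (\<Sum>i\<in>{m<..<2*n+1}. y i)"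
      by (rule sum.reindex_bij_witness[where i = "\<lambda>i. i - m" and j = "\<lambda>e. e + m"])
         (use that in \<open>auto simp: y_def of_nat_diff algebra_simps\<close>)
    finally show ?thesis .
  qed
  show ?thesis
    unfolding sum.reindex_bij_betw[OF bij, symmetric] prod.reindex_bij_betw[OF bij, symmetric]
    using prod_second_largest[of y "2*n+1"] P S by (simp add: y_def)
qed

lemma prod_left_wt:
  assumes "\<tau> 0 = 0" "sf \<in> sforests k n"
  shows "(\<Prod>e=1..2*n. 1 + \<tau> (vis 0 (wsteps sf) (- int e))) = wt \<tau> (left sf)"
proof -
  have "fsize (left sf) \<le> 2 * n"
    using assms(2) fsize_right_left[of sf] by (auto simp: sforests_def)
  moreover have "vis 0 (wsteps sf) (- int e) = fvis (left sf) (int e)" if "e \<ge> 1" for e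
    using that by (simp add: vis_wsteps fvis_def)
  ultimately show ?thesis using wt_eq_prod[of \<tau> "left sf" "2 * n"] assms(1) by simp
qed

lemma sum_right_mk:
  assumes "\<tau> 0 = 0" "sf \<in> sforests k n"
  shows "(\<Sum>e=1..2*n. \<tau> (vis 0 (wsteps sf) (int e))) = mk \<tau> (right sf)"
proof -
  have "fsize (right sf) \<le> 2 * n"
    using assms(2) fsize_right_left[of sf] by (auto simp: sforests_def)
  moreover have "vis 0 (wsteps sf) (int e) = fvis (right sf) (int e)" if "e \<ge> 1" for e
    using that by (simp add: vis_wsteps fvis_def)
  ultimately show ?thesis using mk_eq_sum[of \<tau> "right sf" "2 * n"] assms(1) by simp
qed

lemma sum_cwalks_by_visits:
  "(\<Sum>s\<in>cwalks n. h (vis 0 s 0) s) = (\<Sum>k\<le>n. \<Sum>sf\<in>sforests k n. h k (wsteps sf))"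
  for h :: "nat \<Rightarrow> int list \<Rightarrow> complex"
proof -
  have "(\<Sum>s\<in>cwalks n. h (vis 0 s 0) s) = (\<Sum>k\<le>n. \<Sum>s\<in>{s \<in> cwalks n. vis 0 s 0 = k}. h (vis 0 s 0) s)"
    by (rule sum.group[symmetric]) (auto simp: finite_cwalks vis_le)
  also have "\<dots> = (\<Sum>k\<le>n. \<Sum>sf\<in>sforests k n. h k (wsteps sf))"
    by (intro sum.cong refl trans[OF sum.reindex_bij_betw[OF bij_betw_wsteps, symmetric]])
       (auto simp: vis_wsteps_0 sforests_def)
  finally show ?thesis .
qed

text \<open>No mark leaves the bare number of walks. Otherwise the walk is rerooted at its only
  mark, which gives unweighted forests on both sides, or at the second largest mark: then arbitrary
  marks lie on its left (\<open>wt\<close>) and exactly one on its right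
  (\<open>mk\<close>).\<close>

lemma sum_cwalks_prod:
  assumes \<tau>: "\<tau> 0 = 0"
  shows "(\<Sum>s\<in>cwalks n. \<Prod>q\<in>{- int n..int n}. 1 + \<tau> (vis 0 s q)) =
    of_nat (card (cwalks n)) + of_nat n * (\<Sum>k\<le>n. \<tau> k / of_nat k *
       (fps_nth (\<Sum>i\<le>k. of_nat (k choose i) * (forest_gf (\<lambda>_. 1) i * forest_gf (\<lambda>_. 1) (k - i))) n
        + fps_nth (\<Sum>i\<le>k. of_nat (k choose i) * (forest_gf (wt \<tau>) i * forest_gf (mk \<tau>) (k - i))) n))"
proof -
  define L where "L v = (\<Prod>e=1..2*n. 1 + \<tau> (v (- int e)))" for v :: "int \<Rightarrow> nat"
  define R where "R v = (\<Sum>e=1..2*n. \<tau> (v (int e)))" for v :: "int \<Rightarrow> nat"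
  define I where "I = {- int n..int n}"
  have "(\<Prod>q\<in>I. 1 + \<tau> (vis 0 s q)) = 1 + (\<Sum>q\<in>I. \<tau> (vis 0 s q) *
      (1 + L (\<lambda>x. vis 0 s (q + x)) * R (\<lambda>x. vis 0 s (q + x))))" if "s \<in> cwalks n" for s
    using prod_marks[of n "\<lambda>q. \<tau> (vis 0 s q)"] vis_outside[OF that] \<tau>
    unfolding L_def R_def I_def by (simp add: distrib_left sum.distrib)
  then have "(\<Sum>s\<in>cwalks n. \<Prod>q\<in>I. 1 + \<tau> (vis 0 s q)) = of_nat (card (cwalks n)) +
     (\<Sum>s\<in>cwalks n. \<Sum>q\<in>I. \<tau> (vis 0 s q) * (1 + L (\<lambda>x. vis 0 s (q + x)) * R (\<lambda>x. vis 0 s (q + x))))"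
    by (simp add: sum.distrib)
  also have "(\<Sum>s\<in>cwalks n. \<Sum>q\<in>I. \<tau> (vis 0 s q) * (1 + L (\<lambda>x. vis 0 s (q + x)) * R (\<lambda>x. vis 0 s (q + x))))
    = of_nat n * (\<Sum>s\<in>cwalks n. \<tau> (vis 0 s 0) / of_nat (vis 0 s 0) * (1 + L (vis 0 s) * R (vis 0 s)))"
    unfolding I_def by (rule sum_cwalks_reroot[of \<tau> "\<lambda>v. 1 + L v * R v" n, OF \<tau>])
  also have "(\<Sum>s\<in>cwalks n. \<tau> (vis 0 s 0) / of_nat (vis 0 s 0) * (1 + L (vis 0 s) * R (vis 0 s)))
    = (\<Sum>k\<le>n. \<Sum>sf\<in>sforests k n. \<tau> k / of_nat k * (1 + L (vis 0 (wsteps sf)) * R (vis 0 (wsteps sf))))"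
    by (rule sum_cwalks_by_visits[where h = "\<lambda>k s. \<tau> k / of_nat k * (1 + L (vis 0 s) * R (vis 0 s))"])
  also have "\<dots> = (\<Sum>k\<le>n. \<tau> k / of_nat k * ((\<Sum>sf\<in>sforests k n. 1 * 1)
      + (\<Sum>sf\<in>sforests k n. wt \<tau> (left sf) * mk \<tau> (right sf))))"
    unfolding sum.distrib[symmetric] sum_distrib_left
    unfolding L_def R_def
    by (intro sum.cong refl) (simp only: prod_left_wt[of \<tau>, OF \<tau>] sum_right_mk[of \<tau>, OF \<tau>] mult_1)
  finally show ?thesis
    unfolding sum_sforests[where L = "\<lambda>_. 1" and R = "\<lambda>_. 1"] sum_sforests[where L = "wt \<tau>" and R = "mk \<tau>"]
      I_def .
qed

lemma card_cwalks:
  "of_nat (card (cwalks n)) =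
     (\<Sum>k\<le>n. fps_nth (\<Sum>i\<le>k. of_nat (k choose i) * (forest_gf (\<lambda>_. 1) i * forest_gf (\<lambda>_. 1) (k - i))) n)"
proof -
  have "of_nat (card (cwalks n)) = (\<Sum>s\<in>cwalks n. 1 * (1 :: complex))"
    by (simp only: mult_1 sum_constant mult_1_right)
  also have "\<dots> = (\<Sum>k\<le>n. \<Sum>sf\<in>sforests k n. 1 * 1)"
    by (rule sum_cwalks_by_visits[of "\<lambda>_ _. 1 * 1" n])
  finally show ?thesis unfolding sum_sforests[where L = "\<lambda>_. 1" and R = "\<lambda>_. 1"] .
qed

text \<open>Interior times have weight 2 by definition; the base point gets 1 from each end of the
  walk, which together weigh as much as one interior visit.\<close>

lemma mu_eq:
  assumes "s \<in> cwalks n" "n \<ge> 1"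
  shows "mu q (0, s) = 2 * vis 0 s q"
proof -
  have n: "length s = n" "sum_list s = 0" using assms(1) by (auto simp: cwalks_def)
  have "vis 0 s q = of_bool (q = 0) + (\<Sum>i\<in>{1..<n}. of_bool (q = sum_list (take i s)))"
  proof -
    have "vis 0 s q = (\<Sum>i\<in>insert 0 {1..<n}. of_bool (q = sum_list (take i s)))"
      unfolding vis_eq_sum using assms(2) n by (intro sum.cong) auto
    then show ?thesis by simp
  qed
  then show ?thesis using n by (simp add: mu_def walk_length_def walk_point_def)
qed

text \<open>Points are grouped by their number of visits, and every visited point contributes
  exp(\<Lambda>) = 1 + t. The case distinction gives unvisited points the factor 1, whatever the
  value of \<open>\<Lambda> 0\<close>.\<close>

lemma exp_sum_num_mult:
  assumes s: "s \<in> cwalks n" and n: "n \<ge> 1"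
  shows "exp (\<Sum>\<^sub>\<infinity>k\<in>{1..}. \<Lambda> k * of_nat (num_mult (2 * k) (0, s)))
    = (\<Prod>q\<in>{- int n..int n}. 1 + (if vis 0 s q = 0 then 0 else tvar \<Lambda> (vis 0 s q)))"
proof -
  define I where "I = {- int n..int n}"
  have fin: "finite {q\<in>I. vis 0 s q \<noteq> 0}"
    by (rule finite_subset[of _ I]) (auto simp: I_def)
  have num: "num_mult (2 * k) (0, s) = card {q \<in> I. vis 0 s q = k}" if "k \<ge> 1" for k
  proof -
    have "{q. mu q (0, s) = 2 * k} = {q \<in> I. vis 0 s q = k}"
      using that vis_outside[OF s] unfolding mu_eq[OF s n] I_def by fastforce
    then show ?thesis by (simp add: num_mult_def)
  qed
  have "(\<Sum>\<^sub>\<infinity>k\<in>{1..}. \<Lambda> k * of_nat (num_mult (2 * k) (0, s))) = (\<Sum>\<^sub>\<infinity>k\<in>{1..n}. \<Lambda> k * of_nat (num_mult (2 * k) (0, s)))"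
  proof (rule infsum_cong_neutral)
    fix k assume "k \<in> {1..} - {1..n}"
    then have "{q \<in> I. vis 0 s q = k} = {}" "k \<ge> 1" using vis_le[OF s] by force+
    then have "num_mult (2 * k) (0, s) = 0" by (metis num card.empty)
    then show "\<Lambda> k * of_nat (num_mult (2 * k) (0, s)) = 0" by simp
  qed auto
  also have "\<dots> = (\<Sum>k\<in>{1..n}. \<Sum>q\<in>{q \<in> {q\<in>I. vis 0 s q \<noteq> 0}. vis 0 s q = k}. \<Lambda> (vis 0 s q))"
  proof (subst infsum_finite, simp, rule sum.cong)
    fix k assume k: "k \<in> {1..n}"
    then have "{q \<in> {q\<in>I. vis 0 s q \<noteq> 0}. vis 0 s q = k} = {q \<in> I. vis 0 s q = k}" by auto
    then show "\<Lambda> k * of_nat (num_mult (2 * k) (0, s)) = (\<Sum>q\<in>{q \<in> {q\<in>I. vis 0 s q \<noteq> 0}. vis 0 s q = k}. \<Lambda> (vis 0 s q))"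
      using num[of k] k by (simp add: mult.commute)
  qed simp
  also have "\<dots> = (\<Sum>q\<in>{q\<in>I. vis 0 s q \<noteq> 0}. \<Lambda> (vis 0 s q))"
  proof (rule sum.group)
    show "finite {q\<in>I. vis 0 s q \<noteq> 0}" by (rule fin)
  qed (use vis_le[OF s] in \<open>auto simp: Suc_le_eq\<close>)
  finally have "exp (\<Sum>\<^sub>\<infinity>k\<in>{1..}. \<Lambda> k * of_nat (num_mult (2 * k) (0, s))) = (\<Prod>q\<in>{q\<in>I. vis 0 s q \<noteq> 0}. exp (\<Lambda> (vis 0 s q)))"
    using exp_sum[OF fin] by simp
  also have "\<dots> = (\<Prod>q\<in>I. 1 + (if vis 0 s q = 0 then 0 else tvar \<Lambda> (vis 0 s q)))"
    by (rule prod.mono_neutral_cong_left) (auto simp: I_def tvar_def)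
  finally show ?thesis by (simp add: I_def)
qed

lemma walks_lhs_nth:
  "fps_nth (\<Sum>w\<in>walks0 M. fps_const (F w) * fps_X ^ walk_length w) n =
    (if 1 \<le> n \<and> n \<le> M then \<Sum>s\<in>cwalks n. F (0, s) else (0 :: complex))"
proof -
  have "fps_nth (\<Sum>w\<in>walks0 M. fps_const (F w) * fps_X ^ walk_length w) n =
      (\<Sum>w\<in>walks0 M. if walk_length w = n then F w else 0)"
    by (auto simp: fps_sum_nth fps_X_power_nth intro!: sum.cong)
  also have "\<dots> = (\<Sum>w\<in>{w\<in>walks0 M. walk_length w = n}. F w)"
    using finite_walks0 by (simp add: sum.inter_filter)
  also have "\<dots> = (if 1 \<le> n \<and> n \<le> M then \<Sum>s\<in>cwalks n. F (0, s) else 0)"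
  proof (cases "1 \<le> n \<and> n \<le> M")
    case True
    have "{w\<in>walks0 M. walk_length w = n} = Pair 0 ` cwalks n"
      using True by (force simp: walks0_def cwalks_def closed_walk_def is_walk_def walk_length_def walk_point_def)
    then show ?thesis using True by (simp add: sum.reindex inj_on_def)
  next
    case False
    have "{w\<in>walks0 M. walk_length w = n} = {}" using False by (auto simp: walks0_def)
    then show ?thesis using False by (metis sum.empty)
  qed
  finally show ?thesis .
qed

section \<open>Binomial series and the excursion series\<close>

lemma fps_summable_on_pairI:
  fixes F :: "nat \<times> nat \<Rightarrow> 'a :: comm_ring_1 fps"
  assumes "\<And>i j. fps_X ^ i dvd F (i, j)" "\<And>i j. fps_X ^ j dvd F (i, j)"
  shows "F summable_on A \<times> B"
proof (rule fps_summable_onI[where h = "\<lambda>(i, j). max i j"])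
  show "fps_X ^ (case p of (i, j) \<Rightarrow> max i j) dvd F p" for p
    using assms by (cases p) (auto simp: max_def)
  show "finite {p \<in> A \<times> B. (case p of (i, j) \<Rightarrow> max i j) \<le> n}" for n
    by (rule finite_subset[of _ "{..n} \<times> {..n}"]) auto
qed

lemma fps_X_dvd_iff: "fps_X dvd (l :: 'a :: comm_ring_1 fps) \<longleftrightarrow> fps_nth l 0 = 0"
  using fps_X_power_dvd_iff[of 1 l] by simp

lemma fps_compose_eq_infsum:
  fixes l :: "complex fps"
  assumes "fps_nth l 0 = 0"
  shows "G oo l = (\<Sum>\<^sub>\<infinity>b. fps_const (fps_nth G b) * l ^ b)"
proof (rule fps_ext)
  fix n
  have dvd: "fps_X ^ b dvd l ^ b" for b using assms by (intro dvd_power_same) (simp add: fps_X_dvd_iff)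
  have "(\<lambda>b. fps_const (fps_nth G b) * l ^ b) summable_on UNIV"
    by (intro fps_summable_on_natI dvd_mult dvd)
  from fps_nth_infsum[OF this, of "{0..n}" n] dvd
  show "fps_nth (G oo l) n = fps_nth (\<Sum>\<^sub>\<infinity>b. fps_const (fps_nth G b) * l ^ b) n"
    by (simp add: fps_compose_nth fps_X_power_dvd_iff)
qed

lemma infsum_negative_binomial:
  fixes l :: "complex fps"
  assumes "fps_nth l 0 = 0"
  shows "(\<Sum>\<^sub>\<infinity>b. of_nat ((s + b - 1) choose b) * l ^ b) = inverse (1 - l) ^ s"
proof -
  have *: "inverse ((1 - fps_X) ^ s) = Abs_fps (\<lambda>k. of_nat ((s + k - 1) choose k) :: complex)"
  \<comment> \<open>For s = 0 the truncated subtraction turns the binomial into binom(k - 1, k),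
    which is 1 at k = 0 and 0 otherwise, as the empty power demands.\<close>
  proof (cases "s = 0")
    case True
    have "of_nat ((k - Suc 0) choose k) = (if k = 0 then 1 else 0 :: complex)" for k by (cases k) auto
    then show ?thesis using True by (simp add: fps_eq_iff)
  next
    case False
    then show ?thesis using one_minus_const_fps_X_neg_power'[of s "1 :: complex"] by simp
  qed
  have "inverse (1 - l) ^ s = inverse ((1 - fps_X) ^ s) oo l"
    using assms by (simp add: fps_inverse_compose fps_inverse_power fps_compose_power[symmetric] fps_compose_sub_distrib)
  also have "\<dots> = (\<Sum>\<^sub>\<infinity>b. fps_const (of_nat ((s + b - 1) choose b)) * l ^ b)"
    unfolding * by (subst fps_compose_eq_infsum[OF assms]) simp
  finally show ?thesis by (simp add: fps_of_nat)
qed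

text \<open>The coefficient of $l^i$ in $(l / (1 - \nu l))^s$.\<close>

definition ecoeff :: "complex fps \<Rightarrow> nat \<Rightarrow> nat \<Rightarrow> complex fps" where
  "ecoeff \<nu> s i = (if s \<le> i then of_nat ((i - 1) choose (i - s)) * \<nu> ^ (i - s) else 0)"

lemma infsum_ecoeff:
  assumes l: "fps_nth l 0 = 0"
  shows "(\<Sum>\<^sub>\<infinity>i. ecoeff \<nu> s i * l ^ i) = (l * inverse (1 - \<nu> * l)) ^ s"
proof -
  have "(\<Sum>\<^sub>\<infinity>i. ecoeff \<nu> s i * l ^ i) = (\<Sum>\<^sub>\<infinity>i\<in>{s..}. ecoeff \<nu> s i * l ^ i)"
    by (rule infsum_cong_neutral) (auto simp: ecoeff_def)
  also have "\<dots> = (\<Sum>\<^sub>\<infinity>b. ecoeff \<nu> s (s + b) * l ^ (s + b))"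
    by (rule infsum_reindex_bij_witness[where i = "\<lambda>b. s + b" and j = "\<lambda>i. i - s"]) auto
  also have "\<dots> = (\<Sum>\<^sub>\<infinity>b. l ^ s * (of_nat ((s + b - 1) choose b) * (\<nu> * l) ^ b))"
    by (simp add: ecoeff_def power_add power_mult_distrib mult_ac)
  also have "\<dots> = l ^ s * (\<Sum>\<^sub>\<infinity>b. of_nat ((s + b - 1) choose b) * (\<nu> * l) ^ b)"
  proof (rule infsum_cmult_right)
    show "(\<lambda>b. of_nat ((s + b - 1) choose b) * (\<nu> * l) ^ b) summable_on UNIV"
      using l by (intro fps_summable_on_natI dvd_mult dvd_power_same) (simp add: fps_X_dvd_iff)
  qed
  finally show ?thesis using l by (subst (asm) infsum_negative_binomial) (auto simp: power_mult_distrib)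
qed

text \<open>The coefficient of $z^n$ in $\sum_b S_b (cz)^b$ is a polynomial in $c$.\<close>

lemma rows_eqI:
  fixes S T :: "nat \<Rightarrow> complex fps"
  assumes "\<And>c. (\<Sum>\<^sub>\<infinity>b. S b * (fps_const c * fps_X) ^ b) = (\<Sum>\<^sub>\<infinity>b. T b * (fps_const c * fps_X) ^ b)"
  shows "S = T"
proof
  fix b
  have nth: "fps_nth (\<Sum>\<^sub>\<infinity>b. S b * (fps_const c * fps_X) ^ b) n = (\<Sum>b\<le>n. fps_nth (S b) (n - b) * c ^ b)"
    for S :: "nat \<Rightarrow> complex fps" and c n
  proof -
    have eq: "S b * (fps_const c * fps_X) ^ b = fps_X ^ b * (fps_const (c ^ b) * S b)" for b
      by (simp add: power_mult_distrib mult_ac)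
    have "(\<lambda>b. S b * (fps_const c * fps_X) ^ b) summable_on UNIV"
      unfolding eq by (intro fps_summable_on_natI dvd_triv_left)
    from fps_nth_infsum[OF this, of "{..n}" n] show ?thesis
      unfolding eq by (simp add: fps_X_power_mult_nth mult.commute)
  qed
  show "S b = T b"
  proof (rule fps_ext)
    fix m
    \<comment> \<open>Agreement of the coefficients of z^(b+m) for every constant c means that this
      polynomial in c vanishes; its coefficient at c^b isolates the m-th coefficient of
      \<open>S b\<close>.\<close>
    define P where "P = (\<Sum>i\<le>b+m. monom (fps_nth (S i) (b + m - i) - fps_nth (T i) (b + m - i)) i)"
    have "poly P c = 0" for c
      using assms[of c] nth[of S c "b+m"] nth[of T c "b+m"]
      by (simp add: P_def poly_sum poly_monom left_diff_distrib sum_subtractf)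
    then have "P = 0" by (metis poly_all_0_iff_0)
    then have "coeff P b = 0" by simp
    then show "fps_nth (S b) m = fps_nth (T b) m" by (simp add: P_def coeff_sum)
  qed
qed

text \<open>\<open>lam\<close> counts the single excursions to one side, and \<open>qq\<close> is $B^2$.\<close>

definition lam :: "complex fps" where "lam = fps_const (1/2) * (1 - A_ser)"
text \<open>The reciprocal of 1 - \<lambda>, the second fixed point of the step l \<mapsto> z^2 / (1
  - l).\<close>

definition nu :: "complex fps" where "nu = inverse (1 - lam)"
definition qq :: "complex fps" where "qq = lam * nu"

lemma A_lam: "A_ser = 1 - 2 * lam"
proof -
  have "2 * fps_const (1/2) = (1 :: complex fps)" by (simp add: fps_eq_iff numeral_fps_const)
  then show ?thesis unfolding lam_def by (metis diff_diff_eq2 mult.assoc mult_1 add_diff_cancel_left')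
qed

lemma one_minus_A: "1 - A_ser = 2 * lam" by (simp add: A_lam)

lemma lam_0: "fps_nth lam 0 = 0"
  by (simp add: lam_def A_ser_nth_0)

text \<open>The fixed-point equation of the step, equivalent to A^2 = 1 - 4 z^2 for A = 1 - 2
  \<lambda>.\<close>

lemma X2: "fps_X ^ 2 = lam * (1 - lam)"
proof -
  have "4 * (lam * (1 - lam)) = 4 * fps_X ^ 2"
    using A_ser_power2 unfolding A_lam by (simp add: algebra_simps power2_eq_square)
  moreover have "(4 :: complex fps) \<noteq> 0" by simp
  ultimately show ?thesis by (metis mult_left_cancel)
qed

lemma nu_lam: "nu * (1 - lam) = 1"
  unfolding nu_def by (rule inverse_mult_eq_1) (simp add: lam_0)

lemma nu_X2: "nu * fps_X ^ 2 = lam"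
  using nu_lam unfolding X2 by algebra

lemma X2_dvd_lam: "fps_X ^ 2 dvd lam"
  using nu_X2 by (metis dvd_triv_right)

lemma X2_dvd_qq: "fps_X ^ 2 dvd qq"
  unfolding qq_def using X2_dvd_lam by simp

lemma qq_0: "fps_nth qq 0 = 0"
  by (simp add: qq_def lam_0)

text \<open>B is z / (1 - \<lambda>), so its square \<lambda> / (1 - \<lambda>) is the derivative of
  the step at the fixed point \<lambda>.\<close>

lemma B_power2: "B_ser ^ 2 = qq"
proof -
  have "1 + A_ser = 2 * (1 - lam)" by (simp add: A_lam)
  have "fps_nth (1 + A_ser) 0 \<noteq> 0" by (simp add: A_ser_nth_0)
  then have "inverse (1 + A_ser) * (1 + A_ser) = 1" "B_ser = 2 * fps_X * inverse (1 + A_ser)"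
    by (simp_all add: B_ser_def fps_divide_unit inverse_mult_eq_1)
  then have "B_ser * (2 * (1 - lam)) = 2 * fps_X"
    unfolding \<open>1 + A_ser = 2 * (1 - lam)\<close> by algebra
  then have "2 * (B_ser * (1 - lam)) = 2 * fps_X" by (simp add: algebra_simps)
  then have "B_ser * (1 - lam) = fps_X" by (simp only: mult_cancel_left) simp
  then have "B_ser * (nu * (1 - lam)) = fps_X * nu" by (metis mult.commute mult.left_commute)
  then have "B_ser = fps_X * nu" by (simp add: nu_lam)
  then show ?thesis unfolding qq_def using nu_X2 by algebra
qed

section \<open>The Moebius map of one step\<close>

lemma infsum_sum:
  fixes F :: "'i \<Rightarrow> 'j \<Rightarrow> 'b :: {topological_comm_monoid_add, t2_space}"
  assumes "finite I" "\<And>i. i \<in> I \<Longrightarrow> F i summable_on A"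
  shows "infsum (\<lambda>x. \<Sum>i\<in>I. F i x) A = (\<Sum>i\<in>I. infsum (F i) A)"
    and "(\<lambda>x. \<Sum>i\<in>I. F i x) summable_on A"
  using assms
proof (induction I rule: finite_induct)
  case (insert i I)
  {
    case 1
    then show ?case using insert by (simp add: infsum_add)
  next
    case 2
    then show ?case using insert by (simp add: summable_on_add)
  }
qed simp_all

text \<open>Umbrally, if \<open>x n\<close> is the value of a linear functional at $L^n$, then \<open>btrans c x n\<close> is its value
  at $(L + c)^n$.\<close>

definition btrans :: "complex fps \<Rightarrow> (nat \<Rightarrow> complex fps) \<Rightarrow> nat \<Rightarrow> complex fps" where
  "btrans c x n = (\<Sum>j\<le>n. of_nat (n choose j) * c ^ (n - j) * x j)"

lemma btrans_0 [simp]: "btrans c x 0 = x 0"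
  by (simp add: btrans_def)

text \<open>Umbrally both sides are (L + c + d)^n. Exchanging the sums and applying trinomial
  revision leaves the binomial theorem for (c + d)^(n - i).\<close>

lemma btrans_btrans: "btrans c (btrans d x) n = btrans (c + d) x n"
proof -
  have "btrans c (btrans d x) n = (\<Sum>j\<le>n. \<Sum>i\<le>n. if i \<le> j then of_nat (n choose j) * c ^ (n - j) * (of_nat (j choose i) * d ^ (j - i) * x i) else 0)"
    unfolding btrans_def sum_distrib_left by (intro sum.cong refl sum.mono_neutral_cong_left) auto
  also have "\<dots> = (\<Sum>i\<le>n. \<Sum>j\<le>n. if i \<le> j then of_nat (n choose j) * c ^ (n - j) * (of_nat (j choose i) * d ^ (j - i) * x i) else 0)"
    by (rule sum.swap)
  also have "\<dots> = (\<Sum>i\<le>n. of_nat (n choose i) * (c + d) ^ (n - i) * x i)"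
  proof (intro sum.cong refl)
    fix i assume "i \<in> {..n}"
    then have i: "i \<le> n" by simp
    have "(\<Sum>j\<le>n. if i \<le> j then of_nat (n choose j) * c ^ (n - j) * (of_nat (j choose i) * d ^ (j - i) * x i) else 0)
      = (\<Sum>j\<in>{i..n}. of_nat (n choose j) * c ^ (n - j) * (of_nat (j choose i) * d ^ (j - i) * x i))"
      by (intro sum.mono_neutral_cong_right) auto
    also have "\<dots> = (\<Sum>m\<le>n-i. of_nat (n choose i) * x i * (of_nat ((n - i) choose m) * d ^ m * c ^ (n - i - m)))"
    proof (rule sum.reindex_bij_witness[where i = "\<lambda>m. m + i" and j = "\<lambda>j. j - i"])
      fix j assume j: "j \<in> {i..n}"
      have "(of_nat (n choose j) * of_nat (j choose i) :: complex fps) = of_nat (n choose i) * of_nat ((n - i) choose (j - i))"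
        using choose_mult[of i j n] j by (simp flip: of_nat_mult)
      moreover have "n - i - (j - i) = n - j" using j by auto
      ultimately show "of_nat (n choose i) * x i * (of_nat ((n - i) choose (j - i)) * d ^ (j - i) * c ^ (n - i - (j - i)))
        = of_nat (n choose j) * c ^ (n - j) * (of_nat (j choose i) * d ^ (j - i) * x i)"
        by (simp add: mult_ac)
    qed (use i in auto)
    also have "\<dots> = of_nat (n choose i) * x i * (d + c) ^ (n - i)"
      by (simp only: binomial_ring sum_distrib_left)
    also have "\<dots> = of_nat (n choose i) * (c + d) ^ (n - i) * x i"
      by (simp only: add.commute[of d c] mult_ac)
    finally show "(\<Sum>j\<le>n. if i \<le> j then of_nat (n choose j) * c ^ (n - j) * (of_nat (j choose i) * d ^ (j - i) * x i) else 0)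
      = of_nat (n choose i) * (c + d) ^ (n - i) * x i" .
  qed
  finally show ?thesis by (simp add: btrans_def)
qed

lemma btrans_dvd:
  assumes "\<And>i. fps_X ^ (2 * i) dvd x i" "fps_X ^ 2 dvd c"
  shows "fps_X ^ (2 * n) dvd btrans c x n"
  unfolding btrans_def
proof (rule dvd_sum)
  fix j assume "j \<in> {..n}"
  then have "fps_X ^ (2 * n) = (fps_X ^ 2) ^ (n - j) * fps_X ^ (2 * j)"
    by (simp add: power_mult[symmetric] power_add[symmetric] flip: distrib_left)
  also have "\<dots> dvd c ^ (n - j) * x j"
    by (intro mult_dvd_mono dvd_power_same assms)
  finally show "fps_X ^ (2 * n) dvd of_nat (n choose j) * c ^ (n - j) * x j"
    by (simp add: mult.assoc)
qed

lemma X2_power_dvd: "fps_X ^ 2 dvd c \<Longrightarrow> fps_X ^ (2 * n) dvd (c :: complex fps) ^ n"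
  unfolding power_mult by (rule dvd_power_same)

lemma X_power_dvdI: "fps_X ^ (2 * n) dvd c \<Longrightarrow> m \<le> 2 * n \<Longrightarrow> fps_X ^ m dvd (c :: complex fps)"
  by (rule dvd_trans[OF le_imp_power_dvd])

text \<open>The map \<open>moebius\<close> conjugates the step $l \mapsto z^2 / (1 - l)$ to multiplication by \<open>qq\<close>, and
  \<open>mcoeff f i\<close> is the coefficient of $l^i$ in its $f$-th power.\<close>

definition mcoeff :: "nat \<Rightarrow> nat \<Rightarrow> complex fps" where
  "mcoeff f i = (\<Sum>s\<le>f. of_nat (f choose s) * (- qq) ^ (f - s) * (A_ser * nu ^ 2) ^ s * ecoeff nu s i)"

definition moebius :: "complex fps \<Rightarrow> complex fps" where
  "moebius l = (l - lam) * nu * inverse (1 - nu * l)"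

text \<open>Splitting off the constant term -\<open>qq\<close> leaves a multiple of l / (1 - \<nu>
  l), whose powers have the coefficients \<open>ecoeff\<close>; the binomial theorem then gives
  \<open>mcoeff\<close>.\<close>

lemma moebius_eq:
  assumes "fps_nth l 0 = 0"
  shows "moebius l = - qq + A_ser * nu ^ 2 * (l * inverse (1 - nu * l))"
proof -
  define v where "v = inverse (1 - nu * l)"
  have v: "v * (1 - nu * l) = 1"
    unfolding v_def by (rule inverse_mult_eq_1) (simp add: assms)
  have "(l - lam) * nu * v - (- (lam * nu) + (1 - 2 * lam) * nu ^ 2 * (l * v)) = 0"
    using v nu_lam by algebra
  then show ?thesis by (simp add: moebius_def v_def qq_def A_lam)
qed

lemma mcoeff_eval:
  assumes l: "fps_nth l 0 = 0"
  shows "(\<Sum>\<^sub>\<infinity>i. mcoeff f i * l ^ i) = moebius l ^ f"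
proof -
  have sm: "(\<lambda>i. ecoeff nu s i * l ^ i) summable_on UNIV" for s
    using l by (intro fps_summable_on_natI dvd_mult dvd_power_same) (simp add: fps_X_dvd_iff)
  have "(\<Sum>\<^sub>\<infinity>i. mcoeff f i * l ^ i) =
     (\<Sum>\<^sub>\<infinity>i. \<Sum>s\<le>f. of_nat (f choose s) * (- qq) ^ (f - s) * (A_ser * nu ^ 2) ^ s * (ecoeff nu s i * l ^ i))"
    by (simp add: mcoeff_def sum_distrib_right mult.assoc)
  also have "\<dots> = (\<Sum>s\<le>f. \<Sum>\<^sub>\<infinity>i. of_nat (f choose s) * (- qq) ^ (f - s) * (A_ser * nu ^ 2) ^ s * (ecoeff nu s i * l ^ i))"
    by (rule infsum_sum(1)) (intro finite_atMost summable_on_cmult_right sm)+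
  also have "\<dots> = (\<Sum>s\<le>f. of_nat (f choose s) * (- qq) ^ (f - s) * (A_ser * nu ^ 2) ^ s * (l * inverse (1 - nu * l)) ^ s)"
    by (simp add: infsum_cmult_right sm infsum_ecoeff l)
  also have "\<dots> = (A_ser * nu ^ 2 * (l * inverse (1 - nu * l)) + (- qq)) ^ f"
    unfolding binomial_ring by (intro sum.cong refl) (simp only: power_mult_distrib mult_ac)
  finally show ?thesis using moebius_eq[OF l] by (simp add: add.commute)
qed

text \<open>Only s <= i contributes, and each of the remaining f - s factors is \<open>qq\<close>,
  of order at least 2. This makes the columns of \<open>mcoeff\<close> summable over f.\<close>

lemma mcoeff_dvd: "fps_X ^ (2 * (f - i)) dvd mcoeff f i"
  unfolding mcoeff_def
proof (rule dvd_sum)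
  fix s assume "s \<in> {..f}"
  show "fps_X ^ (2 * (f - i)) dvd of_nat (f choose s) * (- qq) ^ (f - s) * (A_ser * nu ^ 2) ^ s * ecoeff nu s i"
  proof (cases "s \<le> i")
    case True
    have "fps_X ^ (2 * (f - i)) dvd (- qq) ^ (f - s)"
      by (rule X_power_dvdI[OF X2_power_dvd]) (use True X2_dvd_qq in auto)
    then show ?thesis by (simp add: mult.assoc)
  qed (simp add: ecoeff_def)
qed

text \<open>With u the Moebius map, u(z^2 l) = \<open>qq\<close> (-1 + A l / (1 - \<lambda> l))
  because \<nu> z^2 = \<lambda>. The identity compares the coefficients of l^i in the f-th
  powers.\<close>

lemma mcoeff_X:
  "mcoeff f i * fps_X ^ (2 * i) = qq ^ f * (\<Sum>s\<le>f. of_nat (f choose s) * (-1) ^ (f - s) * A_ser ^ s * ecoeff lam s i)"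
  unfolding mcoeff_def sum_distrib_right sum_distrib_left
proof (intro sum.cong refl)
  fix s assume "s \<in> {..f}"
  then have s: "s \<le> f" by simp
  show "of_nat (f choose s) * (- qq) ^ (f - s) * (A_ser * nu\<^sup>2) ^ s * ecoeff nu s i * fps_X ^ (2 * i) =
    qq ^ f * (of_nat (f choose s) * (- 1) ^ (f - s) * A_ser ^ s * ecoeff lam s i)"
  proof (cases "s \<le> i")
    case True
    have h1: "nu ^ i * (fps_X ^ 2) ^ i = lam ^ i"
      by (simp only: power_mult_distrib[symmetric] nu_X2)
    have h2: "nu ^ (i - s) * nu ^ s = nu ^ i" and h3: "lam ^ (i - s) * lam ^ s = lam ^ i"
      and h4: "qq ^ (f - s) * qq ^ s = qq ^ f"
      using True s by (simp_all flip: power_add)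
    have h5: "(- qq) ^ (f - s) = (-1) ^ (f - s) * qq ^ (f - s)"
      by (metis mult_minus1 power_mult_distrib)
    have h6: "lam ^ s * nu ^ s = qq ^ s" by (simp add: qq_def power_mult_distrib)
    have h7: "(A_ser * nu ^ 2) ^ s = A_ser ^ s * nu ^ s * nu ^ s"
      by (simp add: power_mult_distrib power2_eq_square mult.assoc)
    have key: "m * q1 * (a * n2 * n2) * n1 * X = q * (m * a * l1)"
      if "n * X = l" "n1 * n2 = n" "l1 * l2 = l" "q1 * q2 = q" "l2 * n2 = q2"
      for m q1 a n1 n2 n X l l1 l2 q q2 :: "complex fps"
    proof -
      have "m * q1 * (a * n2 * n2) * n1 * X = m * a * q1 * n2 * (n1 * n2 * X)" by (simp add: mult_ac)
      also have "\<dots> = m * a * q1 * n2 * (l1 * l2)" using that by simp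
      also have "\<dots> = m * a * l1 * (q1 * (l2 * n2))" by (simp add: mult_ac)
      also have "\<dots> = q * (m * a * l1)" using that by (simp add: mult_ac)
      finally show ?thesis .
    qed
    have "(- qq) ^ (f - s) * (A_ser * nu\<^sup>2) ^ s * nu ^ (i - s) * fps_X ^ (2 * i)
      = qq ^ f * ((- 1) ^ (f - s) * A_ser ^ s * lam ^ (i - s))"
      unfolding power_mult h5 h7 by (rule key[OF h1 h2 h3 h4 h6])
    then show ?thesis using True by (simp add: ecoeff_def mult_ac)
  qed (simp add: ecoeff_def)
qed

lemma moebius_step:
  assumes "fps_nth l 0 = 0"
  shows "moebius (fps_X ^ 2 * inverse (1 - l)) = qq * moebius l"
proof -
  define w where "w = inverse (1 - l)"
  have w: "w * (1 - l) = 1"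
    unfolding w_def by (rule inverse_mult_eq_1) (simp add: assms)
  define v where "v = inverse (1 - nu * l)"
  have v: "v * (1 - nu * l) = 1"
    unfolding v_def by (rule inverse_mult_eq_1) (simp add: assms)
  define y where "y = inverse (1 - nu * (fps_X ^ 2 * w))"
  have y: "y * (1 - nu * (fps_X ^ 2 * w)) = 1"
    unfolding y_def by (rule inverse_mult_eq_1) (simp add: fps_mult_nth_0)
  have y': "y * (1 - lam * w) = 1" using y nu_X2 by algebra
  have "1 - lam * w = w * (1 - lam) * (1 - nu * l)" using w nu_lam by algebra
  have "(fps_X ^ 2 * w - lam) * nu = lam * w - lam * nu"
  proof -
    have "(fps_X ^ 2 * w - lam) * nu = nu * fps_X ^ 2 * w - lam * nu" by (simp add: algebra_simps)
    then show ?thesis by (simp only: nu_X2)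
  qed
  have "(lam * w - lam * nu) = lam * nu * w * (l - lam)" using w nu_lam by algebra
  have "(lam * w - lam * nu) * y = (lam * nu) * ((l - lam) * nu * v)"
    using \<open>lam * w - lam * nu = lam * nu * w * (l - lam)\<close> \<open>1 - lam * w = w * (1 - lam) * (1 - nu * l)\<close> nu_lam v y' by algebra
  then show ?thesis
    unfolding moebius_def qq_def w_def[symmetric] v_def[symmetric] y_def[symmetric]
    using \<open>(fps_X ^ 2 * w - lam) * nu = lam * w - lam * nu\<close> by simp
qed

text \<open>The map solved for l: l - \<lambda> = A u / (1 + u). The form 1 - (-1) u matches
  \<open>infsum_ecoeff\<close> with \<nu> = -1.\<close>

lemma moebius_inverse:
  assumes "fps_nth l 0 = 0"
  shows "A_ser * (moebius l * inverse (1 - (-1) * moebius l)) = l - lam"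
proof -
  define v where "v = inverse (1 - nu * l)"
  have v: "v * (1 - nu * l) = 1"
    unfolding v_def by (rule inverse_mult_eq_1) (simp add: assms)
  define y where "y = inverse (1 + moebius l)"
  have y: "y * (1 + moebius l) = 1"
    unfolding y_def by (rule inverse_mult_eq_1) (simp add: assms moebius_def fps_mult_nth_0 lam_0)
  have u: "moebius l = (l - lam) * nu * v" by (simp add: moebius_def v_def)
  have "A_ser * moebius l = (l - lam) * (1 + moebius l)"
    unfolding u A_lam using v nu_lam by algebra
  then have "A_ser * (moebius l * y) = (l - lam)" using y by algebra
  then show ?thesis by (simp add: y_def)
qed

section \<open>Diagonalising the step\<close>

text \<open>The rows of \<open>mcoeff\<close> are left eigenvectors of the matrix of
  \<open>forest_gf_step\<close>, with eigenvalue \<open>qq ^ f\<close>. Summing over b against l^b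
  turns the inner sum into (z^2 / (1 - l))^i, and \<open>moebius_step\<close> applies.\<close>

lemma mcoeff_step:
  "(\<Sum>\<^sub>\<infinity>i. mcoeff f i * fps_X ^ (2 * i) * of_nat ((i + b - 1) choose b)) = qq ^ f * mcoeff f b"
proof -
  let ?R = "\<lambda>b. \<Sum>\<^sub>\<infinity>i. mcoeff f i * fps_X ^ (2 * i) * of_nat ((i + b - 1) choose b)"
  have dvd: "fps_X ^ i dvd (fps_X :: complex fps) ^ (2 * i)" for i by (rule le_imp_power_dvd) simp
  have "?R = (\<lambda>b. qq ^ f * mcoeff f b)"
  \<comment> \<open>The coefficients are themselves series in z, so l cannot be an independent
    variable here; evaluating at l = c z for all constants c takes its place.\<close>
  proof (rule rows_eqI)
    fix c :: complex
    define l where "l = fps_const c * fps_X"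
    have l: "fps_nth l 0 = 0" by (simp add: l_def)
    have ldvd: "fps_X ^ j dvd l ^ j" for j by (simp add: l_def power_mult_distrib)
    have sm1: "(\<lambda>i. mcoeff f i * fps_X ^ (2 * i) * of_nat ((i + b - 1) choose b)) summable_on UNIV" for b
      by (intro fps_summable_on_natI dvd_mult2 dvd_mult dvd)
    have sm2: "(\<lambda>(i, b). mcoeff f i * fps_X ^ (2 * i) * of_nat ((i + b - 1) choose b) * l ^ b) summable_on UNIV \<times> UNIV"
      by (rule fps_summable_on_pairI) (use ldvd dvd in \<open>auto intro: dvd_mult2 dvd_mult\<close>)
    have sm3: "(\<lambda>b. of_nat ((i + b - 1) choose b) * l ^ b) summable_on UNIV" for i
      by (intro fps_summable_on_natI dvd_mult ldvd)
    have "(\<Sum>\<^sub>\<infinity>b. ?R b * l ^ b) = (\<Sum>\<^sub>\<infinity>b. \<Sum>\<^sub>\<infinity>i. mcoeff f i * fps_X ^ (2 * i) * of_nat ((i + b - 1) choose b) * l ^ b)"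
      by (intro infsum_cong infsum_cmult_left[symmetric] sm1)
    also have "\<dots> = (\<Sum>\<^sub>\<infinity>i. \<Sum>\<^sub>\<infinity>b. mcoeff f i * fps_X ^ (2 * i) * of_nat ((i + b - 1) choose b) * l ^ b)"
      by (rule fps_infsum_swap[symmetric]) (rule sm2)
    also have "\<dots> = (\<Sum>\<^sub>\<infinity>i. mcoeff f i * (fps_X ^ 2 * inverse (1 - l)) ^ i)"
    proof (rule infsum_cong)
      fix i
      have "(\<Sum>\<^sub>\<infinity>b. mcoeff f i * fps_X ^ (2 * i) * of_nat ((i + b - 1) choose b) * l ^ b)
        = mcoeff f i * fps_X ^ (2 * i) * (\<Sum>\<^sub>\<infinity>b. of_nat ((i + b - 1) choose b) * l ^ b)"
        unfolding mult.assoc[of "mcoeff f i * fps_X ^ (2 * i)"] by (rule infsum_cmult_right) (rule sm3)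
      then show "(\<Sum>\<^sub>\<infinity>b. mcoeff f i * fps_X ^ (2 * i) * of_nat ((i + b - 1) choose b) * l ^ b)
        = mcoeff f i * (fps_X ^ 2 * inverse (1 - l)) ^ i"
        by (simp only: infsum_negative_binomial[OF l] power_mult_distrib power_mult mult.assoc)
    qed
    also have "\<dots> = moebius (fps_X ^ 2 * inverse (1 - l)) ^ f"
      by (rule mcoeff_eval) (simp add: fps_mult_nth_0)
    also have "\<dots> = qq ^ f * moebius l ^ f"
      by (simp add: moebius_step l power_mult_distrib)
    also have "\<dots> = qq ^ f * (\<Sum>\<^sub>\<infinity>b. mcoeff f b * l ^ b)"
      by (simp add: mcoeff_eval l)
    also have "\<dots> = (\<Sum>\<^sub>\<infinity>b. qq ^ f * (mcoeff f b * l ^ b))"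
      by (rule infsum_cmult_right[symmetric]) (intro fps_summable_on_natI dvd_mult ldvd)
    finally show "(\<Sum>\<^sub>\<infinity>b. ?R b * (fps_const c * fps_X) ^ b) = (\<Sum>\<^sub>\<infinity>b. qq ^ f * mcoeff f b * (fps_const c * fps_X) ^ b)"
      by (simp add: l_def mult.assoc)
  qed
  then show ?thesis by (rule fun_cong)
qed

lemma mcoeff_pair_dvd:
  "fps_X ^ f dvd mcoeff f b * x" "fps_X ^ b dvd mcoeff f b * x" if "fps_X ^ (2 * b) dvd x" for x :: "complex fps"
proof -
  have "fps_X ^ (2 * (f - b)) * fps_X ^ (2 * b) dvd mcoeff f b * x"
    by (intro mult_dvd_mono mcoeff_dvd that)
  then show "fps_X ^ f dvd mcoeff f b * x"
    by (rule dvd_trans[rotated]) (auto simp flip: power_add intro: le_imp_power_dvd)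
  show "fps_X ^ b dvd mcoeff f b * x" by (intro dvd_mult X_power_dvdI[OF that]) simp
qed

lemma mcoeff_column_summable: "(\<lambda>f. c f * mcoeff f b) summable_on UNIV"
  by (rule fps_summable_on_shiftI[where c = b]) (intro dvd_mult X_power_dvdI[OF mcoeff_dvd], simp)

text \<open>Comparison of the coefficients of l^b in (l - \<lambda>)^i = (A u / (1 + u))^i. It
  recovers centred powers of l from powers of u.\<close>

lemma mcoeff_inverse:
  assumes "i \<ge> 1"
  shows "(\<Sum>\<^sub>\<infinity>f. A_ser ^ i * ecoeff (-1) i f * mcoeff f b) = (if b \<le> i then of_nat (i choose b) * (- lam) ^ (i - b) else 0)"
proof -
  let ?R = "\<lambda>b. \<Sum>\<^sub>\<infinity>f. A_ser ^ i * ecoeff (-1) i f * mcoeff f b"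
  let ?S = "\<lambda>b. if b \<le> i then of_nat (i choose b) * (- lam) ^ (i - b) else 0"
  have "?R = ?S"
  proof (rule rows_eqI)
    fix c :: complex
    define l where "l = fps_const c * fps_X"
    have l: "fps_nth l 0 = 0" by (simp add: l_def)
    have ldvd: "fps_X ^ j dvd l ^ j" for j by (simp add: l_def power_mult_distrib)
    have pl: "fps_X ^ f dvd mcoeff f b * l ^ b" for f b
    proof -
      have "fps_X ^ (2 * (f - b)) * fps_X ^ b dvd mcoeff f b * l ^ b"
        by (intro mult_dvd_mono mcoeff_dvd ldvd)
      then show ?thesis by (rule dvd_trans[rotated]) (auto simp flip: power_add intro: le_imp_power_dvd)
    qed
    have sm2: "(\<lambda>(f, b). A_ser ^ i * ecoeff (-1) i f * mcoeff f b * l ^ b) summable_on UNIV \<times> UNIV"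
      by (rule fps_summable_on_pairI) (use ldvd pl in \<open>auto simp: mult.assoc intro: dvd_mult\<close>)
    have sm3: "(\<lambda>b. mcoeff f b * l ^ b) summable_on UNIV" for f
      by (intro fps_summable_on_natI dvd_mult ldvd)
    have "(\<Sum>\<^sub>\<infinity>b. ?R b * l ^ b) = (\<Sum>\<^sub>\<infinity>b. \<Sum>\<^sub>\<infinity>f. A_ser ^ i * ecoeff (-1) i f * mcoeff f b * l ^ b)"
      by (intro infsum_cong infsum_cmult_left[symmetric] mcoeff_column_summable)
    also have "\<dots> = (\<Sum>\<^sub>\<infinity>f. \<Sum>\<^sub>\<infinity>b. A_ser ^ i * ecoeff (-1) i f * mcoeff f b * l ^ b)"
      by (rule fps_infsum_swap[symmetric]) (rule sm2)
    also have "\<dots> = (\<Sum>\<^sub>\<infinity>f. A_ser ^ i * (ecoeff (-1) i f * moebius l ^ f))"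
    proof (rule infsum_cong)
      fix f
      have "(\<Sum>\<^sub>\<infinity>b. A_ser ^ i * ecoeff (-1) i f * mcoeff f b * l ^ b) = A_ser ^ i * ecoeff (-1) i f * (\<Sum>\<^sub>\<infinity>b. mcoeff f b * l ^ b)"
        unfolding mult.assoc[of "A_ser ^ i * ecoeff (-1) i f"] by (rule infsum_cmult_right) (rule sm3)
      then show "(\<Sum>\<^sub>\<infinity>b. A_ser ^ i * ecoeff (-1) i f * mcoeff f b * l ^ b) = A_ser ^ i * (ecoeff (-1) i f * moebius l ^ f)"
        by (simp only: mcoeff_eval[OF l] mult.assoc)
    qed
    also have "\<dots> = A_ser ^ i * (moebius l * inverse (1 - (-1) * moebius l)) ^ i"
    proof -
      have u: "fps_nth (moebius l) 0 = 0" by (simp add: moebius_def fps_mult_nth_0 l lam_0)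
      have "(\<lambda>f. ecoeff (-1) i f * moebius l ^ f) summable_on UNIV"
        using u by (intro fps_summable_on_natI dvd_mult dvd_power_same) (simp add: fps_X_dvd_iff)
      then show ?thesis by (simp only: infsum_cmult_right infsum_ecoeff[OF u])
    qed
    also have "\<dots> = (l + (- lam)) ^ i"
      using moebius_inverse[OF l] by (simp flip: power_mult_distrib)
    also have "\<dots> = (\<Sum>b\<le>i. ?S b * l ^ b)"
      unfolding binomial_ring by (intro sum.cong) (auto simp: mult_ac)
    also have "\<dots> = (\<Sum>\<^sub>\<infinity>b\<in>{..i}. ?S b * l ^ b)" by simp
    also have "\<dots> = (\<Sum>\<^sub>\<infinity>b. ?S b * l ^ b)" by (rule infsum_cong_neutral) auto
    finally show "(\<Sum>\<^sub>\<infinity>b. ?R b * (fps_const c * fps_X) ^ b) = (\<Sum>\<^sub>\<infinity>b. ?S b * (fps_const c * fps_X) ^ b)"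
      by (simp add: l_def)
  qed
  then show ?thesis by (rule fun_cong)
qed

text \<open>For a neighbour with k visits, k - j excursions reach it and j lead on, which gives the
  weight binom(k - 1, j). The identity binom(k-1, j) binom(k-1-j, s-1) = binom(k-1, s-1) binom(k-s,
  j) turns the sum over j into a shift by \<lambda>.\<close>

lemma ecoeff_lam_convolution:
  assumes "k \<ge> 1"
  shows "(\<Sum>j\<le>k. ecoeff lam s (k - j) * of_nat ((k - 1) choose j) * b j) =
    (if s = 0 then 0 else of_nat ((k - 1) choose (s - 1)) * btrans lam b (k - s))"
proof (cases "s = 0")
  case True
  have "ecoeff lam s (k - j) * of_nat ((k - 1) choose j) * b j = 0" if "j \<le> k" for j
    using True that assms by (cases "j = k") (auto simp: ecoeff_def)
  then have "(\<Sum>j\<le>k. ecoeff lam s (k - j) * of_nat ((k - 1) choose j) * b j) = 0"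
    by (intro sum.neutral) auto
  then show ?thesis using True by simp
next
  case False
  show ?thesis
  proof (cases "s \<le> k")
    case s: True
    have "(\<Sum>j\<le>k. ecoeff lam s (k - j) * of_nat ((k - 1) choose j) * b j) =
      (\<Sum>j\<le>k-s. of_nat ((k - 1) choose (s - 1)) * (of_nat ((k - s) choose j) * lam ^ (k - s - j) * b j))"
    proof (rule sum.mono_neutral_cong_right)
      show "\<forall>i\<in>{..k} - {..k - s}. ecoeff lam s (k - i) * of_nat (k - 1 choose i) * b i = 0"
        by (auto simp: ecoeff_def)
      fix j assume "j \<in> {..k-s}"
      then have j: "j + s \<le> k" using s by auto
      have "((k - 1) choose j) * ((k - 1 - j) choose (s - 1)) = ((k - 1) choose (s - 1)) * ((k - s) choose j)"
      proof -
        have e: "k - 1 - j = (k - 1) - j" "(k - 1 - (s - 1)) = k - s" using False s by auto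
        have "((k - 1) choose (j + (s - 1))) * ((j + (s - 1)) choose j) = ((k - 1) choose j) * ((k - 1 - j) choose (s - 1))"
          using choose_mult[of j "j + (s - 1)" "k - 1"] j False by simp
        moreover have "((k - 1) choose (j + (s - 1))) * ((j + (s - 1)) choose (s - 1)) = ((k - 1) choose (s - 1)) * ((k - s) choose j)"
          using choose_mult[of "s - 1" "j + (s - 1)" "k - 1"] j False e by simp
        moreover have "((j + (s - 1)) choose j) = ((j + (s - 1)) choose (s - 1))"
          using binomial_symmetric[of j "j + (s - 1)"] by simp
        ultimately show ?thesis by metis
      qed
      moreover have "(k - j - 1) choose (k - j - s) = (k - 1 - j) choose (s - 1)"
      proof -
        have "k - j - 1 - (k - j - s) = s - 1" "k - j - 1 = k - 1 - j" "k - j - s \<le> k - j - 1" using j False by auto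
        then show ?thesis using binomial_symmetric[of "k - j - s" "k - j - 1"] by simp
      qed
      ultimately have "of_nat ((k - j - 1) choose (k - j - s)) * of_nat ((k - 1) choose j) =
          (of_nat ((k - 1) choose (s - 1)) * of_nat ((k - s) choose j) :: complex fps)"
        by (simp flip: of_nat_mult add: mult.commute)
      moreover have "k - j - s = k - s - j" by simp
      moreover have "ecoeff lam s (k - j) = of_nat ((k - j - 1) choose (k - j - s)) * lam ^ (k - j - s)"
        using j by (simp add: ecoeff_def)
      ultimately show "ecoeff lam s (k - j) * of_nat ((k - 1) choose j) * b j =
        of_nat ((k - 1) choose (s - 1)) * (of_nat ((k - s) choose j) * lam ^ (k - s - j) * b j)"
        by (simp add: mult_ac)
    qed auto
    then show ?thesis using False by (simp add: btrans_def sum_distrib_left)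
  next
    case s: False
    then have "(k - 1) choose (s - 1) = 0" using assms by (intro binomial_eq_0) simp
    moreover have "ecoeff lam s (k - j) = 0" for j using s by (simp add: ecoeff_def)
    ultimately show ?thesis by simp
  qed
qed

section \<open>Solving the transfer equation\<close>

definition beta :: "nat \<Rightarrow> complex fps" where
  "beta f = B_ser ^ (2 * f) / (1 - B_ser ^ (2 * f))"

lemma qq_power_0: "f \<ge> 1 \<Longrightarrow> fps_nth (qq ^ f) 0 = 0"
  by (simp add: fps_nth_power_0 qq_0)

lemma beta_eq: "f \<ge> 1 \<Longrightarrow> beta f = qq ^ f * inverse (1 - qq ^ f)"
  and beta_inverse: "f \<ge> 1 \<Longrightarrow> inverse (1 - qq ^ f) * (1 - qq ^ f) = 1"
  by (simp_all add: beta_def power_mult B_power2 fps_divide_unit qq_power_0 inverse_mult_eq_1)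

lemma beta_dvd: "f \<ge> 1 \<Longrightarrow> fps_X ^ (2 * f) dvd beta f"
  by (simp add: beta_eq X2_power_dvd X2_dvd_qq)

text \<open>This is i times the untruncated G_{i,s}: the factor i/f turns binom(f, i) into binom(f -
  1, i - 1), which up to sign is the coefficient of u^f in (u / (1 + u))^i.\<close>

definition G_scaled :: "nat \<Rightarrow> nat \<Rightarrow> complex fps" where
  "G_scaled i s = (-1) ^ (i + s) * A_ser ^ (i + s) *
     (\<Sum>\<^sub>\<infinity>f\<in>{max i s..}. of_nat ((f - 1) choose (i - 1)) * of_nat (f choose s) * beta f)"

text \<open>Here \<open>a i\<close> counts $i$ excursions with a weight that depends on the visits. If the neighbouring
  point is not marked, the walk beyond it is weighted by \<open>a\<close> again; if it is marked, with a factor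
  \<open>t k\<close> for its $k$ visits, the walk beyond it is weighted by \<open>b\<close>.\<close>

locale transfer_pair =
  fixes a b :: "nat \<Rightarrow> complex fps" and t :: "nat \<Rightarrow> complex"
  assumes t_0: "t 0 = 0"
    and a_dvd: "fps_X ^ (2 * i) dvd a i"
    and b_dvd: "fps_X ^ (2 * i) dvd b i"
    and step: "a i = fps_X ^ (2 * i) *
      (\<Sum>\<^sub>\<infinity>j. of_nat ((i + j - 1) choose j) * (a j + fps_const (t (i + j)) * b j))"
begin

text \<open>The value at u^f of the functional with moments \<open>a\<close>.\<close>

definition V :: "nat \<Rightarrow> complex fps" where
  "V f = (\<Sum>\<^sub>\<infinity>i. mcoeff f i * a i)"

text \<open>The two transforms amount to a shift by \<lambda>. They are kept apart so that the
  centred moments of \<open>b\<close> appear, followed by the shift 2 \<lambda> = 1 - A.\<close>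

definition moment :: "nat \<Rightarrow> nat \<Rightarrow> complex fps" where
  "moment k s = of_nat ((k - 1) choose (s - 1)) * btrans (2 * lam) (btrans (- lam) b) (k - s)"

definition moment_sum :: "nat \<Rightarrow> nat \<Rightarrow> complex fps" where
  "moment_sum f k = (\<Sum>s=1..f. of_nat (f choose s) * (-1) ^ (f - s) * A_ser ^ s * moment k s)"

text \<open>The contribution of a marked neighbour to \<open>V f\<close>, without the factor
  \<open>qq ^ f\<close> of the step towards it.\<close>

definition Y :: "nat \<Rightarrow> complex fps" where
  "Y f = (\<Sum>\<^sub>\<infinity>k\<in>{1..}. fps_const (t k) * moment_sum f k)"

lemma moment_dvd: "fps_X ^ (2 * (k - s)) dvd moment k s"
  unfolding moment_def using X2_dvd_lam by (intro dvd_mult btrans_dvd b_dvd) auto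

lemma moment_sum_dvd: "fps_X ^ (k - f) dvd fps_const (t k) * moment_sum f k"
  unfolding moment_sum_def
proof (intro dvd_mult dvd_sum)
  fix s assume "s \<in> {1..f}"
  then show "fps_X ^ (k - f) dvd moment k s" by (intro X_power_dvdI[OF moment_dvd]) auto
qed

lemma moment_sum_summable: "(\<lambda>k. fps_const (t k) * moment_sum f k) summable_on A"
  by (rule fps_summable_on_shiftI) (rule moment_sum_dvd)

text \<open>The functional at u^f is applied to both sides of \<open>step\<close>. The unmarked part
  is diagonal by \<open>mcoeff_step\<close>; the marked part is collected according to the number of
  visits to the mark, on which its factor depends.\<close>

lemma V_eq: "V f = qq ^ f * V f + qq ^ f * Y f"
proof -
  define F1 where "F1 i j = mcoeff f i * fps_X ^ (2 * i) * of_nat ((i + j - 1) choose j) * a j" for i j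
  define F2 where "F2 i j = mcoeff f i * fps_X ^ (2 * i) * of_nat ((i + j - 1) choose j) * (fps_const (t (i + j)) * b j)" for i j
  have dvd: "fps_X ^ i dvd (fps_X :: complex fps) ^ (2 * i)" for i by (rule le_imp_power_dvd) simp
  have xa: "fps_X ^ j dvd a j" and xb: "fps_X ^ j dvd b j" for j
    using X_power_dvdI[OF a_dvd] X_power_dvdI[OF b_dvd] by simp_all
  have sm1: "(\<lambda>(i, j). F1 i j) summable_on UNIV \<times> UNIV"
    by (rule fps_summable_on_pairI) (use dvd xa in \<open>auto simp: F1_def intro: dvd_mult dvd_mult2\<close>)
  have sm2: "(\<lambda>(i, j). F2 i j) summable_on UNIV \<times> UNIV"
    by (rule fps_summable_on_pairI) (use dvd xb in \<open>auto simp: F2_def intro: dvd_mult dvd_mult2\<close>)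
  have sa: "(\<lambda>j. of_nat ((i + j - 1) choose j) * a j) summable_on UNIV" for i
    by (intro fps_summable_on_natI dvd_mult xa)
  have sb: "(\<lambda>j. of_nat ((i + j - 1) choose j) * (fps_const (t (i + j)) * b j)) summable_on UNIV" for i
    by (intro fps_summable_on_natI dvd_mult xb)
  have si: "(\<lambda>i. infsum (F1 i) UNIV) summable_on UNIV" "(\<lambda>i. infsum (F2 i) UNIV) summable_on UNIV"
    using fps_has_sum_iterated[OF sm1] fps_has_sum_iterated[OF sm2] by (auto intro: has_sum_imp_summable)
  have "mcoeff f i * a i = infsum (F1 i) UNIV + infsum (F2 i) UNIV" for i
  proof -
    have "mcoeff f i * a i = mcoeff f i * fps_X ^ (2 * i) *
       ((\<Sum>\<^sub>\<infinity>j. of_nat ((i + j - 1) choose j) * a j) + (\<Sum>\<^sub>\<infinity>j. of_nat ((i + j - 1) choose j) * (fps_const (t (i + j)) * b j)))"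
      unfolding infsum_add[OF sa sb, symmetric] distrib_left[symmetric] mult.assoc step[symmetric] ..
    moreover have "infsum (F1 i) UNIV = mcoeff f i * fps_X ^ (2 * i) * (\<Sum>\<^sub>\<infinity>j. of_nat ((i + j - 1) choose j) * a j)"
      unfolding F1_def mult.assoc[of "mcoeff f i * fps_X ^ (2 * i)"] by (rule infsum_cmult_right) (rule sa)
    moreover have "infsum (F2 i) UNIV = mcoeff f i * fps_X ^ (2 * i) *
        (\<Sum>\<^sub>\<infinity>j. of_nat ((i + j - 1) choose j) * (fps_const (t (i + j)) * b j))"
      unfolding F2_def mult.assoc[of "mcoeff f i * fps_X ^ (2 * i)"] by (rule infsum_cmult_right) (rule sb)
    ultimately show ?thesis by (simp only: distrib_left)
  qed
  then have "V f = (\<Sum>\<^sub>\<infinity>i. infsum (F1 i) UNIV) + (\<Sum>\<^sub>\<infinity>i. infsum (F2 i) UNIV)"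
    unfolding V_def by (simp add: infsum_add[OF si])
  also have "(\<Sum>\<^sub>\<infinity>i. infsum (F1 i) UNIV) = qq ^ f * V f"
  proof -
    have "(\<Sum>\<^sub>\<infinity>i. infsum (F1 i) UNIV) = (\<Sum>\<^sub>\<infinity>j. \<Sum>\<^sub>\<infinity>i. F1 i j)" by (rule fps_infsum_swap[OF sm1])
    also have "\<dots> = (\<Sum>\<^sub>\<infinity>j. qq ^ f * (mcoeff f j * a j))"
    proof (rule infsum_cong)
      fix j
      have "(\<lambda>i. mcoeff f i * fps_X ^ (2 * i) * of_nat ((i + j - 1) choose j)) summable_on UNIV"
        by (intro fps_summable_on_natI dvd_mult2 dvd_mult dvd)
      then show "(\<Sum>\<^sub>\<infinity>i. F1 i j) = qq ^ f * (mcoeff f j * a j)"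
        unfolding F1_def by (subst infsum_cmult_left) (simp_all only: mcoeff_step mult.assoc[of "qq ^ f"])
    qed
    also have "\<dots> = qq ^ f * V f"
      unfolding V_def by (rule infsum_cmult_right) (intro fps_summable_on_natI dvd_mult xa)
    finally show ?thesis .
  qed
  also have "(\<Sum>\<^sub>\<infinity>i. infsum (F2 i) UNIV) = qq ^ f * Y f"
  proof -
    \<comment> \<open>Regrouping by k = i + j, the number of visits to the neighbour.\<close>
    define F3 where "F3 k j = (if j \<le> k then F2 (k - j) j else 0)" for k j
    have sm3: "(\<lambda>(k, j). F3 k j) summable_on UNIV \<times> UNIV"
    proof (rule fps_summable_on_pairI)
      fix k j
      have "fps_X ^ k dvd F3 k j \<and> fps_X ^ j dvd F3 k j"
      proof (cases "j \<le> k")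
        case True
        have "fps_X ^ (2 * (k - j)) * fps_X ^ (2 * j) dvd F2 (k - j) j"
          unfolding F2_def using b_dvd[of j] by (intro mult_dvd_mono dvd_mult2 dvd_mult) simp_all
        then have "fps_X ^ (2 * k) dvd F2 (k - j) j" using True by (simp flip: power_add distrib_left)
        then have "fps_X ^ k dvd F2 (k - j) j" "fps_X ^ j dvd F2 (k - j) j"
          using X_power_dvdI True by simp_all
        then show ?thesis using True by (simp add: F3_def)
      qed (simp add: F3_def)
      then show "fps_X ^ k dvd (case (k, j) of (k, j) \<Rightarrow> F3 k j)" "fps_X ^ j dvd (case (k, j) of (k, j) \<Rightarrow> F3 k j)" by simp_all
    qed
    have "(\<Sum>\<^sub>\<infinity>i. infsum (F2 i) UNIV) = infsum (\<lambda>(i, j). F2 i j) (UNIV \<times> UNIV)"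
      using fps_infsum_iterated[OF sm2] by simp
    also have "\<dots> = infsum (\<lambda>(k, j). F3 k j) {(k, j). j \<le> k}"
      by (rule infsum_reindex_bij_witness[where i = "\<lambda>(k, j). (k - j, j)" and j = "\<lambda>(i, j). (i + j, j)"])
         (auto simp: F3_def)
    also have "\<dots> = infsum (\<lambda>(k, j). F3 k j) (UNIV \<times> UNIV)"
      by (rule infsum_cong_neutral) (auto simp: F3_def)
    also have "\<dots> = (\<Sum>\<^sub>\<infinity>k. infsum (F3 k) UNIV)"
      using fps_infsum_iterated[OF sm3] by simp
    also have "\<dots> = (\<Sum>\<^sub>\<infinity>k. \<Sum>j\<le>k. F2 (k - j) j)"
    proof (rule infsum_cong)
      fix k
      have "infsum (F3 k) UNIV = infsum (F3 k) {..k}" by (rule infsum_cong_neutral) (auto simp: F3_def)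
      then show "infsum (F3 k) UNIV = (\<Sum>j\<le>k. F2 (k - j) j)" by (simp add: F3_def)
    qed
    also have "\<dots> = (\<Sum>\<^sub>\<infinity>k\<in>{1..}. \<Sum>j\<le>k. F2 (k - j) j)"
    proof (rule infsum_cong_neutral)
      fix k :: nat assume "k \<in> UNIV - {1..}"
      then have "k = 0" by auto
      then show "(\<Sum>j\<le>k. F2 (k - j) j) = 0" by (simp add: F2_def t_0)
    qed auto
    also have "\<dots> = (\<Sum>\<^sub>\<infinity>k\<in>{1..}. qq ^ f * (fps_const (t k) * moment_sum f k))"
    proof (rule infsum_cong)
      fix k :: nat assume "k \<in> {1..}"
      then have k: "k \<ge> 1" by simp
      have "(\<Sum>j\<le>k. F2 (k - j) j) = (\<Sum>j\<le>k. \<Sum>s\<le>f. qq ^ f * fps_const (t k) * (of_nat (f choose s) * (-1) ^ (f - s) * A_ser ^ s)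
          * (ecoeff lam s (k - j) * of_nat ((k - 1) choose j) * b j))"
        unfolding F2_def mcoeff_X sum_distrib_right sum_distrib_left
        by (intro sum.cong refl) (simp add: mult_ac)
      also have "\<dots> = (\<Sum>s\<le>f. qq ^ f * fps_const (t k) * (of_nat (f choose s) * (-1) ^ (f - s) * A_ser ^ s)
          * (\<Sum>j\<le>k. ecoeff lam s (k - j) * of_nat ((k - 1) choose j) * b j))"
        by (subst sum.swap) (simp only: sum_distrib_left)
      also have "\<dots> = (\<Sum>s\<le>f. if s = 0 then 0 else qq ^ f * (fps_const (t k) * (of_nat (f choose s) * (-1) ^ (f - s) * A_ser ^ s * moment k s)))"
        unfolding ecoeff_lam_convolution[OF k]
        by (intro sum.cong refl) (simp add: moment_def btrans_btrans mult_ac)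
      also have "\<dots> = (\<Sum>s=1..f. qq ^ f * (fps_const (t k) * (of_nat (f choose s) * (-1) ^ (f - s) * A_ser ^ s * moment k s)))"
        by (rule sum.mono_neutral_cong_right) auto
      finally show "(\<Sum>j\<le>k. F2 (k - j) j) = qq ^ f * (fps_const (t k) * moment_sum f k)"
        by (simp only: moment_sum_def sum_distrib_left)
    qed
    also have "\<dots> = qq ^ f * Y f"
      unfolding Y_def
    proof (rule infsum_cmult_right)
      show "(\<lambda>k. fps_const (t k) * moment_sum f k) summable_on {1..}" by (rule moment_sum_summable)
    qed
    finally show ?thesis .
  qed
  finally show ?thesis .
qed

text \<open>For f = 0 the equation \<open>V_eq\<close> gives no information on \<open>V 0\<close>,
  as 1 - \<open>qq ^ 0\<close> is 0. That value does not enter centred moments of positive order,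
  whose expansion in u starts at f = i.\<close>

lemma V_beta:
  assumes "f \<ge> 1"
  shows "V f = beta f * Y f"
proof -
  have "(1 - qq ^ f) * V f = qq ^ f * Y f" using V_eq[of f] by (simp add: algebra_simps)
  then have "inverse (1 - qq ^ f) * (1 - qq ^ f) * V f = inverse (1 - qq ^ f) * (qq ^ f * Y f)"
    by (simp only: mult.assoc)
  then show ?thesis unfolding beta_inverse[OF assms] beta_eq[OF assms] by (simp add: mult_ac)
qed

lemma center_eq_V:
  assumes "i \<ge> 1"
  shows "btrans (- lam) a i = (\<Sum>\<^sub>\<infinity>f\<in>{1..}. A_ser ^ i * ecoeff (-1) i f * V f)"
proof -
  have sm: "(\<lambda>(f, b). A_ser ^ i * ecoeff (-1) i f * mcoeff f b * a b) summable_on UNIV \<times> UNIV"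
    by (rule fps_summable_on_pairI) (use mcoeff_pair_dvd[OF a_dvd] in \<open>auto simp: mult.assoc intro: dvd_mult\<close>)
  have smb: "(\<lambda>b. mcoeff f b * a b) summable_on UNIV" for f
    by (intro fps_summable_on_natI mcoeff_pair_dvd a_dvd)
  have "btrans (- lam) a i = (\<Sum>b\<le>i. (\<Sum>\<^sub>\<infinity>f. A_ser ^ i * ecoeff (-1) i f * mcoeff f b) * a b)"
    unfolding mcoeff_inverse[OF assms] btrans_def by (intro sum.cong) auto
  also have "\<dots> = (\<Sum>\<^sub>\<infinity>b\<in>{..i}. (\<Sum>\<^sub>\<infinity>f. A_ser ^ i * ecoeff (-1) i f * mcoeff f b) * a b)" by simp
  also have "\<dots> = (\<Sum>\<^sub>\<infinity>b. (\<Sum>\<^sub>\<infinity>f. A_ser ^ i * ecoeff (-1) i f * mcoeff f b) * a b)"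
    by (rule infsum_cong_neutral) (auto simp: mcoeff_inverse[OF assms])
  also have "\<dots> = (\<Sum>\<^sub>\<infinity>b. \<Sum>\<^sub>\<infinity>f. A_ser ^ i * ecoeff (-1) i f * mcoeff f b * a b)"
    by (simp only: infsum_cmult_left mcoeff_column_summable)
  also have "\<dots> = (\<Sum>\<^sub>\<infinity>f. \<Sum>\<^sub>\<infinity>b. A_ser ^ i * ecoeff (-1) i f * mcoeff f b * a b)"
    by (rule fps_infsum_swap[symmetric]) (rule sm)
  also have "\<dots> = (\<Sum>\<^sub>\<infinity>f. A_ser ^ i * ecoeff (-1) i f * V f)"
    unfolding V_def by (simp only: mult.assoc infsum_cmult_right smb summable_on_cmult_right)
  also have "\<dots> = (\<Sum>\<^sub>\<infinity>f\<in>{1..}. A_ser ^ i * ecoeff (-1) i f * V f)"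
    by (rule infsum_cong_neutral) (use assms in \<open>auto simp: ecoeff_def not_le\<close>)
  finally show ?thesis .
qed

text \<open>\<open>center_eq_V\<close> expresses centred moments through the values V,
  \<open>V_beta\<close> expresses these through centred moments beyond the mark, and carrying out
  the sum over f first leaves \<open>G_scaled\<close>.\<close>

lemma center_step:
  assumes "i \<ge> 1"
  shows "btrans (- lam) a i = (\<Sum>\<^sub>\<infinity>k\<in>{1..}. fps_const (t k) * (\<Sum>s=1..k. G_scaled i s * moment k s))"
proof -
  define T where "T f k = A_ser ^ i * ecoeff (-1) i f * beta f * (fps_const (t k) *
     moment_sum f k)" for f k
  define c where "c f s = A_ser ^ i * ecoeff (-1) i f * beta f * (of_nat (f choose s) * (-1) ^ (f - s) * A_ser ^ s)" for f s
  have cdvd: "fps_X ^ f dvd c f s" if "f \<ge> 1" for f s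
    unfolding c_def using X_power_dvdI[OF beta_dvd[OF that]] by (intro dvd_mult dvd_mult2) auto
  have csm: "(\<lambda>f. c f s) summable_on {1..}" for s
    by (rule fps_summable_on_natI) (use cdvd in auto)
  have Tsm: "(\<lambda>(f, k). T f k) summable_on {1..} \<times> {1..}"
  proof (rule fps_summable_onI[where h = "\<lambda>(f, k). f + (k - f)"])
    fix x :: "nat \<times> nat" assume "x \<in> {1..} \<times> {1..}"
    then obtain f k where x: "x = (f, k)" "f \<ge> 1" by auto
    have "fps_X ^ f * fps_X ^ (k - f) dvd T f k"
      unfolding T_def using X_power_dvdI[OF beta_dvd[OF x(2)], of f]
      by (intro mult_dvd_mono[OF _ moment_sum_dvd] dvd_mult) simp
    then show "fps_X ^ (case x of (f, k) \<Rightarrow> f + (k - f)) dvd (case x of (f, k) \<Rightarrow> T f k)"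
      using x by (simp add: power_add)
  next
    show "finite {x :: nat \<times> nat. x \<in> {1..} \<times> {1..} \<and> (case x of (f, k) \<Rightarrow> f + (k - f)) \<le> n}" for n
      by (rule finite_subset[of _ "{..n} \<times> {..n}"]) auto
  qed
  have "btrans (- lam) a i = (\<Sum>\<^sub>\<infinity>f\<in>{1..}. \<Sum>\<^sub>\<infinity>k\<in>{1..}. T f k)"
    unfolding center_eq_V[OF assms] T_def
  proof (rule infsum_cong)
    fix f :: nat assume "f \<in> {1..}"
    then have "A_ser ^ i * ecoeff (-1) i f * V f = A_ser ^ i * ecoeff (-1) i f * beta f * Y f"
      by (simp add: V_beta mult.assoc)
    then show "A_ser ^ i * ecoeff (-1) i f * V f = (\<Sum>\<^sub>\<infinity>k\<in>{1..}. A_ser ^ i * ecoeff (-1) i f * beta f * (fps_const (t k) *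
     moment_sum f k))"
      unfolding Y_def by (subst infsum_cmult_right) (rule moment_sum_summable, simp)
  qed
  also have "\<dots> = (\<Sum>\<^sub>\<infinity>k\<in>{1..}. \<Sum>\<^sub>\<infinity>f\<in>{1..}. T f k)"
    by (rule fps_infsum_swap[OF Tsm])
  also have "\<dots> = (\<Sum>\<^sub>\<infinity>k\<in>{1..}. fps_const (t k) * (\<Sum>s=1..k. G_scaled i s * moment k s))"
  proof (rule infsum_cong)
    fix k :: nat assume "k \<in> {1..}"
    have "(\<Sum>\<^sub>\<infinity>f\<in>{1..}. T f k) = (\<Sum>\<^sub>\<infinity>f\<in>{1..}. \<Sum>s=1..k. c f s * (fps_const (t k) * moment k s))"
    proof (rule infsum_cong)
      fix f :: nat
      have "T f k = (\<Sum>s=1..f. c f s * (fps_const (t k) * moment k s))"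
        unfolding T_def moment_sum_def c_def sum_distrib_left by (intro sum.cong refl) (simp only: mult_ac)
      \<comment> \<open>The range of s is made independent of f: binom(f, s) vanishes for s > f, and
        binom(k - 1, s - 1) inside \<open>moment\<close> vanishes for s > k.\<close>
      also have "\<dots> = (\<Sum>s=1..f + k. c f s * (fps_const (t k) * moment k s))"
        by (rule sum.mono_neutral_left) (auto simp: c_def)
      also have "\<dots> = (\<Sum>s=1..k. c f s * (fps_const (t k) * moment k s))"
      proof (rule sum.mono_neutral_right)
        have "(k - 1) choose (s - 1) = 0" if "s > k" for s using that \<open>k \<in> {1..}\<close> by (intro binomial_eq_0) auto
        then show "\<forall>s\<in>{1..f + k} - {1..k}. c f s * (fps_const (t k) * moment k s) = 0"
          by (auto simp: moment_def)
      qed auto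
      finally show "T f k = (\<Sum>s=1..k. c f s * (fps_const (t k) * moment k s))" .
    qed
    also have "\<dots> = (\<Sum>s=1..k. (\<Sum>\<^sub>\<infinity>f\<in>{1..}. c f s) * (fps_const (t k) * moment k s))"
      by (subst infsum_sum(1)) (simp_all only: finite_atLeastAtMost summable_on_cmult_left csm infsum_cmult_left)
    also have "\<dots> = (\<Sum>s=1..k. fps_const (t k) * (G_scaled i s * moment k s))"
    proof (intro sum.cong refl)
      fix s assume s: "s \<in> {1..k}"
      have "(\<Sum>\<^sub>\<infinity>f\<in>{1..}. c f s) = (\<Sum>\<^sub>\<infinity>f\<in>{max i s..}. (-1) ^ (i + s) * A_ser ^ (i + s) * (of_nat ((f - 1) choose (i - 1)) * of_nat (f choose s) * beta f))"
      proof (rule infsum_cong_neutral)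
        fix f assume "f \<in> {1..} - {max i s..}"
        then show "c f s = 0" by (auto simp: c_def ecoeff_def)
      next
        fix f assume "f \<in> {1..} \<inter> {max i s..}"
        then have f: "f \<ge> 1" "i \<le> f" "s \<le> f" by auto
        have "((-1) ^ (f - i) * (-1) ^ (f - s) :: complex fps) = (-1) ^ (i + s)"
          using f by (simp flip: power_add add: minus_one_power_iff)
        moreover have "(f - 1) choose (f - i) = (f - 1) choose (i - 1)"
          using f assms binomial_symmetric[of "i - 1" "f - 1"] by simp
        ultimately show "c f s = (-1) ^ (i + s) * A_ser ^ (i + s) * (of_nat ((f - 1) choose (i - 1)) * of_nat (f choose s) * beta f)"
          using f by (simp add: c_def ecoeff_def power_add mult_ac)
      next
        fix f assume "f \<in> {max i s..} - {1..}"
        then show "(-1) ^ (i + s) * A_ser ^ (i + s) * (of_nat ((f - 1) choose (i - 1)) * of_nat (f choose s) * beta f) = 0"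
          using assms by auto
      qed
      also have "\<dots> = G_scaled i s"
        unfolding G_scaled_def
      proof (rule infsum_cmult_right)
        show "(\<lambda>f. of_nat ((f - 1) choose (i - 1)) * of_nat (f choose s) * beta f) summable_on {max i s..}"
          using assms by (intro fps_summable_on_natI dvd_mult X_power_dvdI[OF beta_dvd]) auto
      qed
      finally show "(\<Sum>\<^sub>\<infinity>f\<in>{1..}. c f s) * (fps_const (t k) * moment k s) = fps_const (t k) * (G_scaled i s * moment k s)"
        by (simp only: mult_ac)
    qed
    finally show "(\<Sum>\<^sub>\<infinity>f\<in>{1..}. T f k) = fps_const (t k) * (\<Sum>s=1..k. G_scaled i s * moment k s)"
      by (simp only: sum_distrib_left)
  qed
  finally show ?thesis .
qed

end

section \<open>Centred moments\<close>

text \<open>Umbrally, the moments of a sum of two independent variables.\<close>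

definition conv :: "(nat \<Rightarrow> complex fps) \<Rightarrow> (nat \<Rightarrow> complex fps) \<Rightarrow> nat \<Rightarrow> complex fps" where
  "conv x y n = (\<Sum>i\<le>n. of_nat (n choose i) * (x i * y (n - i)))"

definition egf :: "(nat \<Rightarrow> complex fps) \<Rightarrow> complex fps fps" where
  "egf x = Abs_fps (\<lambda>i. fps_const (1 / fact i) * x i)"

lemma egf_conv: "egf (conv x y) = egf x * egf y"
proof (rule fps_ext)
  fix n
  have key: "fps_const (1 / fact n) * (of_nat (n choose i) * (x i * y (n - i))) =
      fps_const (1 / fact i) * x i * (fps_const (1 / fact (n - i)) * y (n - i))" if "i \<le> n" for i
  proof -
    have "(1 / fact n * of_nat (n choose i) :: complex) = 1 / fact i * (1 / fact (n - i))"
      using that by (simp add: binomial_fact)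
    then have "fps_const (1 / fact n) * (of_nat (n choose i) :: complex fps) = fps_const (1 / fact i) * fps_const (1 / fact (n - i))"
      by (simp only: fps_of_nat[symmetric] fps_const_mult)
    then show ?thesis by (metis (no_types, lifting) mult.assoc mult.left_commute)
  qed
  show "fps_nth (egf (conv x y)) n = fps_nth (egf x * egf y) n"
    unfolding fps_mult_nth egf_def conv_def fps_nth_Abs_fps sum_distrib_left atLeast0AtMost
    by (intro sum.cong refl key) simp
qed

lemma egf_inject: "egf x = egf y \<Longrightarrow> x = y"
proof
  fix n assume "egf x = egf y"
  then have "fps_const (1 / fact n) * x n = fps_const (1 / fact n) * y n"
    by (metis egf_def fps_nth_Abs_fps)
  then show "x n = y n" by (simp add: fps_eq_iff)
qed

lemma btrans_eq_conv: "btrans c x = conv x (\<lambda>j. c ^ j)"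
  by (rule ext) (simp add: btrans_def conv_def mult_ac)

text \<open>For exponential generating functions \<open>conv\<close> is the product and a shift is
  multiplication by an exponential series, so both shifts may be moved to one factor.\<close>

lemma conv_btrans_btrans: "conv (btrans c x) (btrans d y) = conv x (btrans (c + d) y)"
proof (rule egf_inject)
  have "btrans (c + d) y = btrans c (btrans d y)" by (rule ext) (simp add: btrans_btrans)
  then show "egf (conv (btrans c x) (btrans d y)) = egf (conv x (btrans (c + d) y))"
    by (simp only: btrans_eq_conv[of c] btrans_eq_conv[of d] egf_conv mult_ac)
qed

lemma infsum_choose_0:
  fixes x :: "nat \<Rightarrow> complex fps"
  shows "(\<Sum>\<^sub>\<infinity>j. of_nat ((0 + j - 1) choose j) * x j) = x 0"
proof -
  have "(\<Sum>\<^sub>\<infinity>j. of_nat ((0 + j - 1) choose j) * x j) = (\<Sum>\<^sub>\<infinity>j\<in>{0}. of_nat ((0 + j - 1) choose j) * x j)"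
    by (rule infsum_cong_neutral) auto
  then show ?thesis by simp
qed

section \<open>The functional without marks\<close>

definition unmarked :: "nat \<Rightarrow> complex fps" where
  "unmarked = forest_gf (\<lambda>_. 1)"

lemma unmarked_0: "unmarked 0 = 1"
  by (simp add: unmarked_def forest_gf_0)

lemma transfer_pair_unmarked: "transfer_pair unmarked unmarked (\<lambda>_. 0)"
proof
  fix i
  show "unmarked i = fps_X ^ (2 * i) * (\<Sum>\<^sub>\<infinity>j. of_nat ((i + j - 1) choose j) * (unmarked j + fps_const 0 * unmarked j))"
  proof (cases "i = 0")
    case True
    then show ?thesis by (simp only: infsum_choose_0 unmarked_0) simp
  next
    case False
    then show ?thesis unfolding unmarked_def
      by (subst forest_gf_step[where g = "\<lambda>_. 1"]) auto
  qed
qed (simp_all add: unmarked_def forest_gf_dvd)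

text \<open>Every term of \<open>center_step\<close> carries a mark, and here all marks are
  0.\<close>

lemma center_unmarked: "btrans (- lam) unmarked i = of_bool (i = 0)"
proof (cases "i = 0")
  case False
  interpret transfer_pair unmarked unmarked "\<lambda>_. 0" by (rule transfer_pair_unmarked)
  show ?thesis using center_step[of i] False by simp
qed (simp add: unmarked_0)

lemma btrans_delta: "btrans c (\<lambda>i. of_bool (i = 0)) n = c ^ n"
proof -
  have "btrans c (\<lambda>i. of_bool (i = 0)) n = (\<Sum>j\<in>{0}. of_nat (n choose j) * c ^ (n - j) * of_bool (j = 0))"
    unfolding btrans_def by (rule sum.mono_neutral_right) auto
  then show ?thesis by simp
qed

lemma btrans_0_left: "btrans 0 x n = x n"
proof -
  have "btrans 0 x n = (\<Sum>j\<in>{n}. of_nat (n choose j) * 0 ^ (n - j) * x j)"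
    unfolding btrans_def by (rule sum.mono_neutral_right) auto
  then show ?thesis by simp
qed

lemma uncenter: "x = btrans lam (btrans (- lam) x)"
  by (rule ext) (simp add: btrans_btrans btrans_0_left)

lemma unmarked_eq: "unmarked i = lam ^ i"
proof -
  have "btrans (- lam) unmarked = (\<lambda>i. of_bool (i = 0))" by (rule ext) (rule center_unmarked)
  then show ?thesis using uncenter[of unmarked] by (metis btrans_delta)
qed

context
  fixes \<tau> :: "nat \<Rightarrow> complex"
  assumes \<tau>_0: "\<tau> 0 = 0"
begin

text \<open>Beyond a marked point any further marks are allowed, so both sequences of the pair are
  the same and the result is a genuine system of equations.\<close>

lemma transfer_pair_wt: "transfer_pair (forest_gf (wt \<tau>)) (forest_gf (wt \<tau>)) \<tau>"
proof
  fix i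
  show "forest_gf (wt \<tau>) i = fps_X ^ (2 * i) * (\<Sum>\<^sub>\<infinity>j. of_nat ((i + j - 1) choose j) * (forest_gf (wt \<tau>) j + fps_const (\<tau> (i + j)) * forest_gf (wt \<tau>) j))"
  proof (cases "i = 0")
    case True
    then show ?thesis by (simp only: infsum_choose_0) (simp add: \<tau>_0)
  next
    case False
    have "forest_gf (\<lambda>c. (1 + \<tau> (i + length c)) * wt \<tau> c) j = forest_gf (wt \<tau>) j + fps_const (\<tau> (i + j)) * forest_gf (wt \<tau>) j" for j
      by (rule fps_ext) (auto simp: forest_gf_nth forests_def sum_distrib_left algebra_simps sum.distrib[symmetric] intro!: sum.cong)
    then show ?thesis using False
      by (subst forest_gf_step[where g = "\<lambda>c. (1 + \<tau> (i + length c)) * wt \<tau> c"]) (auto simp: wt.simps[of \<tau> "_ :: tree list"])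
  qed
qed (simp_all add: \<tau>_0 forest_gf_dvd)

text \<open>Beyond the single mark no further mark may follow. The second sequence is therefore
  known, and \<open>center_step\<close> becomes an explicit formula.\<close>

lemma transfer_pair_mk: "transfer_pair (forest_gf (mk \<tau>)) unmarked \<tau>"
proof
  fix i
  show "forest_gf (mk \<tau>) i = fps_X ^ (2 * i) * (\<Sum>\<^sub>\<infinity>j. of_nat ((i + j - 1) choose j) * (forest_gf (mk \<tau>) j + fps_const (\<tau> (i + j)) * unmarked j))"
  proof (cases "i = 0")
    case True
    then show ?thesis by (simp only: infsum_choose_0) (simp add: \<tau>_0)
  next
    case False
    have "forest_gf (\<lambda>c. \<tau> (i + length c) + mk \<tau> c) j = forest_gf (mk \<tau>) j + fps_const (\<tau> (i + j)) * unmarked j" for j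
    proof (rule fps_ext)
      fix n
      have "(\<Sum>ts\<in>forests j n. \<tau> (i + length ts) + mk \<tau> ts) = (\<Sum>ts\<in>forests j n. mk \<tau> ts + \<tau> (i + j) * 1)"
        by (intro sum.cong refl) (simp add: forests_def)
      then show "fps_nth (forest_gf (\<lambda>c. \<tau> (i + length c) + mk \<tau> c) j) n = fps_nth (forest_gf (mk \<tau>) j + fps_const (\<tau> (i + j)) * unmarked j) n"
        by (simp only: unmarked_def forest_gf_nth sum.distrib sum_distrib_left fps_add_nth fps_mult_left_const_nth)
    qed
    then show ?thesis using False
      by (subst forest_gf_step[where g = "\<lambda>c. \<tau> (i + length c) + mk \<tau> c"]) (auto simp: mk.simps[of \<tau> "_ :: tree list"])
  qed
qed (simp_all add: \<tau>_0 forest_gf_dvd unmarked_def)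

end

section \<open>Coefficients without truncation\<close>

definition G_full :: "nat \<Rightarrow> nat \<Rightarrow> complex fps" where
  "G_full i j = (-1) ^ (i + j) * A_ser ^ (i + j) *
      (\<Sum>\<^sub>\<infinity>f\<in>{max i j..}.
         fps_const (1 / of_nat f * of_nat (f choose i) * of_nat (f choose j)) *
         (B_ser ^ (2 * f) / (1 - B_ser ^ (2 * f))))"

lemma G_full_summable: "i \<ge> 1 \<Longrightarrow> (\<lambda>f. fps_const (c f) * (B_ser ^ (2 * f) / (1 - B_ser ^ (2 * f)))) summable_on {max i j..}"
  by (intro fps_summable_on_natI dvd_mult) (auto simp: beta_def[symmetric] intro!: X_power_dvdI[OF beta_dvd])

lemma G_scaled_eq_G_full:
  assumes "i \<ge> 1"
  shows "G_scaled i s = of_nat i * G_full i s"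
proof -
  have "of_nat i * (\<Sum>\<^sub>\<infinity>f\<in>{max i s..}. fps_const (1 / of_nat f * of_nat (f choose i) * of_nat (f choose s)) * beta f)
    = (\<Sum>\<^sub>\<infinity>f\<in>{max i s..}. of_nat i * (fps_const (1 / of_nat f * of_nat (f choose i) * of_nat (f choose s)) * beta f))"
    unfolding beta_def by (rule infsum_cmult_right[symmetric]) (rule G_full_summable[OF assms])
  also have "\<dots> = (\<Sum>\<^sub>\<infinity>f\<in>{max i s..}. of_nat ((f - 1) choose (i - 1)) * of_nat (f choose s) * beta f)"
  proof (rule infsum_cong)
    fix f assume "f \<in> {max i s..}"
    then have f: "f \<ge> 1" "f \<ge> i" using assms by auto
    have "i * (f choose i) = f * ((f - 1) choose (i - 1))"
      using assms by (intro times_binomial_minus1_eq) simp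
    then have "of_nat i * of_nat (f choose i) = (of_nat f * of_nat ((f - 1) choose (i - 1)) :: complex)"
      by (simp flip: of_nat_mult)
    then have "of_nat i * (1 / of_nat f * of_nat (f choose i) * of_nat (f choose s)) = (of_nat ((f - 1) choose (i - 1)) * of_nat (f choose s) :: complex)"
      using f by (simp add: field_simps)
    then have "of_nat i * fps_const (1 / of_nat f * of_nat (f choose i) * of_nat (f choose s)) = (of_nat ((f - 1) choose (i - 1)) * of_nat (f choose s) :: complex fps)"
      by (simp only: fps_of_nat[symmetric] fps_const_mult)
    then show "of_nat i * (fps_const (1 / of_nat f * of_nat (f choose i) * of_nat (f choose s)) * beta f) =
      of_nat ((f - 1) choose (i - 1)) * of_nat (f choose s) * beta f"
      by (metis mult.assoc)
  qed
  finally show ?thesis unfolding G_scaled_def G_full_def beta_def[symmetric] by (simp add: mult_ac)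
qed

definition T2_full :: "nat \<Rightarrow> nat \<Rightarrow> complex fps" where
  "T2_full k1 k2 = (\<Sum>l1 = 0..k1 - 1. \<Sum>l2 = 0..k2 - 1.
        of_nat ((k1 - 1) choose l1) * of_nat ((k2 - 1) choose l2) *
        (1 - A_ser) ^ (l1 + l2) * G_full (k1 - l1) (k2 - l2))"

lemma G_full_dvd: "i \<ge> 1 \<Longrightarrow> fps_X ^ (2 * max i j) dvd G_full i j"
  unfolding G_full_def beta_def[symmetric]
  by (intro dvd_mult fps_X_power_dvd_infsum) (auto intro!: X_power_dvdI[OF beta_dvd])

lemma X2_dvd_one_minus_A: "fps_X ^ 2 dvd 1 - A_ser"
  unfolding one_minus_A using X2_dvd_lam by simp

lemma one_minus_A': "1 - A_ser = lam + lam"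
  by (simp add: one_minus_A)

lemma X_powers_dvdI: "fps_X ^ a * fps_X ^ b dvd c \<Longrightarrow> m \<le> a + b \<Longrightarrow> fps_X ^ m dvd (c :: complex fps)"
  by (simp only: power_add[symmetric]) (rule dvd_trans[OF le_imp_power_dvd])

lemma T2_full_dvd:
  assumes "k1 \<ge> 1" "k2 \<ge> 1"
  shows "fps_X ^ (k1 + k2) dvd T2_full k1 k2"
  unfolding T2_full_def
proof (intro dvd_sum)
  fix l1 l2 assume l: "l1 \<in> {0..k1 - 1}" "l2 \<in> {0..k2 - 1}"
  have "fps_X ^ (2 * (l1 + l2)) * fps_X ^ (2 * max (k1 - l1) (k2 - l2)) dvd (1 - A_ser) ^ (l1 + l2) * G_full (k1 - l1) (k2 - l2)"
    using l assms by (intro mult_dvd_mono X2_power_dvd X2_dvd_one_minus_A G_full_dvd) auto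
  moreover have "k1 + k2 \<le> 2 * (l1 + l2) + 2 * max (k1 - l1) (k2 - l2)" by auto
  ultimately have "fps_X ^ (k1 + k2) dvd (1 - A_ser) ^ (l1 + l2) * G_full (k1 - l1) (k2 - l2)"
    by (rule X_powers_dvdI)
  then show "fps_X ^ (k1 + k2) dvd of_nat ((k1 - 1) choose l1) * of_nat ((k2 - 1) choose l2) *
        (1 - A_ser) ^ (l1 + l2) * G_full (k1 - l1) (k2 - l2)"
    by (simp add: mult.assoc)
qed

definition centred :: "(nat \<Rightarrow> complex) \<Rightarrow> nat \<Rightarrow> complex fps" where
  "centred \<tau> = btrans (- lam) (forest_gf (wt \<tau>))"

text \<open>The centred moments with exactly one mark. They are also the inhomogeneous term of the
  system for \<open>centred\<close>: the part in which only the moment of order 0, equal to 1, is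
  kept beyond the first mark.\<close>

definition rho :: "(nat \<Rightarrow> complex) \<Rightarrow> nat \<Rightarrow> complex fps" where
  "rho \<tau> i = (\<Sum>\<^sub>\<infinity>k\<in>{1..}. fps_const (\<tau> k) * (\<Sum>s=1..k. G_scaled i s * (of_nat ((k - 1) choose (s - 1)) * (1 - A_ser) ^ (k - s))))"

lemma centred_0: "centred \<tau> 0 = 1"
  by (simp add: centred_def forest_gf_0 wt.simps[of \<tau> "[]"])

lemma centred_dvd: "fps_X ^ (2 * i) dvd centred \<tau> i"
  unfolding centred_def using X2_dvd_lam by (intro btrans_dvd forest_gf_dvd) simp

lemma centred_step:
  assumes "\<tau> 0 = 0" "i \<ge> 1"
  shows "centred \<tau> i = (\<Sum>\<^sub>\<infinity>k\<in>{1..}. fps_const (\<tau> k) * (\<Sum>s=1..k. G_scaled i s * (of_nat ((k - 1) choose (s - 1)) * btrans (1 - A_ser) (centred \<tau>) (k - s))))"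
proof -
  interpret transfer_pair "forest_gf (wt \<tau>)" "forest_gf (wt \<tau>)" \<tau> by (rule transfer_pair_wt) fact
  show ?thesis using center_step[OF assms(2)] unfolding moment_def centred_def one_minus_A .
qed

lemma center_mk:
  assumes "\<tau> 0 = 0" "i \<ge> 1"
  shows "btrans (- lam) (forest_gf (mk \<tau>)) i = rho \<tau> i"
proof -
  interpret transfer_pair "forest_gf (mk \<tau>)" unmarked \<tau> by (rule transfer_pair_mk) fact
  have "btrans (- lam) unmarked = (\<lambda>i. of_bool (i = 0))" by (rule ext) (rule center_unmarked)
  then show ?thesis using center_step[OF assms(2)] unfolding moment_def rho_def one_minus_A by (simp only: btrans_delta)
qed

lemma rho_eq_G_full:
  assumes "i \<ge> 1"
  shows "rho \<tau> i = (\<Sum>\<^sub>\<infinity>k\<in>{1..}. fps_const (\<tau> k) * (of_nat i * (\<Sum>l=0..k-1. of_nat ((k - 1) choose l) * (1 - A_ser) ^ l * G_full i (k - l))))"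
  unfolding rho_def
proof (rule infsum_cong)
  fix k :: nat assume k: "k \<in> {1..}"
  have "(\<Sum>s=1..k. G_scaled i s * (of_nat ((k - 1) choose (s - 1)) * (1 - A_ser) ^ (k - s))) =
     (\<Sum>l=0..k-1. of_nat i * (of_nat ((k - 1) choose l) * (1 - A_ser) ^ l * G_full i (k - l)))"
  proof (rule sum.reindex_bij_witness[where i = "\<lambda>l. k - l" and j = "\<lambda>s. k - s"])
    fix s assume s: "s \<in> {1..k}"
    have "k - 1 - (s - 1) = k - s" "s - 1 \<le> k - 1" using s by auto
    then have "(k - 1) choose (k - s) = (k - 1) choose (s - 1)" using binomial_symmetric[of "s - 1" "k - 1"] by simp
    then show "of_nat i * (of_nat ((k - 1) choose (k - s)) * (1 - A_ser) ^ (k - s) * G_full i (k - (k - s))) =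
      G_scaled i s * (of_nat ((k - 1) choose (s - 1)) * (1 - A_ser) ^ (k - s))"
      using s by (simp add: G_scaled_eq_G_full[OF assms] mult_ac)
  qed (use k in auto)
  then show "fps_const (\<tau> k) * (\<Sum>s=1..k. G_scaled i s * (of_nat ((k - 1) choose (s - 1)) * (1 - A_ser) ^ (k - s))) =
    fps_const (\<tau> k) * (of_nat i * (\<Sum>l=0..k-1. of_nat ((k - 1) choose l) * (1 - A_ser) ^ l * G_full i (k - l)))"
    by (simp only: sum_distrib_left)
qed

lemma G_full_row_dvd:
  assumes "i \<ge> 1"
  shows "fps_X ^ (i + k) dvd (\<Sum>l=0..k-1. of_nat ((k - 1) choose l) * (1 - A_ser) ^ l * G_full i (k - l))"
proof (intro dvd_sum)
  fix l assume l: "l \<in> {0..k-1}"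
  have "fps_X ^ (2 * l) * fps_X ^ (2 * max i (k - l)) dvd (1 - A_ser) ^ l * G_full i (k - l)"
    using l assms by (intro mult_dvd_mono X2_power_dvd X2_dvd_one_minus_A G_full_dvd) auto
  moreover have "i + k \<le> 2 * l + 2 * max i (k - l)" by auto
  ultimately have "fps_X ^ (i + k) dvd (1 - A_ser) ^ l * G_full i (k - l)"
    by (rule X_powers_dvdI)
  then show "fps_X ^ (i + k) dvd of_nat ((k - 1) choose l) * (1 - A_ser) ^ l * G_full i (k - l)"
    by (simp add: mult.assoc)
qed

text \<open>The factor i between \<open>G_scaled\<close> and \<open>G_full\<close> is absorbed by i
  binom(m, i) = m binom(m - 1, i - 1). With l = m - i the sum over i becomes the outer sum of
  T2.\<close>

lemma btrans_rho:
  assumes \<tau>: "\<tau> 0 = 0"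
  shows "btrans (1 - A_ser) (btrans (- lam) (forest_gf (mk \<tau>))) m = of_nat m * (\<Sum>\<^sub>\<infinity>k\<in>{1..}. fps_const (\<tau> k) * T2_full m k)"
proof (cases "m = 0")
  case True
  then show ?thesis by (simp add: forest_gf_0 mk.simps[of \<tau> "[]"])
next
  case False
  define row where "row i k = (\<Sum>l=0..k-1. of_nat ((k - 1) choose l) * (1 - A_ser) ^ l * G_full i (k - l))" for i k
  have sm: "(\<lambda>k. fps_const (\<tau> k) * (of_nat i * row i k)) summable_on {1..}" if "i \<ge> 1" for i
    unfolding row_def
    by (intro fps_summable_on_natI dvd_mult)
       (rule dvd_trans[OF le_imp_power_dvd G_full_row_dvd[OF that]], simp)
  have "btrans (1 - A_ser) (btrans (- lam) (forest_gf (mk \<tau>))) m =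
     (\<Sum>i=1..m. of_nat (m choose i) * (1 - A_ser) ^ (m - i) * btrans (- lam) (forest_gf (mk \<tau>)) i)"
  proof -
    have "btrans (- lam) (forest_gf (mk \<tau>)) 0 = 0" by (simp add: forest_gf_0 mk.simps[of \<tau> "[]"])
    then show ?thesis unfolding btrans_def[of "1 - A_ser"] 
      by (intro sum.mono_neutral_cong_right) (auto simp: not_less_eq_eq)
  qed
  also have "\<dots> = (\<Sum>i=1..m. (\<Sum>\<^sub>\<infinity>k\<in>{1..}. of_nat (m choose i) * (1 - A_ser) ^ (m - i) * (fps_const (\<tau> k) * (of_nat i * row i k))))"
  proof (rule sum.cong)
    fix i assume "i \<in> {1..m}"
    then have i: "i \<ge> 1" by simp
    show "of_nat (m choose i) * (1 - A_ser) ^ (m - i) * btrans (- lam) (forest_gf (mk \<tau>)) i =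
      (\<Sum>\<^sub>\<infinity>k\<in>{1..}. of_nat (m choose i) * (1 - A_ser) ^ (m - i) * (fps_const (\<tau> k) * (of_nat i * row i k)))"
      unfolding center_mk[of \<tau>, OF \<tau> i] rho_eq_G_full[OF i] row_def[symmetric]
      by (rule infsum_cmult_right[symmetric]) (rule sm[OF i])
  qed simp
  also have "\<dots> = (\<Sum>\<^sub>\<infinity>k\<in>{1..}. \<Sum>i=1..m. of_nat (m choose i) * (1 - A_ser) ^ (m - i) * (fps_const (\<tau> k) * (of_nat i * row i k)))"
  proof (rule infsum_sum(1)[symmetric])
    fix i assume "i \<in> {1..m}"
    then show "(\<lambda>k. of_nat (m choose i) * (1 - A_ser) ^ (m - i) * (fps_const (\<tau> k) * (of_nat i * row i k))) summable_on {1..}"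
      by (intro summable_on_cmult_right sm) simp
  qed simp
  also have "\<dots> = (\<Sum>\<^sub>\<infinity>k\<in>{1..}. of_nat m * (fps_const (\<tau> k) * T2_full m k))"
  proof (rule infsum_cong)
    fix k :: nat
    have "(\<Sum>i=1..m. of_nat (m choose i) * (1 - A_ser) ^ (m - i) * (fps_const (\<tau> k) * (of_nat i * row i k))) =
      (\<Sum>l1=0..m-1. of_nat m * (fps_const (\<tau> k) * (of_nat ((m - 1) choose l1) * (1 - A_ser) ^ l1 * row (m - l1) k)))"
    proof (rule sum.reindex_bij_witness[where i = "\<lambda>l. m - l" and j = "\<lambda>i. m - i"])
      fix i assume i: "i \<in> {1..m}"
      have "i * (m choose i) = m * ((m - 1) choose (i - 1))"
        using i by (intro times_binomial_minus1_eq) simp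
      also have "(m - 1) choose (i - 1) = (m - 1) choose (m - i)"
      proof -
        have "m - 1 - (i - 1) = m - i" "i - 1 \<le> m - 1" using i by auto
        then show ?thesis using binomial_symmetric[of "i - 1" "m - 1"] by simp
      qed
      finally have "of_nat i * of_nat (m choose i) = (of_nat m * of_nat ((m - 1) choose (m - i)) :: complex fps)"
        by (simp flip: of_nat_mult)
      then have "(of_nat i * of_nat (m choose i)) * ((1 - A_ser) ^ (m - i) * (fps_const (\<tau> k) * row i k)) =
          (of_nat m * of_nat ((m - 1) choose (m - i))) * ((1 - A_ser) ^ (m - i) * (fps_const (\<tau> k) * row i k))"
        by (simp only:)
      moreover have "m - (m - i) = i" using i by simp
      ultimately show "of_nat m * (fps_const (\<tau> k) * (of_nat ((m - 1) choose (m - i)) * (1 - A_ser) ^ (m - i) * row (m - (m - i)) k))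
         = of_nat (m choose i) * (1 - A_ser) ^ (m - i) * (fps_const (\<tau> k) * (of_nat i * row i k))"
        by (simp only: mult_ac)
    qed (use False in auto)
    also have "\<dots> = of_nat m * (fps_const (\<tau> k) * T2_full m k)"
      unfolding T2_full_def row_def sum_distrib_left
      by (intro sum.cong refl) (simp add: power_add mult_ac)
    finally show "(\<Sum>i=1..m. of_nat (m choose i) * (1 - A_ser) ^ (m - i) * (fps_const (\<tau> k) * (of_nat i * row i k)))
      = of_nat m * (fps_const (\<tau> k) * T2_full m k)" .
  qed
  also have "\<dots> = of_nat m * (\<Sum>\<^sub>\<infinity>k\<in>{1..}. fps_const (\<tau> k) * T2_full m k)"
  proof (rule infsum_cmult_right)
    show "(\<lambda>k. fps_const (\<tau> k) * T2_full m k) summable_on {1..}"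
      using False by (intro fps_summable_on_natI dvd_mult)
        (rule dvd_trans[OF le_imp_power_dvd T2_full_dvd], auto)
  qed
  finally show ?thesis .
qed

text \<open>Excursions to both sides are umbrally (L + R)^k with L + R = (L - \<lambda>) + ((R -
  \<lambda>) + 2 \<lambda>). The whole shift 2 \<lambda> = 1 - A is put on the right side, where
  \<open>btrans_rho\<close> evaluates it.\<close>

lemma marked_excursions:
  assumes "\<tau> 0 = 0"
  shows "(\<Sum>i\<le>k. of_nat (k choose i) * (forest_gf (wt \<tau>) i * forest_gf (mk \<tau>) (k - i))) =
    (\<Sum>i\<le>k. of_nat (k choose i) * (centred \<tau> i * (of_nat (k - i) * (\<Sum>\<^sub>\<infinity>k'\<in>{1..}. fps_const (\<tau> k') * T2_full (k - i) k'))))"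
proof -
  have "conv (forest_gf (wt \<tau>)) (forest_gf (mk \<tau>)) = conv (btrans lam (centred \<tau>)) (btrans lam (btrans (- lam) (forest_gf (mk \<tau>))))"
    unfolding centred_def by (simp flip: uncenter)
  also have "\<dots> = conv (centred \<tau>) (btrans (1 - A_ser) (btrans (- lam) (forest_gf (mk \<tau>))))"
    by (simp only: conv_btrans_btrans one_minus_A')
  finally show ?thesis
    unfolding btrans_rho[of \<tau>, OF assms, symmetric] conv_def[symmetric] by metis
qed

lemma unmarked_excursions:
  "(\<Sum>i\<le>k. of_nat (k choose i) * (forest_gf (\<lambda>_. 1) i * forest_gf (\<lambda>_. 1) (k - i))) = (1 - A_ser) ^ k"
proof -
  have "(\<Sum>i\<le>k. of_nat (k choose i) * (forest_gf (\<lambda>_. 1) i * forest_gf (\<lambda>_. 1) (k - i))) = (lam + lam) ^ k"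
    unfolding unmarked_def[symmetric] unmarked_eq binomial_ring by (simp add: mult.assoc)
  then show ?thesis by (simp only: one_minus_A')
qed

section \<open>Matrix coefficients\<close>

text \<open>Trinomial revision extracts binom(s - 1, j) from the sum; the rest is a Vandermonde
  convolution whose missing term u = 0 is zero.\<close>

lemma sum_choose_choose_choose:
  assumes "s \<ge> 1"
  shows "(\<Sum>t<s. (i choose (t + 1)) * ((s - 1) choose t) * (t choose j)) = ((s - 1) choose j) * ((i + s - 1 - j) choose s)"
proof (cases "j < s")
  case True
  have "(\<Sum>t<s. (i choose (t + 1)) * ((s - 1) choose t) * (t choose j)) =
    (\<Sum>t<s. ((s - 1) choose j) * ((i choose (t + 1)) * ((s - 1 - j) choose (s - (t + 1)))))"
  proof (rule sum.cong)
    fix t assume t: "t \<in> {..<s}"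
    show "(i choose (t + 1)) * ((s - 1) choose t) * (t choose j) = ((s - 1) choose j) * ((i choose (t + 1)) * ((s - 1 - j) choose (s - (t + 1))))"
    proof (cases "j \<le> t")
      case True
      have "((s - 1) choose t) * (t choose j) = ((s - 1) choose j) * ((s - 1 - j) choose (t - j))"
        using True t by (intro choose_mult) auto
      moreover have "(s - 1 - j) choose (t - j) = (s - 1 - j) choose (s - (t + 1))"
      proof -
        have "s - 1 - j - (t - j) = s - (t + 1)" "t - j \<le> s - 1 - j" using t True by auto
        then show ?thesis using binomial_symmetric[of "t - j" "s - 1 - j"] by simp
      qed
      ultimately show ?thesis by (simp add: mult_ac)
    next
      case False
      then have z: "(s - 1 - j) choose (s - (t + 1)) = 0" using t \<open>j < s\<close> by (intro binomial_eq_0) auto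
      show ?thesis unfolding z using False by simp
    qed
  qed simp
  also have "\<dots> = ((s - 1) choose j) * (\<Sum>t<s. (i choose (Suc t)) * ((s - 1 - j) choose (s - Suc t)))"
    by (simp add: sum_distrib_left)
  also have "(\<Sum>t<s. (i choose (Suc t)) * ((s - 1 - j) choose (s - Suc t))) = (\<Sum>u\<le>s. (i choose u) * ((s - 1 - j) choose (s - u)))"
  proof -
    have "(s - 1 - j) choose s = 0" using assms by (intro binomial_eq_0) auto
    moreover have "{..s} = {..<Suc s}" by auto
    ultimately show ?thesis by (simp only: sum.lessThan_Suc_shift) simp
  qed
  also have "\<dots> = (i + (s - 1 - j)) choose s" by (rule vandermonde)
  also have "i + (s - 1 - j) = i + s - 1 - j" using True by simp
  finally show ?thesis .
next
  case False
  have "(s - 1) choose j = 0" using False assms by (intro binomial_eq_0) auto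
  moreover have "(\<Sum>t<s. (i choose (t + 1)) * ((s - 1) choose t) * (t choose j)) = 0"
  proof (rule sum.neutral, rule ballI)
    fix t assume "t \<in> {..<s}"
    then have "t choose j = 0" using False by (intro binomial_eq_0) auto
    then show "(i choose (t + 1)) * ((s - 1) choose t) * (t choose j) = 0" by (simp only: mult_0_right)
  qed
  ultimately show ?thesis by (simp only: mult_0)
qed

text \<open>A product of two binomials in f becomes a combination of single binomials; t is the
  origin of the second matrix index. Vandermonde expands binom(f + t, i + s - 1), the previous lemma
  sums over t, and after one more trinomial revision Vandermonde sums over j.\<close>

lemma choose_product:
  assumes "i \<ge> 1" "s \<ge> 1" "f \<ge> 1"
  shows "((f - 1) choose (i - 1)) * (f choose s) = (\<Sum>t<s. (i choose (t + 1)) * ((s - 1) choose t) * ((f + t) choose (i + s - 1)))"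
proof -
  define r where "r = i + s - 1"
  have "(\<Sum>t<s. (i choose (t + 1)) * ((s - 1) choose t) * ((f + t) choose r)) =
    (\<Sum>t<s. \<Sum>j\<le>r. (i choose (t + 1)) * ((s - 1) choose t) * ((t choose j) * (f choose (r - j))))"
    by (simp only: add.commute[of f] vandermonde[symmetric] sum_distrib_left)
  also have "\<dots> = (\<Sum>j\<le>r. (\<Sum>t<s. (i choose (t + 1)) * ((s - 1) choose t) * (t choose j)) * (f choose (r - j)))"
    by (subst sum.swap) (simp only: sum_distrib_right mult.assoc)
  also have "\<dots> = (\<Sum>j\<le>r. ((s - 1) choose j) * ((r - j) choose s) * (f choose (r - j)))"
    unfolding sum_choose_choose_choose[OF assms(2)] r_def ..
  also have "\<dots> = (\<Sum>j\<le>i-1. (((s - 1) choose j) * ((f - s) choose (i - 1 - j))) * (f choose s))"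
  proof (rule sum.mono_neutral_cong_right)
    show "\<forall>j\<in>{..r} - {..i - 1}. ((s - 1) choose j) * ((r - j) choose s) * (f choose (r - j)) = 0"
      using assms by (auto simp: r_def intro!: binomial_eq_0)
    fix j assume "j \<in> {..i-1}"
    then have j: "j \<le> i - 1" by simp
    have "((r - j) choose s) * (f choose (r - j)) = ((f - s) choose (i - 1 - j)) * (f choose s)"
    proof (cases "r - j \<le> f")
      case True
      then have "(f choose (r - j)) * ((r - j) choose s) = (f choose s) * ((f - s) choose (r - j - s))"
        using j assms by (intro choose_mult) (auto simp: r_def)
      moreover have "r - j - s = i - 1 - j" using j assms by (auto simp: r_def)
      ultimately show ?thesis by (simp add: mult_ac)
    next
      case False
      show ?thesis
      proof (cases "s \<le> f")
        case True
        then have z: "(f - s) choose (i - 1 - j) = 0" using False j assms by (intro binomial_eq_0) (auto simp: r_def)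
        show ?thesis unfolding z using False by simp
      next
        case s: False
        then have "f choose s = 0" "f choose (r - j) = 0" using False by (auto intro!: binomial_eq_0)
        then show ?thesis by (simp only: mult_0_right)
      qed
    qed
    then show "((s - 1) choose j) * ((r - j) choose s) * (f choose (r - j)) = (((s - 1) choose j) * ((f - s) choose (i - 1 - j))) * (f choose s)"
      by (simp add: mult.assoc)
  qed (use assms in \<open>auto simp: r_def\<close>)
  also have "\<dots> = ((s - 1 + (f - s)) choose (i - 1)) * (f choose s)"
    by (simp only: sum_distrib_right[symmetric] vandermonde)
  also have "\<dots> = ((f - 1) choose (i - 1)) * (f choose s)"
  proof (cases "s \<le> f")
    case True
    then have "s - 1 + (f - s) = f - 1" using assms by auto
    then show ?thesis by simp
  qed simp
  finally show ?thesis by (simp add: r_def)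
qed

definition H_full :: "nat \<Rightarrow> nat \<Rightarrow> complex fps" where
  "H_full i j = A_ser ^ j *
      (\<Sum>\<^sub>\<infinity>f\<in>{j - i..}.
         of_nat ((f + i - 1) choose (j - 1)) * (B_ser ^ (2 * f) / (1 - B_ser ^ (2 * f))))"

lemma H_full_dvd: "i < j \<Longrightarrow> fps_X ^ (2 * (j - i)) dvd H_full i j"
  unfolding H_full_def beta_def[symmetric]
  by (intro dvd_mult fps_X_power_dvd_infsum) (auto intro!: X_power_dvdI[OF beta_dvd])

text \<open>The single binomial binom(f + t, i + s - 1) is the one in H with indices t + 1 and i +
  s. The ranges of f are matched through the zeros of the binomials.\<close>

lemma G_scaled_eq_H_full:
  assumes "i \<ge> 1" "s \<ge> 1"
  shows "G_scaled i s = (\<Sum>t<s. (-1) ^ (i + s) * of_nat ((i choose (t + 1)) * ((s - 1) choose t)) * H_full (t + 1) (i + s))"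
proof -
  have sm: "(\<lambda>f. of_nat ((f + t) choose m) * beta f) summable_on {1..}" for t m
    by (intro fps_summable_on_natI dvd_mult) (auto intro!: X_power_dvdI[OF beta_dvd])
  have H: "H_full (t + 1) (i + s) = A_ser ^ (i + s) * (\<Sum>\<^sub>\<infinity>f\<in>{1..}. of_nat ((f + t) choose (i + s - 1)) * beta f)" if "t < s" for t
  proof -
    have "(\<Sum>\<^sub>\<infinity>f\<in>{i + s - (t + 1)..}. of_nat ((f + (t + 1) - 1) choose (i + s - 1)) * beta f) =
      (\<Sum>\<^sub>\<infinity>f\<in>{1..}. of_nat ((f + t) choose (i + s - 1)) * beta f)"
      by (rule infsum_cong_neutral) (use that assms in \<open>auto intro!: binomial_eq_0\<close>)
    then show ?thesis unfolding H_full_def beta_def[symmetric] by simp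
  qed
  have "(\<Sum>\<^sub>\<infinity>f\<in>{max i s..}. of_nat ((f - 1) choose (i - 1)) * of_nat (f choose s) * beta f) =
     (\<Sum>\<^sub>\<infinity>f\<in>{1..}. of_nat ((f - 1) choose (i - 1)) * of_nat (f choose s) * beta f)"
    by (rule infsum_cong_neutral) (use assms in \<open>auto simp: not_le intro!: binomial_eq_0\<close>)
  also have "\<dots> = (\<Sum>\<^sub>\<infinity>f\<in>{1..}. \<Sum>t<s. of_nat ((i choose (t + 1)) * ((s - 1) choose t)) * (of_nat ((f + t) choose (i + s - 1)) * beta f))"
  proof (rule infsum_cong)
    fix f :: nat assume "f \<in> {1..}"
    then have "of_nat ((f - 1) choose (i - 1)) * of_nat (f choose s) = (\<Sum>t<s. of_nat ((i choose (t + 1)) * ((s - 1) choose t)) * of_nat ((f + t) choose (i + s - 1)) :: complex fps)"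
      using choose_product[OF assms, of f] by (simp flip: of_nat_mult of_nat_sum)
    then show "of_nat ((f - 1) choose (i - 1)) * of_nat (f choose s) * beta f =
       (\<Sum>t<s. of_nat ((i choose (t + 1)) * ((s - 1) choose t)) * (of_nat ((f + t) choose (i + s - 1)) * beta f))"
      by (simp only: sum_distrib_right mult.assoc)
  qed
  also have "\<dots> = (\<Sum>t<s. of_nat ((i choose (t + 1)) * ((s - 1) choose t)) * (\<Sum>\<^sub>\<infinity>f\<in>{1..}. of_nat ((f + t) choose (i + s - 1)) * beta f))"
  proof (subst infsum_sum(1))
    show "(\<lambda>f. of_nat ((i choose (t + 1)) * ((s - 1) choose t)) * (of_nat ((f + t) choose (i + s - 1)) * beta f)) summable_on {1..}" for t
      by (rule summable_on_cmult_right[OF sm])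
    show "(\<Sum>t<s. \<Sum>\<^sub>\<infinity>f\<in>{1..}. of_nat ((i choose (t + 1)) * ((s - 1) choose t)) * (of_nat ((f + t) choose (i + s - 1)) * beta f)) =
      (\<Sum>t<s. of_nat ((i choose (t + 1)) * ((s - 1) choose t)) * (\<Sum>\<^sub>\<infinity>f\<in>{1..}. of_nat ((f + t) choose (i + s - 1)) * beta f))"
      by (intro sum.cong refl infsum_cmult_right sm)
  qed simp
  finally have "G_scaled i s = (-1) ^ (i + s) * A_ser ^ (i + s) * (\<Sum>t<s. of_nat ((i choose (t + 1)) * ((s - 1) choose t)) * (\<Sum>\<^sub>\<infinity>f\<in>{1..}. of_nat ((f + t) choose (i + s - 1)) * beta f))"
    unfolding G_scaled_def by simp
  also have "\<dots> = (\<Sum>t<s. (-1) ^ (i + s) * of_nat ((i choose (t + 1)) * ((s - 1) choose t)) * H_full (t + 1) (i + s))"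
    unfolding sum_distrib_left by (intro sum.cong refl) (simp only: H lessThan_iff mult_ac)
  finally show ?thesis .
qed

section \<open>Congruence modulo powers of z\<close>

definition fps_cong :: "nat \<Rightarrow> complex fps \<Rightarrow> complex fps \<Rightarrow> bool" where
  "fps_cong m x y \<longleftrightarrow> fps_X ^ m dvd x - y"

lemma fps_cong_iff: "fps_cong m x y \<longleftrightarrow> (\<forall>n<m. fps_nth x n = fps_nth y n)"
  by (simp add: fps_cong_def fps_X_power_dvd_iff)

lemma fps_cong_refl [simp]: "fps_cong m x x" by (simp add: fps_cong_iff)
lemma fps_cong_sym: "fps_cong m x y \<Longrightarrow> fps_cong m y x" by (simp add: fps_cong_iff)
lemma fps_cong_trans [trans]: "fps_cong m x y \<Longrightarrow> fps_cong m y z \<Longrightarrow> fps_cong m x z" by (simp add: fps_cong_iff)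
lemma fps_cong_eq_trans [trans]: "fps_cong m x y \<Longrightarrow> y = z \<Longrightarrow> fps_cong m x z" "x = y \<Longrightarrow> fps_cong m y z \<Longrightarrow> fps_cong m x z" by auto
lemma fps_cong_add: "fps_cong m x y \<Longrightarrow> fps_cong m x' y' \<Longrightarrow> fps_cong m (x + x') (y + y')" by (simp add: fps_cong_iff)
lemma fps_cong_mult: "fps_cong m x y \<Longrightarrow> fps_cong m x' y' \<Longrightarrow> fps_cong m (x * x') (y * y')"
  by (auto simp: fps_cong_iff fps_mult_nth intro!: sum.cong)
lemma fps_cong_sum: "(\<And>i. i \<in> I \<Longrightarrow> fps_cong m (f i) (g i)) \<Longrightarrow> fps_cong m (sum f I) (sum g I)"
  by (auto simp: fps_cong_iff fps_sum_nth intro!: sum.cong)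
lemma fps_cong_0_iff: "fps_cong m x 0 \<longleftrightarrow> fps_X ^ m dvd x" by (simp add: fps_cong_def)

lemma fps_cong_infsum:
  assumes "\<And>x. x \<in> A \<Longrightarrow> fps_cong m (f x) (g x)" "f summable_on A" "g summable_on A"
  shows "fps_cong m (infsum f A) (infsum g A)"
proof -
  have "infsum f A - infsum g A = infsum (\<lambda>x. f x + - g x) A"
    using infsum_add[OF assms(2) summable_on_uminus[THEN iffD2, OF assms(3)]] by (simp add: infsum_uminus)
  also have "fps_X ^ m dvd \<dots>"
    by (rule fps_X_power_dvd_infsum) (use assms(1) in \<open>simp add: fps_cong_def\<close>)
  finally show ?thesis by (simp add: fps_cong_def)
qed

lemma fps_cong_ztrunc: "fps_cong (2 * N + 1) (ztrunc (2 * N) x) x"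
  by (simp add: fps_cong_iff ztrunc_def)

lemma ztrunc_dvd: "fps_X ^ m dvd x \<Longrightarrow> fps_X ^ m dvd ztrunc n x"
  by (auto simp: fps_X_power_dvd_iff ztrunc_def)

lemma ztrunc_nth_big: "n > 2 * N \<Longrightarrow> fps_nth (ztrunc (2 * N) x) n = 0"
  by (simp add: ztrunc_def)

section \<open>Truncation\<close>

lemma ztrunc_cong: "fps_cong (2 * N + 1) x y \<Longrightarrow> ztrunc (2 * N) x = ztrunc (2 * N) y"
  by (auto simp: fps_eq_iff fps_cong_iff ztrunc_def)

lemma G_ser_eq: "G_ser N i j = ztrunc (2 * N) (G_full i j)"
  by (simp add: G_ser_def G_full_def)

lemma H_ser_eq: "H_ser N i j = ztrunc (2 * N) (H_full i j)"
  by (simp add: H_ser_def H_full_def)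

text \<open>Inner truncations are invisible modulo z^(2N+1), and the outer truncation depends only
  on the residue class there, so the nested truncations collapse to one.\<close>

lemma T2_eq: "T2 N k1 k2 = ztrunc (2 * N) (T2_full k1 k2)"
  unfolding T2_def T2_full_def G_ser_eq
  by (intro ztrunc_cong fps_cong_sum fps_cong_mult fps_cong_refl fps_cong_ztrunc)

definition Grow :: "nat \<Rightarrow> nat \<Rightarrow> complex fps" where
  "Grow i k = (\<Sum>l = 0..k - 1. of_nat ((k - 1) choose l) * (1 - A_ser) ^ l * G_full i (k - l))"

lemma Psi_eq: "Psi N k (r, t) = (if t = 0 then ztrunc (2 * N) ((-1) ^ (r + 1) * Grow (r + 1) k) else 0)"
proof (cases "t = 0")
  case True
  then show ?thesis unfolding Psi_def Grow_def G_ser_eq prod.case if_P[OF True]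
    by (intro ztrunc_cong fps_cong_sum fps_cong_mult fps_cong_refl fps_cong_ztrunc)
qed (simp add: Psi_def ztrunc_def)

lemma Phi_eq: "Phi N k1 k2 (r, t) = (if k1 < r + t + 2 then 0 else
    ztrunc (2 * N) (fps_const ((-1) ^ (r + 1) * fact (k1 - 1) / (fact r * fact (k1 - 2 - r - t))) * T2_full (k1 - 1 - r - t) k2))"
proof (cases "k1 < r + t + 2")
  case False
  show ?thesis unfolding Phi_def T2_eq prod.case if_not_P[OF False]
    by (intro ztrunc_cong fps_cong_sum fps_cong_mult fps_cong_refl fps_cong_ztrunc)
qed (simp add: Phi_def)

text \<open>Apart from the factor (-1)^r / r!, a row (r, t) of Q enters only through p = r + t. This
  is what later lets sums over row pairs collapse to sums over the order r + t + 1.\<close>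

definition Q_core :: "nat \<Rightarrow> nat \<Rightarrow> nat \<Rightarrow> nat \<Rightarrow> complex fps" where
  "Q_core k p r t = (if k < p + t + 2 then 0 else fps_const (1 / (fact t * fact (t + 1))) *
     (\<Sum>e = 0..k - 2 - p - t. fps_const (fact (k - 1) / (fact e * fact (k - 2 - p - t - e))) *
        (1 - A_ser) ^ (k - 2 - p - t - e) * (-1) ^ e * H_full (t + 1) (r + e + 2 * t + 2)))"

lemma Q_eq: "Q_mat N k (r, t) (r', t') = ztrunc (2 * N) (fps_const (1 / fact r) * (-1) ^ r * Q_core k (r + t) r' t')"
proof (cases "k < r + t + t' + 2")
  case True
  then show ?thesis by (simp add: Q_mat_def Q_core_def ztrunc_def)
next
  case False
  have "fps_const (1 / fact r) * (-1) ^ r * Q_core k (r + t) r' t' =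
    fps_const (1 / (fact t' * fact (t' + 1) * fact r)) *
        (\<Sum>e = 0..k - 2 - r - t - t'.
           fps_const (fact (k - 1) / (fact e * fact (k - 2 - r - t - t' - e))) *
           (1 - A_ser) ^ (k - 2 - r - t - t' - e) * (-1) ^ (r + e) *
           H_full (t' + 1) (r' + e + 2 * t' + 2))"
  proof -
    have h1: "fps_const (1 / fact r) * fps_const (1 / (fact t' * fact (t' + 1))) = fps_const (1 / (fact t' * fact (t' + 1) * fact r) :: complex)"
      by (simp add: mult_ac)
    have h2: "(-1) ^ r * (\<Sum>e = 0..k - 2 - r - t - t'. fps_const (fact (k - 1) / (fact e * fact (k - 2 - r - t - t' - e))) *
          (1 - A_ser) ^ (k - 2 - r - t - t' - e) * (-1) ^ e * H_full (t' + 1) (r' + e + 2 * t' + 2)) =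
       (\<Sum>e = 0..k - 2 - r - t - t'. fps_const (fact (k - 1) / (fact e * fact (k - 2 - r - t - t' - e))) *
           (1 - A_ser) ^ (k - 2 - r - t - t' - e) * (-1) ^ (r + e) * H_full (t' + 1) (r' + e + 2 * t' + 2))"
      unfolding sum_distrib_left power_add by (intro sum.cong refl) (simp only: mult_ac)
    have h3: "Q_core k (r + t) r' t' = fps_const (1 / (fact t' * fact (t' + 1))) *
        (\<Sum>e = 0..k - 2 - r - t - t'. fps_const (fact (k - 1) / (fact e * fact (k - 2 - r - t - t' - e))) *
          (1 - A_ser) ^ (k - 2 - r - t - t' - e) * (-1) ^ e * H_full (t' + 1) (r' + e + 2 * t' + 2))"
      using False by (simp add: Q_core_def add.assoc)
    have "a * b * (c * d) = x * y" if "a * c = x" "b * d = y" for a b c d x y :: "complex fps"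
      unfolding that[symmetric] by (simp only: mult_ac)
    from this[OF h1 h2] show ?thesis unfolding h3 .
  qed
  then show ?thesis unfolding Q_mat_def H_ser_eq prod.case if_not_P[OF False]
    by (simp only:) (intro ztrunc_cong fps_cong_sum fps_cong_mult fps_cong_refl fps_cong_ztrunc)
qed

text \<open>The first bound, in the column index, makes the matrix entries small enough for the
  geometric series; the second, growing with k, makes the sum over k converge.\<close>

lemma Q_core_dvd:
  "fps_X ^ (2 * (r + t + 1)) dvd Q_core k p r t" (is ?thesis1)
  "fps_X ^ (2 * (k - 1 - p)) dvd Q_core k p r t" (is ?thesis2)
proof -
  have "fps_X ^ (2 * (r + t + 1)) dvd Q_core k p r t \<and> fps_X ^ (2 * (k - 1 - p)) dvd Q_core k p r t"
  proof (cases "k < p + t + 2")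
    case True
    then show ?thesis by (simp add: Q_core_def)
  next
    case False
    have *: "fps_X ^ n dvd Q_core k p r t" if "\<And>e. e \<le> k - 2 - p - t \<Longrightarrow> n \<le> 2 * (k - 2 - p - t - e) + 2 * (r + e + t + 1)" for n
    proof -
      have "fps_X ^ n dvd fps_const (fact (k - 1) / (fact e * fact (k - 2 - p - t - e))) *
        (1 - A_ser) ^ (k - 2 - p - t - e) * (-1) ^ e * H_full (t + 1) (r + e + 2 * t + 2)" if e: "e \<in> {0..k - 2 - p - t}" for e
      proof -
        have "fps_X ^ (2 * (r + e + 2 * t + 2 - (t + 1))) dvd H_full (t + 1) (r + e + 2 * t + 2)" by (rule H_full_dvd) simp
        also have "r + e + 2 * t + 2 - (t + 1) = r + e + t + 1" by simp
        finally have "fps_X ^ (2 * (k - 2 - p - t - e)) * fps_X ^ (2 * (r + e + t + 1)) dvd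
          (1 - A_ser) ^ (k - 2 - p - t - e) * H_full (t + 1) (r + e + 2 * t + 2)"
          by (intro mult_dvd_mono X2_power_dvd X2_dvd_one_minus_A)
        then have "fps_X ^ n dvd (1 - A_ser) ^ (k - 2 - p - t - e) * H_full (t + 1) (r + e + 2 * t + 2)"
          by (rule X_powers_dvdI) (use \<open>\<And>e. e \<le> k - 2 - p - t \<Longrightarrow> n \<le> 2 * (k - 2 - p - t - e) + 2 * (r + e + t + 1)\<close> e in simp)
        then have "fps_X ^ n dvd (fps_const (fact (k - 1) / (fact e * fact (k - 2 - p - t - e))) * (-1) ^ e) *
          ((1 - A_ser) ^ (k - 2 - p - t - e) * H_full (t + 1) (r + e + 2 * t + 2))" by (rule dvd_mult)
        then show ?thesis by (simp only: mult_ac)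
      qed
      then show ?thesis unfolding Q_core_def if_not_P[OF False] by (rule dvd_mult[OF dvd_sum])
    qed
    show ?thesis using False by (intro conjI *) auto
  qed
  then show ?thesis1 ?thesis2 by auto
qed

section \<open>The linear system for the centred moments\<close>

context
  fixes \<tau> :: "nat \<Rightarrow> complex"
  assumes \<tau>_0: "\<tau> 0 = 0"
begin

text \<open>The part of column (r, t) that comes from a mark with k visits, with the sum over row
  pairs already collapsed to the centred moments of order j.\<close>

definition Srow :: "nat \<Rightarrow> nat \<Rightarrow> nat \<Rightarrow> complex fps" where
  "Srow k r t = (\<Sum>j=1..k-1. - (fps_const (1 / fact j) * centred \<tau> j * Q_core k (j - 1) r t))"

lemma Srow_dvd: "fps_X ^ k dvd Srow k r t" "fps_X ^ (2 * (r + t + 1)) dvd Srow k r t"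
proof -
  show "fps_X ^ k dvd Srow k r t"
    unfolding Srow_def
  proof (intro dvd_sum)
    fix j assume j: "j \<in> {1..k-1}"
    have "fps_X ^ (2 * j) * fps_X ^ (2 * (k - 1 - (j - 1))) dvd centred \<tau> j * Q_core k (j - 1) r t"
      by (intro mult_dvd_mono centred_dvd Q_core_dvd)
    then have "fps_X ^ k dvd centred \<tau> j * Q_core k (j - 1) r t" by (rule X_powers_dvdI) (use j in auto)
    then show "fps_X ^ k dvd - (fps_const (1 / fact j) * centred \<tau> j * Q_core k (j - 1) r t)"
      by (simp add: mult.assoc)
  qed
  show "fps_X ^ (2 * (r + t + 1)) dvd Srow k r t"
    unfolding Srow_def by (intro dvd_sum dvd_minus_iff[THEN iffD2] dvd_mult Q_core_dvd)
qed

lemma Srow_summable: "(\<lambda>k. fps_const (\<tau> k) * Srow k r t) summable_on {1..}"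
  by (intro fps_summable_on_natI dvd_mult Srow_dvd)

text \<open>A closed form, up to truncation, of \<open>Psi\<close> multiplied by the geometric series. The pair $(r, t)$
  splits the index $r + t + 1$ of \<open>centred\<close>: see \<open>centred_eq_vstar\<close>.\<close>

definition vstar :: "nat \<times> nat \<Rightarrow> complex fps" where
  "vstar = (\<lambda>(r, t). (if t = 0 then fps_const ((-1) ^ (r + 1) / of_nat (r + 1)) * rho \<tau> (r + 1) else 0)
     + (\<Sum>\<^sub>\<infinity>k\<in>{1..}. fps_const (\<tau> k) * Srow k r t))"

lemma rho_dvd: "i \<ge> 1 \<Longrightarrow> fps_X ^ (2 * i) dvd rho \<tau> i"
  unfolding rho_def
  by (intro fps_X_power_dvd_infsum dvd_mult dvd_sum dvd_mult2)
     (simp add: G_scaled_eq_G_full, intro dvd_mult dvd_trans[OF le_imp_power_dvd G_full_dvd], auto)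

lemma vstar_dvd: "fps_X ^ (2 * (r + t + 1)) dvd vstar (r, t)"
  unfolding vstar_def prod.case
  by (intro dvd_add fps_X_power_dvd_infsum dvd_mult Srow_dvd)
     (use rho_dvd[of "r + 1"] in auto)

text \<open>The shift in \<open>centred_step\<close> is expanded in centred moments of order j. The
  term j = 0, where the moment is 1, gives \<open>rho\<close>; the others are sorted by j.\<close>

lemma centred_split:
  assumes "i \<ge> 1"
  shows "centred \<tau> i = rho \<tau> i + (\<Sum>\<^sub>\<infinity>k\<in>{1..}. fps_const (\<tau> k) *
    (\<Sum>j=1..k-1. centred \<tau> j * (\<Sum>s=1..k-j. of_nat (((k - 1) choose (s - 1)) * ((k - s) choose j)) * (1 - A_ser) ^ (k - s - j) * G_scaled i s)))"
proof -
  define R1 where "R1 k = (\<Sum>s=1..k. G_scaled i s * (of_nat ((k - 1) choose (s - 1)) * (1 - A_ser) ^ (k - s)))" for k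
  define R2 where "R2 k = (\<Sum>s=1..k. \<Sum>j=1..k-1. if j \<le> k - s then of_nat (((k - 1) choose (s - 1)) * ((k - s) choose j)) * (1 - A_ser) ^ (k - s - j) * G_scaled i s * centred \<tau> j else 0)" for k
  have Gcd: "fps_X ^ (2 * s) dvd G_scaled i s" for s
    unfolding G_scaled_eq_G_full[OF assms] by (intro dvd_mult dvd_trans[OF le_imp_power_dvd G_full_dvd]) (use assms in auto)
  have "fps_X ^ k dvd R1 k" for k
    unfolding R1_def
  proof (intro dvd_sum)
    fix s assume s: "s \<in> {1..k}"
    have "fps_X ^ (2 * s) * fps_X ^ (2 * (k - s)) dvd G_scaled i s * (of_nat ((k - 1) choose (s - 1)) * (1 - A_ser) ^ (k - s))"
      by (intro mult_dvd_mono Gcd dvd_mult X2_power_dvd X2_dvd_one_minus_A)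
    then show "fps_X ^ k dvd G_scaled i s * (of_nat ((k - 1) choose (s - 1)) * (1 - A_ser) ^ (k - s))"
      by (rule X_powers_dvdI) (use s in auto)
  qed
  then have sm1: "(\<lambda>k. fps_const (\<tau> k) * R1 k) summable_on {1..}"
    by (intro fps_summable_on_natI dvd_mult)
  have "fps_X ^ k dvd R2 k" for k
    unfolding R2_def
  proof (intro dvd_sum)
    fix s j assume s: "s \<in> {1..k}" "j \<in> {1..k-1}"
    show "fps_X ^ k dvd (if j \<le> k - s then of_nat (((k - 1) choose (s - 1)) * ((k - s) choose j)) * (1 - A_ser) ^ (k - s - j) * G_scaled i s * centred \<tau> j else 0)"
    proof (cases "j \<le> k - s")
      case True
      have "fps_X ^ (2 * (k - s - j)) * fps_X ^ (2 * s) * fps_X ^ (2 * j) dvd (1 - A_ser) ^ (k - s - j) * G_scaled i s * centred \<tau> j"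
        by (intro mult_dvd_mono Gcd X2_power_dvd X2_dvd_one_minus_A centred_dvd)
      then have "fps_X ^ (2 * (k - s - j) + 2 * s) * fps_X ^ (2 * j) dvd (1 - A_ser) ^ (k - s - j) * G_scaled i s * centred \<tau> j"
        by (simp only: power_add)
      then have "fps_X ^ k dvd (1 - A_ser) ^ (k - s - j) * G_scaled i s * centred \<tau> j"
        by (rule X_powers_dvdI) (use True s in auto)
      then show ?thesis using True by (simp add: mult.assoc)
    qed simp
  qed
  then have sm2: "(\<lambda>k. fps_const (\<tau> k) * R2 k) summable_on {1..}"
    by (intro fps_summable_on_natI dvd_mult)
  have "centred \<tau> i = (\<Sum>\<^sub>\<infinity>k\<in>{1..}. fps_const (\<tau> k) * R1 k + fps_const (\<tau> k) * R2 k)"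
    unfolding centred_step[of \<tau>, OF \<tau>_0 assms]
  proof (rule infsum_cong)
    fix k :: nat assume k: "k \<in> {1..}"
    have "(\<Sum>s=1..k. G_scaled i s * (of_nat ((k - 1) choose (s - 1)) * btrans (1 - A_ser) (centred \<tau>) (k - s))) = R1 k + R2 k"
      unfolding R1_def R2_def sum.distrib[symmetric]
    proof (rule sum.cong)
      fix s assume s: "s \<in> {1..k}"
      have "btrans (1 - A_ser) (centred \<tau>) (k - s) = (1 - A_ser) ^ (k - s) +
         (\<Sum>j=1..k-s. of_nat ((k - s) choose j) * (1 - A_ser) ^ (k - s - j) * centred \<tau> j)"
        unfolding btrans_def atMost_atLeast0 by (subst sum.atLeast_Suc_atMost) (simp_all add: centred_0)
      also have "(\<Sum>j=1..k-s. of_nat ((k - s) choose j) * (1 - A_ser) ^ (k - s - j) * centred \<tau> j) =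
        (\<Sum>j=1..k-1. if j \<le> k - s then of_nat ((k - s) choose j) * (1 - A_ser) ^ (k - s - j) * centred \<tau> j else 0)"
        by (rule sum.mono_neutral_cong_left) (use s in auto)
      finally have "G_scaled i s * (of_nat ((k - 1) choose (s - 1)) * btrans (1 - A_ser) (centred \<tau>) (k - s)) =
        G_scaled i s * (of_nat ((k - 1) choose (s - 1)) * (1 - A_ser) ^ (k - s)) + 
        (\<Sum>j=1..k-1. G_scaled i s * (of_nat ((k - 1) choose (s - 1)) * (if j \<le> k - s then of_nat ((k - s) choose j) * (1 - A_ser) ^ (k - s - j) * centred \<tau> j else 0)))"
        by (simp only: distrib_left sum_distrib_left)
      also have "(\<Sum>j=1..k-1. G_scaled i s * (of_nat ((k - 1) choose (s - 1)) * (if j \<le> k - s then of_nat ((k - s) choose j) * (1 - A_ser) ^ (k - s - j) * centred \<tau> j else 0)))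
        = (\<Sum>j=1..k-1. if j \<le> k - s then of_nat (((k - 1) choose (s - 1)) * ((k - s) choose j)) * (1 - A_ser) ^ (k - s - j) * G_scaled i s * centred \<tau> j else 0)"
        by (intro sum.cong refl) (simp add: mult_ac)
      finally show "G_scaled i s * (of_nat ((k - 1) choose (s - 1)) * btrans (1 - A_ser) (centred \<tau>) (k - s)) =
         G_scaled i s * (of_nat ((k - 1) choose (s - 1)) * (1 - A_ser) ^ (k - s)) +
         (\<Sum>j=1..k-1. if j \<le> k - s then of_nat (((k - 1) choose (s - 1)) * ((k - s) choose j)) * (1 - A_ser) ^ (k - s - j) * G_scaled i s * centred \<tau> j else 0)" .
    qed simp
    then show "fps_const (\<tau> k) * (\<Sum>s=1..k. G_scaled i s * (of_nat ((k - 1) choose (s - 1)) * btrans (1 - A_ser) (centred \<tau>) (k - s))) =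
      fps_const (\<tau> k) * R1 k + fps_const (\<tau> k) * R2 k" by (simp only: distrib_left)
  qed
  also have "\<dots> = rho \<tau> i + (\<Sum>\<^sub>\<infinity>k\<in>{1..}. fps_const (\<tau> k) * R2 k)"
    unfolding infsum_add[OF sm1 sm2] by (simp add: rho_def R1_def)
  finally have split: "centred \<tau> i = rho \<tau> i + (\<Sum>\<^sub>\<infinity>k\<in>{1..}. fps_const (\<tau> k) * R2 k)" .
  have R2: "R2 k = (\<Sum>j=1..k-1. centred \<tau> j * (\<Sum>s=1..k-j. of_nat (((k - 1) choose (s - 1)) * ((k - s) choose j)) * (1 - A_ser) ^ (k - s - j) * G_scaled i s))" for k
  proof -
    have "R2 k = (\<Sum>j=1..k-1. \<Sum>s=1..k. if j \<le> k - s then of_nat (((k - 1) choose (s - 1)) * ((k - s) choose j)) * (1 - A_ser) ^ (k - s - j) * G_scaled i s * centred \<tau> j else 0)"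
      unfolding R2_def by (rule sum.swap)
    also have "\<dots> = (\<Sum>j=1..k-1. \<Sum>s=1..k-j. centred \<tau> j * (of_nat (((k - 1) choose (s - 1)) * ((k - s) choose j)) * (1 - A_ser) ^ (k - s - j) * G_scaled i s))"
    proof (rule sum.cong)
      fix j assume j: "j \<in> {1..k-1}"
      show "(\<Sum>s=1..k. if j \<le> k - s then of_nat (((k - 1) choose (s - 1)) * ((k - s) choose j)) * (1 - A_ser) ^ (k - s - j) * G_scaled i s * centred \<tau> j else 0)
        = (\<Sum>s=1..k-j. centred \<tau> j * (of_nat (((k - 1) choose (s - 1)) * ((k - s) choose j)) * (1 - A_ser) ^ (k - s - j) * G_scaled i s))"
        by (rule sum.mono_neutral_cong_right) (use j in \<open>auto simp: mult_ac\<close>)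
    qed simp
    finally show ?thesis by (simp only: sum_distrib_left)
  qed
  show ?thesis unfolding split R2 ..
qed

end

text \<open>In terms of factorials, i!, (s - 1)! and (k - s)! cancel.\<close>

lemma coefficient_identity:
  assumes "j \<ge> 1" "t < i" "t < s" "s + j \<le> k"
  shows "(1 / fact i * of_nat (((k - 1) choose (s - 1)) * ((k - s) choose j)) * of_nat ((i choose (t + 1)) * ((s - 1) choose t)) :: complex)
    = 1 / fact (i - 1 - t) * (1 / fact j) * (1 / (fact t * fact (t + 1))) * (fact (k - 1) / (fact (s - 1 - t) * fact (k - j - s)))"
proof -
  have "of_nat ((k - 1) choose (s - 1)) = (fact (k - 1) / (fact (s - 1) * fact (k - s)) :: complex)"
    using assms binomial_fact[of "s - 1" "k - 1", where ?'a = complex] by simp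
  moreover have "of_nat ((k - s) choose j) = (fact (k - s) / (fact j * fact (k - j - s)) :: complex)"
    using assms binomial_fact[of j "k - s", where ?'a = complex] by (simp add: add.commute[of s j])
  moreover have "of_nat (i choose (t + 1)) = (fact i / (fact (t + 1) * fact (i - 1 - t)) :: complex)"
    using assms binomial_fact[of "t + 1" i, where ?'a = complex] by simp
  moreover have "of_nat ((s - 1) choose t) = (fact (s - 1) / (fact t * fact (s - 1 - t)) :: complex)"
    using assms binomial_fact[of t "s - 1", where ?'a = complex] by simp
  ultimately show ?thesis by (simp only: of_nat_mult) (simp add: field_simps del: fact_Suc)
qed

lemma fps_const_minus_one_power: "fps_const ((-1) ^ n) = ((-1) ^ n :: complex fps)"
  by (simp flip: fps_const_power)

text \<open>The coefficient of \<open>centred\<close> of order j in the equation for order i,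
  distributed over the pairs (i - 1 - t, t): \<open>G_scaled\<close> is expanded in H, and for fixed
  t the sum over s is an entry of \<open>Q_core\<close>.\<close>

lemma Q_core_expansion:
  assumes "j \<ge> 1" "i \<ge> 1"
  shows "fps_const (1 / fact i) * (\<Sum>s=1..k-j. of_nat (((k - 1) choose (s - 1)) * ((k - s) choose j)) * (1 - A_ser) ^ (k - s - j) * G_scaled i s)
    = (\<Sum>t<i. fps_const ((-1) ^ (i - t) / fact (i - 1 - t)) * - (fps_const (1 / fact j) * Q_core k (j - 1) (i - 1 - t) t))"
proof -
  define X where "X s t = (1 - A_ser) ^ (k - s - j) * H_full (t + 1) (i + s)" for s t
  define c where "c s t = 1 / fact i * of_nat (((k - 1) choose (s - 1)) * ((k - s) choose j)) * ((-1) ^ (i + s) * of_nat ((i choose (t + 1)) * ((s - 1) choose t)) :: complex)" for s t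
  have c0: "c s t = 0" if "\<not> t < i" for s t
  proof -
    have "i choose (t + 1) = 0" using that by (intro binomial_eq_0) simp
    then show ?thesis unfolding c_def by (simp only: mult_0 of_nat_0 mult_zero_right)
  qed
  have "fps_const (1 / fact i) * (\<Sum>s=1..k-j. of_nat (((k - 1) choose (s - 1)) * ((k - s) choose j)) * (1 - A_ser) ^ (k - s - j) * G_scaled i s)
    = (\<Sum>s=1..k-j. \<Sum>t<s. fps_const (c s t) * X s t)"
    unfolding sum_distrib_left
  proof (rule sum.cong)
    fix s assume "s \<in> {1..k-j}"
    then have s: "s \<ge> 1" by simp
    show "fps_const (1 / fact i) * (of_nat (((k - 1) choose (s - 1)) * ((k - s) choose j)) * (1 - A_ser) ^ (k - s - j) * G_scaled i s) = (\<Sum>t<s. fps_const (c s t) * X s t)"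
      unfolding G_scaled_eq_H_full[OF assms(2) s] sum_distrib_left c_def X_def fps_const_mult[symmetric] fps_of_nat fps_const_minus_one_power
      by (intro sum.cong refl) (simp only: mult_ac)
  qed simp
  \<comment> \<open>binom(i, t + 1) bounds t by i independently of s, so the sums can be
    exchanged.\<close>
  also have "\<dots> = (\<Sum>s=1..k-j. \<Sum>t<i. if t < s then fps_const (c s t) * X s t else 0)"
  proof (rule sum.cong)
    fix s
    have "(\<Sum>t<s. fps_const (c s t) * X s t) = (\<Sum>t<i+s. if t < s then fps_const (c s t) * X s t else 0)"
      by (rule sum.mono_neutral_cong_left) auto
    also have "\<dots> = (\<Sum>t<i. if t < s then fps_const (c s t) * X s t else 0)"
      by (rule sum.mono_neutral_right) (auto simp: c0)
    finally show "(\<Sum>t<s. fps_const (c s t) * X s t) = (\<Sum>t<i. if t < s then fps_const (c s t) * X s t else 0)" .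
  qed simp
  also have "\<dots> = (\<Sum>t<i. \<Sum>s=1..k-j. if t < s then fps_const (c s t) * X s t else 0)"
    by (rule sum.swap)
  also have "\<dots> = (\<Sum>t<i. fps_const ((-1) ^ (i - t) / fact (i - 1 - t)) * - (fps_const (1 / fact j) * Q_core k (j - 1) (i - 1 - t) t))"
  proof (rule sum.cong)
    fix t assume "t \<in> {..<i}"
    then have t: "t < i" by simp
    show "(\<Sum>s=1..k-j. if t < s then fps_const (c s t) * X s t else 0) = fps_const ((-1) ^ (i - t) / fact (i - 1 - t)) * - (fps_const (1 / fact j) * Q_core k (j - 1) (i - 1 - t) t)"
    proof (cases "k < (j - 1) + t + 2")
      case True
      then have "(\<Sum>s=1..k-j. if t < s then fps_const (c s t) * X s t else 0) = 0"
        using assms by (intro sum.neutral) auto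
      then show ?thesis using True by (simp add: Q_core_def)
    next
      case False
      have "(\<Sum>s=1..k-j. if t < s then fps_const (c s t) * X s t else 0) = (\<Sum>s=t+1..k-j. fps_const (c s t) * X s t)"
        by (rule sum.mono_neutral_cong_right) auto
      also have "\<dots> = (\<Sum>e=0..k-2-(j-1)-t. fps_const ((-1) ^ (i - t) / fact (i - 1 - t)) * - (fps_const (1 / fact j) * (fps_const (1 / (fact t * fact (t + 1))) *
        (fps_const (fact (k - 1) / (fact e * fact (k - 2 - (j - 1) - t - e))) *
        (1 - A_ser) ^ (k - 2 - (j - 1) - t - e) * (-1) ^ e * H_full (t + 1) (i - 1 - t + e + 2 * t + 2)))))"
      \<comment> \<open>With s = e + t + 1 and r = i - 1 - t the index i + s of H takes the form r +
        e + 2t + 2 used in Q.\<close>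
      proof (rule sum.reindex_bij_witness[where i = "\<lambda>e. e + t + 1" and j = "\<lambda>s. s - 1 - t"])
        fix s assume s: "s \<in> {t+1..k-j}"
        define e where "e = s - 1 - t"
        have e: "k - 2 - (j - 1) - t - e = k - j - s" "i - 1 - t + e + 2 * t + 2 = i + s" "s = e + t + 1"
          using s False assms t by (auto simp: e_def)
        have "(-1) ^ (i + s) = (- ((-1) ^ (i - t) * (-1) ^ e) :: complex)"
        proof -
          have "i + s = Suc ((i - t) + e + 2 * t)" using e(3) t by simp
          then show ?thesis by (simp add: power_add)
        qed
        moreover have "1 / fact i * of_nat (((k - 1) choose (s - 1)) * ((k - s) choose j)) * of_nat ((i choose (t + 1)) * ((s - 1) choose t))
            = 1 / fact (i - 1 - t) * (1 / fact j) * (1 / (fact t * fact (t + 1))) * (fact (k - 1) / (fact e * fact (k - j - s)) :: complex)"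
          unfolding e_def by (rule coefficient_identity) (use s t assms in auto)
        moreover have "c s t = (1 / fact i * of_nat (((k - 1) choose (s - 1)) * ((k - s) choose j)) * of_nat ((i choose (t + 1)) * ((s - 1) choose t))) * (-1) ^ (i + s)"
          unfolding c_def by (simp only: mult_ac)
        ultimately have "c s t = 1 / fact (i - 1 - t) * (1 / fact j) * (1 / (fact t * fact (t + 1))) * (fact (k - 1) / (fact e * fact (k - j - s))) * (- ((-1) ^ (i - t) * (-1) ^ e))"
          by (simp only:)
        then have c: "c s t = ((-1) ^ (i - t) / fact (i - 1 - t)) * - ((1 / fact j) * ((1 / (fact t * fact (t + 1))) * ((fact (k - 1) / (fact e * fact (k - j - s))) * (-1) ^ e)))"
          by (simp add: mult_ac)
        have "fps_const (c s t) * X s t = fps_const ((-1) ^ (i - t) / fact (i - 1 - t)) * - (fps_const (1 / fact j) * (fps_const (1 / (fact t * fact (t + 1))) *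
          (fps_const (fact (k - 1) / (fact e * fact (k - j - s))) * (1 - A_ser) ^ (k - j - s) * (-1) ^ e * H_full (t + 1) (i + s))))"
        proof -
          have "k - s - j = k - j - s" by simp
          then show ?thesis
            unfolding c X_def fps_const_mult[symmetric] fps_const_neg[symmetric] fps_const_minus_one_power
            by (simp only: mult_ac mult_minus_left mult_minus_right)
        qed
        then show "fps_const ((-1) ^ (i - t) / fact (i - 1 - t)) * - (fps_const (1 / fact j) * (fps_const (1 / (fact t * fact (t + 1))) *
          (fps_const (fact (k - 1) / (fact (s - 1 - t) * fact (k - 2 - (j - 1) - t - (s - 1 - t)))) *
          (1 - A_ser) ^ (k - 2 - (j - 1) - t - (s - 1 - t)) * (-1) ^ (s - 1 - t) * H_full (t + 1) (i - 1 - t + (s - 1 - t) + 2 * t + 2))))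
          = fps_const (c s t) * X s t"
          unfolding e_def[symmetric] e(1,2) by (rule sym)
      qed (use assms False in auto)
      also have "\<dots> = fps_const ((-1) ^ (i - t) / fact (i - 1 - t)) * - (fps_const (1 / fact j) * Q_core k (j - 1) (i - 1 - t) t)"
        unfolding Q_core_def if_not_P[OF False] by (simp only: sum_distrib_left sum_negf[symmetric])
      finally show ?thesis .
    qed
  qed simp
  finally show ?thesis .
qed

context
  fixes \<tau> :: "nat \<Rightarrow> complex"
  assumes \<tau>_0: "\<tau> 0 = 0"
begin

text \<open>The pairs (i - 1 - t, t) are those with r + t + 1 = i, and each enters with weight
  (-1)^(r+1) / r!. The marked part follows from \<open>Q_core_expansion\<close>, one k at a
  time.\<close>

lemma centred_eq_vstar:
  assumes "i \<ge> 1"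
  shows "fps_const (1 / fact i) * centred \<tau> i = (\<Sum>t<i. fps_const ((-1) ^ (i - t) / fact (i - 1 - t)) * vstar \<tau> (i - 1 - t, t))"
proof -
  define c where "c t = fps_const ((-1) ^ (i - t) / fact (i - 1 - t) :: complex)" for t
  define Z where "Z k = (\<Sum>j=1..k-1. centred \<tau> j * (\<Sum>s=1..k-j. of_nat (((k - 1) choose (s - 1)) * ((k - s) choose j)) * (1 - A_ser) ^ (k - s - j) * G_scaled i s))" for k
  have Z: "fps_const (1 / fact i) * Z k = (\<Sum>t<i. c t * Srow \<tau> k (i - 1 - t) t)" for k
  proof -
    have "fps_const (1 / fact i) * Z k = (\<Sum>j=1..k-1. centred \<tau> j * (fps_const (1 / fact i) * (\<Sum>s=1..k-j. of_nat (((k - 1) choose (s - 1)) * ((k - s) choose j)) * (1 - A_ser) ^ (k - s - j) * G_scaled i s)))"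
      unfolding Z_def by (subst sum_distrib_left) (simp only: mult.left_commute)
    also have "\<dots> = (\<Sum>j=1..k-1. centred \<tau> j * (\<Sum>t<i. c t * - (fps_const (1 / fact j) * Q_core k (j - 1) (i - 1 - t) t)))"
      unfolding c_def by (intro sum.cong refl) (subst Q_core_expansion[OF _ assms], auto)
    also have "\<dots> = (\<Sum>j=1..k-1. \<Sum>t<i. c t * - (fps_const (1 / fact j) * centred \<tau> j * Q_core k (j - 1) (i - 1 - t) t))"
      unfolding sum_distrib_left by (intro sum.cong refl) (simp only: mult_ac mult_minus_left mult_minus_right)
    also have "\<dots> = (\<Sum>t<i. c t * Srow \<tau> k (i - 1 - t) t)"
      unfolding Srow_def[of \<tau>, OF \<tau>_0] sum_distrib_left by (rule sum.swap)
    finally show ?thesis .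
  qed
  have sm: "(\<lambda>k. c t * (fps_const (\<tau> k) * Srow \<tau> k (i - 1 - t) t)) summable_on {1..}" for t
    by (intro summable_on_cmult_right Srow_summable \<tau>_0)
  have smZ: "(\<lambda>k. fps_const (\<tau> k) * Z k) summable_on {1..}"
  proof -
    have "fps_const (fact i) * (fps_const (1 / fact i) * Z k) = Z k" for k
      unfolding mult.assoc[symmetric] by simp
    moreover have "fps_X ^ k dvd fps_const (fact i) * (fps_const (1 / fact i) * Z k)" for k
      unfolding Z by (intro dvd_mult dvd_sum Srow_dvd \<tau>_0)
    ultimately have "fps_X ^ k dvd Z k" for k by metis
    then show ?thesis by (intro fps_summable_on_natI dvd_mult)
  qed
  have "fps_const (1 / fact i) * (\<Sum>\<^sub>\<infinity>k\<in>{1..}. fps_const (\<tau> k) * Z k) = (\<Sum>\<^sub>\<infinity>k\<in>{1..}. fps_const (1 / fact i) * (fps_const (\<tau> k) * Z k))"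
    by (rule infsum_cmult_right[symmetric]) (rule smZ)
  also have "\<dots> = (\<Sum>\<^sub>\<infinity>k\<in>{1..}. \<Sum>t<i. c t * (fps_const (\<tau> k) * Srow \<tau> k (i - 1 - t) t))"
  proof (rule infsum_cong)
    fix k
    have "fps_const (1 / fact i) * (fps_const (\<tau> k) * Z k) = fps_const (\<tau> k) * (\<Sum>t<i. c t * Srow \<tau> k (i - 1 - t) t)"
      unfolding Z[symmetric] by (simp only: mult.left_commute)
    then show "fps_const (1 / fact i) * (fps_const (\<tau> k) * Z k) = (\<Sum>t<i. c t * (fps_const (\<tau> k) * Srow \<tau> k (i - 1 - t) t))"
      by (simp only: sum_distrib_left mult.left_commute)
  qed
  also have "\<dots> = (\<Sum>t<i. c t * (\<Sum>\<^sub>\<infinity>k\<in>{1..}. fps_const (\<tau> k) * Srow \<tau> k (i - 1 - t) t))"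
  proof (subst infsum_sum(1))
    show "(\<Sum>t<i. \<Sum>\<^sub>\<infinity>k\<in>{1..}. c t * (fps_const (\<tau> k) * Srow \<tau> k (i - 1 - t) t)) =
      (\<Sum>t<i. c t * (\<Sum>\<^sub>\<infinity>k\<in>{1..}. fps_const (\<tau> k) * Srow \<tau> k (i - 1 - t) t))"
      by (intro sum.cong refl infsum_cmult_right Srow_summable \<tau>_0)
  qed (rule sm | simp)+
  finally have A: "fps_const (1 / fact i) * (\<Sum>\<^sub>\<infinity>k\<in>{1..}. fps_const (\<tau> k) * Z k) = (\<Sum>t<i. c t * (\<Sum>\<^sub>\<infinity>k\<in>{1..}. fps_const (\<tau> k) * Srow \<tau> k (i - 1 - t) t))" .
  \<comment> \<open>Only the pair (i - 1, 0) carries \<open>rho\<close>; its two signs cancel, and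
    (i - 1)! i = i! yields the factor on the left side.\<close>
  have "(\<Sum>t<i. c t * (if t = 0 then fps_const ((-1) ^ (i - 1 - t + 1) / of_nat (i - 1 - t + 1)) * rho \<tau> (i - 1 - t + 1) else 0))
    = c 0 * (fps_const ((-1) ^ i / of_nat i) * rho \<tau> i)"
    by (subst sum.remove[of _ 0]) (use assms in auto)
  also have "\<dots> = fps_const (1 / fact i) * rho \<tau> i"
  proof -
    have "(-1) ^ i / fact (i - 1) * ((-1) ^ i / of_nat i) = (1 / fact i :: complex)"
      using assms by (cases i) (auto simp: field_simps simp flip: power_add mult_2)
    then show ?thesis by (simp add: c_def mult.assoc[symmetric])
  qed
  finally have B: "(\<Sum>t<i. c t * (if t = 0 then fps_const ((-1) ^ (i - 1 - t + 1) / of_nat (i - 1 - t + 1)) * rho \<tau> (i - 1 - t + 1) else 0))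
    = fps_const (1 / fact i) * rho \<tau> i" .
  show ?thesis
    unfolding centred_split[of \<tau>, OF \<tau>_0 assms] Z_def[symmetric] distrib_left A B[symmetric] sum.distrib[symmetric]
    unfolding vstar_def[of \<tau>, OF \<tau>_0] c_def prod.case by (simp only: distrib_left)
qed

end

section \<open>The geometric series\<close>

lemma fps_cong_minus: "fps_cong m x y \<Longrightarrow> fps_cong m (- x) (- y)" by (simp add: fps_cong_iff)

lemma pmat_pow_dvd:
  assumes "\<And>a b. fps_X dvd M a b"
  shows "fps_X ^ m dvd pmat_pow N M m a b"
proof (induction m arbitrary: a b)
  case (Suc m)
  show ?case unfolding pmat_pow.simps pmat_mult_def power_Suc
    by (intro dvd_sum mult_dvd_mono assms Suc)
qed simp

text \<open>The entries of \<open>M\<close> are divisible by z and those of its m-th power by z^m,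
  so the series converges and its first term can be split off.\<close>

lemma pmat_geom_unfold:
  assumes "\<And>a b. fps_X dvd M a b"
  shows "pmat_geom N M a b = pmat_one a b + (\<Sum>c\<in>idx N. M a c * pmat_geom N M c b)"
proof -
  have sm: "(\<lambda>m. pmat_pow N M m a b) summable_on A" for a b A
    by (intro fps_summable_on_natI pmat_pow_dvd assms)
  have UNIV: "{0..} = (UNIV :: nat set)" by auto
  have "(\<Sum>\<^sub>\<infinity>m. pmat_pow N M m a b) = infsum (\<lambda>m. pmat_pow N M m a b) (insert 0 (range Suc))"
    by (rule arg_cong[OF UNIV_nat_eq])
  also have "\<dots> = pmat_pow N M 0 a b + infsum (\<lambda>m. pmat_pow N M m a b) (range Suc)"
    by (rule infsum_insert) (auto intro: sm)
  also have "infsum (\<lambda>m. pmat_pow N M m a b) (range Suc) = (\<Sum>\<^sub>\<infinity>m. \<Sum>c\<in>idx N. M a c * pmat_pow N M m c b)"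
    by (subst infsum_reindex) (simp_all add: o_def pmat_mult_def)
  also have "\<dots> = (\<Sum>c\<in>idx N. \<Sum>\<^sub>\<infinity>m. M a c * pmat_pow N M m c b)"
    by (rule infsum_sum(1)) (auto simp: idx_def intro!: summable_on_cmult_right sm)
  also have "\<dots> = (\<Sum>c\<in>idx N. M a c * (\<Sum>\<^sub>\<infinity>m. pmat_pow N M m c b))"
    by (intro sum.cong refl infsum_cmult_right sm)
  finally show ?thesis unfolding pmat_geom_def UNIV by simp
qed

text \<open>If v = p + v M and G = I + M G, multiplying by G from the right gives v G = p G + v M G
  = p G + v G - v, hence p G = v. All of this holds modulo z^m.\<close>

lemma geom_fixpoint:
  assumes M: "\<And>a b. fps_X dvd M a b"
    and v: "\<And>b. b \<in> idx N \<Longrightarrow> fps_cong m (v b) (p b + (\<Sum>a\<in>idx N. v a * M a b))"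
    and b: "b \<in> idx N"
  shows "fps_cong m (\<Sum>a\<in>idx N. p a * pmat_geom N M a b) (v b)"
proof -
  let ?G = "pmat_geom N M"
  have fin: "finite (idx N)" by (simp add: idx_def)
  have "fps_cong m (\<Sum>a\<in>idx N. v a * ?G a b) (\<Sum>a\<in>idx N. (p a + (\<Sum>c\<in>idx N. v c * M c a)) * ?G a b)"
    by (intro fps_cong_sum fps_cong_mult v fps_cong_refl)
  also have "(\<Sum>a\<in>idx N. (p a + (\<Sum>c\<in>idx N. v c * M c a)) * ?G a b) =
    (\<Sum>a\<in>idx N. p a * ?G a b) + (\<Sum>c\<in>idx N. v c * (\<Sum>a\<in>idx N. M c a * ?G a b))"
  proof -
    have "(\<Sum>a\<in>idx N. (\<Sum>c\<in>idx N. v c * M c a) * ?G a b) = (\<Sum>c\<in>idx N. v c * (\<Sum>a\<in>idx N. M c a * ?G a b))"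
      unfolding sum_distrib_right sum_distrib_left by (subst sum.swap) (simp only: mult.assoc)
    then show ?thesis by (simp only: distrib_right sum.distrib)
  qed
  also have "(\<Sum>c\<in>idx N. v c * (\<Sum>a\<in>idx N. M c a * ?G a b)) = (\<Sum>c\<in>idx N. v c * ?G c b) - v b"
  proof -
    have "(\<Sum>c\<in>idx N. v c * ?G c b) = (\<Sum>c\<in>idx N. v c * pmat_one c b) + (\<Sum>c\<in>idx N. v c * (\<Sum>a\<in>idx N. M c a * ?G a b))"
      by (subst pmat_geom_unfold[OF M]) (simp only: distrib_left sum.distrib)
    moreover have "(\<Sum>c\<in>idx N. v c * pmat_one c b) = v b"
      using fin b by (simp add: pmat_one_def if_distrib cong: if_cong)
    ultimately show ?thesis by simp
  qed
  finally have "fps_cong m (\<Sum>c\<in>idx N. v c * ?G c b) ((\<Sum>a\<in>idx N. p a * ?G a b) + ((\<Sum>c\<in>idx N. v c * ?G c b) - v b))" .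
  moreover have "x - (y + (x - z)) = z - y" for x y z :: "complex fps" by simp
  ultimately have "fps_cong m (v b) (\<Sum>a\<in>idx N. p a * ?G a b)" unfolding fps_cong_def by (simp only:)
  then show ?thesis by (rule fps_cong_sym)
qed

lemma Grow_dvd: "i \<ge> 1 \<Longrightarrow> fps_X ^ k dvd Grow i k"
  unfolding Grow_def by (rule dvd_trans[OF le_imp_power_dvd G_full_row_dvd]) auto

lemma Psi_dvd: "fps_X ^ k dvd Psi N k a"
  by (cases a) (auto simp: Psi_eq intro!: ztrunc_dvd dvd_mult Grow_dvd)

context
  fixes \<tau> :: "nat \<Rightarrow> complex" and N :: nat
  assumes \<tau>_0: "\<tau> 0 = 0"
begin

text \<open>Pairs are collected by j = r + t + 1. For j <= N all of them lie in \<open>idx N\<close>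
  and \<open>centred_eq_vstar\<close> applies; for j > N both sides are divisible by z^(2j) and
  vanish modulo z^(2N+1). This is why size N in each index suffices.\<close>

lemma regroup:
  assumes phi: "\<And>j. j > M \<Longrightarrow> \<phi> j = 0"
  shows "fps_cong (2 * N + 1) (\<Sum>(r, t)\<in>idx N. fps_const ((-1) ^ (r + 1) / fact r) * vstar \<tau> (r, t) * \<phi> (r + t + 1))
    (\<Sum>j=1..M. fps_const (1 / fact j) * centred \<tau> j * \<phi> j)"
proof -
  define F where "F = (\<lambda>(r, t). fps_const ((-1) ^ (r + 1) / fact r) * vstar \<tau> (r, t) * \<phi> (r + t + 1))"
  define g where "g j = (if j \<le> N then fps_const (1 / fact j) * centred \<tau> j * \<phi> j else 0)" for j
  have fin: "finite (idx N)" by (simp add: idx_def)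
  have small: "fps_cong (2 * N + 1) x 0" if "fps_X ^ (2 * j) dvd x" "j > N" for x j
    unfolding fps_cong_0_iff by (rule X_power_dvdI[OF that(1)]) (use that(2) in simp)
  have "sum F (idx N) = (\<Sum>j=1..2*N. \<Sum>p\<in>{p \<in> idx N. fst p + snd p + 1 = j}. F p)"
    by (rule sum.group[symmetric]) (auto simp: idx_def)
  also have "fps_cong (2 * N + 1) \<dots> (\<Sum>j=1..2*N. g j)"
  proof (rule fps_cong_sum)
    fix j assume j: "j \<in> {1..2*N}"
    show "fps_cong (2 * N + 1) (\<Sum>p\<in>{p \<in> idx N. fst p + snd p + 1 = j}. F p) (g j)"
    proof (cases "j \<le> N")
      case True
      have "(\<Sum>p\<in>{p \<in> idx N. fst p + snd p + 1 = j}. F p) = (\<Sum>t<j. fps_const ((-1) ^ (j - t) / fact (j - 1 - t)) * vstar \<tau> (j - 1 - t, t) * \<phi> j)"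
      proof (rule sum.reindex_bij_witness[where i = "\<lambda>t. (j - 1 - t, t)" and j = snd])
        fix p assume "p \<in> {p \<in> idx N. fst p + snd p + 1 = j}"
        then obtain r t where p: "p = (r, t)" "r + t + 1 = j" by (cases p) auto
        then have "j - t = r + 1" "j - 1 - t = r" by auto
        then show "fps_const ((-1) ^ (j - snd p) / fact (j - 1 - snd p)) * vstar \<tau> (j - 1 - snd p, snd p) * \<phi> j = F p"
          unfolding F_def p(1) prod.case p(2) snd_conv by (simp only:)
      qed (use True in \<open>auto simp: idx_def\<close>)
      also have "\<dots> = g j"
        unfolding sum_distrib_right[symmetric] using centred_eq_vstar[of \<tau> j, OF \<tau>_0] j True by (simp add: g_def)
      finally show ?thesis by simp
    next
      case False
      have "fps_cong (2 * N + 1) (\<Sum>p\<in>{p \<in> idx N. fst p + snd p + 1 = j}. F p) 0"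
      proof (rule small)
        show "fps_X ^ (2 * j) dvd (\<Sum>p\<in>{p \<in> idx N. fst p + snd p + 1 = j}. F p)"
        proof (rule dvd_sum)
          fix p assume "p \<in> {p \<in> idx N. fst p + snd p + 1 = j}"
          then obtain r t where p: "p = (r, t)" "r + t + 1 = j" by (cases p) auto
          show "fps_X ^ (2 * j) dvd F p"
            unfolding F_def p(1) prod.case p(2)[symmetric] by (intro dvd_mult dvd_mult2 vstar_dvd \<tau>_0)
        qed
      qed (use False in simp)
      then show ?thesis using False by (simp add: g_def)
    qed
  qed
  \<comment> \<open>M and 2N are in no fixed order, so the passage goes through a common larger
    range: \<open>g\<close> is 0 beyond N, and \<phi> is 0 beyond M.\<close>
  also have "(\<Sum>j=1..2*N. g j) = (\<Sum>j=1..M+2*N. g j)"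
    by (rule sum.mono_neutral_left) (auto simp: g_def)
  also have "(\<Sum>j=1..M+2*N. g j) = (\<Sum>j=1..M. g j)"
    by (rule sum.mono_neutral_right) (auto simp: g_def phi)
  also have "fps_cong (2 * N + 1) \<dots> (\<Sum>j=1..M. fps_const (1 / fact j) * centred \<tau> j * \<phi> j)"
  proof (rule fps_cong_sum)
    fix j
    show "fps_cong (2 * N + 1) (g j) (fps_const (1 / fact j) * centred \<tau> j * \<phi> j)"
    proof (cases "j \<le> N")
      case False
      have "fps_cong (2 * N + 1) (fps_const (1 / fact j) * centred \<tau> j * \<phi> j) 0"
        by (rule small[of j]) (use False in \<open>auto intro: dvd_mult dvd_mult2 centred_dvd\<close>)
      then show ?thesis using False by (simp add: g_def fps_cong_sym)
    qed (simp add: g_def)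
  qed
  finally show ?thesis by (simp add: F_def)
qed

section \<open>The row vector and the matrix, summed over the marks\<close>

definition psi :: "nat \<times> nat \<Rightarrow> complex fps" where
  "psi a = (\<Sum>\<^sub>\<infinity>k\<in>{1..}. fps_const (\<tau> k) * Psi N k a)"

definition Kq :: "nat \<times> nat \<Rightarrow> nat \<times> nat \<Rightarrow> complex fps" where
  "Kq a b = (\<Sum>\<^sub>\<infinity>k\<in>{1..}. fps_const (\<tau> k) * Q_mat N k a b)"

text \<open>The denominator r + 1 removes the factor by which the rows in \<open>rho\<close> differ
  from those in \<open>Psi\<close>.\<close>

lemma psi_cong: "fps_cong (2 * N + 1) (psi (r, t)) (if t = 0 then fps_const ((-1) ^ (r + 1) / of_nat (r + 1)) * rho \<tau> (r + 1) else 0)"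
proof (cases "t = 0")
  case True
  have sm: "(\<lambda>k. fps_const (\<tau> k) * ((-1) ^ (r + 1) * Grow (r + 1) k)) summable_on {1..}"
    by (intro fps_summable_on_natI dvd_mult Grow_dvd) simp
  have "fps_cong (2 * N + 1) (psi (r, t)) (\<Sum>\<^sub>\<infinity>k\<in>{1..}. fps_const (\<tau> k) * ((-1) ^ (r + 1) * Grow (r + 1) k))"
    unfolding psi_def Psi_eq if_P[OF True]
    by (intro fps_cong_infsum fps_cong_mult fps_cong_refl fps_cong_ztrunc sm)
       (intro fps_summable_on_natI dvd_mult ztrunc_dvd Grow_dvd, simp)
  also have "(\<Sum>\<^sub>\<infinity>k\<in>{1..}. fps_const (\<tau> k) * ((-1) ^ (r + 1) * Grow (r + 1) k))
    = (\<Sum>\<^sub>\<infinity>k\<in>{1..}. fps_const ((-1) ^ (r + 1) / of_nat (r + 1)) * (fps_const (\<tau> k) * (of_nat (r + 1) * Grow (r + 1) k)))"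
  proof (rule infsum_cong)
    fix k
    have "(-1) ^ (r + 1) / of_nat (r + 1) * of_nat (r + 1) = ((-1) ^ (r + 1) :: complex)"
      using of_nat_neq_0[of r, where ?'a = complex] by (simp del: of_nat_Suc)
    then have "fps_const ((-1) ^ (r + 1) / of_nat (r + 1)) * of_nat (r + 1) = ((-1) ^ (r + 1) :: complex fps)"
      by (simp only: fps_of_nat[symmetric] fps_const_mult fps_const_minus_one_power)
    then show "fps_const (\<tau> k) * ((-1) ^ (r + 1) * Grow (r + 1) k) =
       fps_const ((-1) ^ (r + 1) / of_nat (r + 1)) * (fps_const (\<tau> k) * (of_nat (r + 1) * Grow (r + 1) k))"
      by (metis (no_types, lifting) mult.assoc mult.left_commute)
  qed
  also have "\<dots> = fps_const ((-1) ^ (r + 1) / of_nat (r + 1)) * (\<Sum>\<^sub>\<infinity>k\<in>{1..}. fps_const (\<tau> k) * (of_nat (r + 1) * Grow (r + 1) k))"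
    by (intro infsum_cmult_right fps_summable_on_natI dvd_mult Grow_dvd) simp
  also have "(\<Sum>\<^sub>\<infinity>k\<in>{1..}. fps_const (\<tau> k) * (of_nat (r + 1) * Grow (r + 1) k)) = rho \<tau> (r + 1)"
    unfolding Grow_def by (rule rho_eq_G_full[symmetric]) simp
  finally show ?thesis using True by simp
qed (simp add: psi_def Psi_eq)

lemma Q_core_summable: "(\<lambda>k. fps_const (\<tau> k) * (c * Q_core k p r t)) summable_on {1..}"
  by (rule fps_summable_on_shiftI[where c = "1 + p"]) (intro dvd_mult X_power_dvdI[OF Q_core_dvd(2)], simp)

lemma Kq_cong: "fps_cong (2 * N + 1) (Kq (r, t) (r', t')) (\<Sum>\<^sub>\<infinity>k\<in>{1..}. fps_const (\<tau> k) * (fps_const (1 / fact r) * (-1) ^ r * Q_core k (r + t) r' t'))"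
  unfolding Kq_def Q_eq
proof (intro fps_cong_infsum fps_cong_mult fps_cong_refl fps_cong_ztrunc Q_core_summable)
  show "(\<lambda>k. fps_const (\<tau> k) * ztrunc (2 * N) (fps_const (1 / fact r) * (-1) ^ r * Q_core k (r + t) r' t')) summable_on {1..}"
    by (rule fps_summable_on_shiftI[where c = "1 + (r + t)"])
       (intro dvd_mult ztrunc_dvd X_power_dvdI[OF Q_core_dvd(2)], simp)
qed

lemma Kq_dvd: "fps_X dvd Kq a b"
proof -
  obtain r t r' t' where [simp]: "a = (r, t)" "b = (r', t')" by (cases a; cases b)
  have "fps_X ^ 1 dvd Kq a b"
    unfolding Kq_def by (simp only: \<open>a = _\<close> \<open>b = _\<close> Q_eq)
      (intro fps_X_power_dvd_infsum dvd_mult ztrunc_dvd X_power_dvdI[OF Q_core_dvd(1)], simp)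
  then show ?thesis by simp
qed

text \<open>For fixed k, \<open>regroup\<close> with \<phi> given by \<open>Q_core\<close> turns the
  product with the matrix into a sum over centred moments, and this sum is \<open>Srow\<close>. Its
  minus sign is the difference between (-1)^r in Q and (-1)^(r+1) in \<open>regroup\<close>.\<close>

lemma vstar_fixpoint:
  assumes "b \<in> idx N"
  shows "fps_cong (2 * N + 1) (vstar \<tau> b) (psi b + (\<Sum>a\<in>idx N. vstar \<tau> a * Kq a b))"
proof -
  obtain r' t' where b: "b = (r', t')" by (cases b)
  define q where "q k a = (case a of (r, t) \<Rightarrow> fps_const (1 / fact r) * (-1) ^ r * Q_core k (r + t) r' t')" for k and a :: "nat \<times> nat"
  have smq: "(\<lambda>k. fps_const (\<tau> k) * q k a) summable_on {1..}" for a
    unfolding q_def by (cases a) (simp only: prod.case Q_core_summable)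
  have "fps_cong (2 * N + 1) (\<Sum>a\<in>idx N. vstar \<tau> a * Kq a b) (\<Sum>a\<in>idx N. vstar \<tau> a * (\<Sum>\<^sub>\<infinity>k\<in>{1..}. fps_const (\<tau> k) * q k a))"
  proof (intro fps_cong_sum fps_cong_mult fps_cong_refl)
    fix a
    show "fps_cong (2 * N + 1) (Kq a b) (\<Sum>\<^sub>\<infinity>k\<in>{1..}. fps_const (\<tau> k) * q k a)"
      unfolding q_def b by (cases a) (simp only: Kq_cong prod.case)
  qed
  also have "(\<Sum>a\<in>idx N. vstar \<tau> a * (\<Sum>\<^sub>\<infinity>k\<in>{1..}. fps_const (\<tau> k) * q k a)) =
     (\<Sum>a\<in>idx N. \<Sum>\<^sub>\<infinity>k\<in>{1..}. vstar \<tau> a * (fps_const (\<tau> k) * q k a))"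
    by (intro sum.cong refl infsum_cmult_right[symmetric] smq)
  also have "\<dots> = (\<Sum>\<^sub>\<infinity>k\<in>{1..}. \<Sum>a\<in>idx N. vstar \<tau> a * (fps_const (\<tau> k) * q k a))"
    by (rule infsum_sum(1)[symmetric], simp add: idx_def, rule summable_on_cmult_right, rule smq)
  also have "fps_cong (2 * N + 1) \<dots> (\<Sum>\<^sub>\<infinity>k\<in>{1..}. fps_const (\<tau> k) * Srow \<tau> k r' t')"
  proof (rule fps_cong_infsum)
    show "(\<lambda>k. \<Sum>a\<in>idx N. vstar \<tau> a * (fps_const (\<tau> k) * q k a)) summable_on {1..}"
      by (rule infsum_sum(2), simp add: idx_def, rule summable_on_cmult_right, rule smq)
    show "(\<lambda>k. fps_const (\<tau> k) * Srow \<tau> k r' t') summable_on {1..}"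
      by (rule Srow_summable[of \<tau>, OF \<tau>_0])
    fix k :: nat assume k: "k \<in> {1..}"
    have "(\<Sum>a\<in>idx N. vstar \<tau> a * (fps_const (\<tau> k) * q k a)) =
      fps_const (\<tau> k) * - (\<Sum>(r, t)\<in>idx N. fps_const ((-1) ^ (r + 1) / fact r) * vstar \<tau> (r, t) * Q_core k (r + t + 1 - 1) r' t')"
      unfolding sum_negf[symmetric] sum_distrib_left
    proof (intro sum.cong refl)
      fix a :: "nat \<times> nat"
      obtain r t where a: "a = (r, t)" by (cases a)
      have e: "fps_const ((-1) ^ (r + 1) / fact r) = - (fps_const (1 / fact r) * (-1) ^ r :: complex fps)"
        by (simp flip: fps_const_minus_one_power)
      show "vstar \<tau> a * (fps_const (\<tau> k) * q k a) =
        fps_const (\<tau> k) * - (case a of (r, t) \<Rightarrow> fps_const ((-1) ^ (r + 1) / fact r) * vstar \<tau> (r, t) * Q_core k (r + t + 1 - 1) r' t')"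
        unfolding a prod.case q_def e add_diff_cancel_right'
        by (simp only: mult_ac mult_minus_left mult_minus_right minus_minus)
    qed
    also have "fps_cong (2 * N + 1) \<dots> (fps_const (\<tau> k) * - (\<Sum>j=1..k-1. fps_const (1 / fact j) * centred \<tau> j * Q_core k (j - 1) r' t'))"
      by (intro fps_cong_mult fps_cong_refl fps_cong_minus regroup[where \<phi> = "\<lambda>j. Q_core k (j - 1) r' t'"]) (use k in \<open>auto simp: Q_core_def\<close>)
    finally show "fps_cong (2 * N + 1) (\<Sum>a\<in>idx N. vstar \<tau> a * (fps_const (\<tau> k) * q k a)) (fps_const (\<tau> k) * Srow \<tau> k r' t')"
      by (simp only: Srow_def[of \<tau>, OF \<tau>_0] sum_negf)
  qed
  finally have "fps_cong (2 * N + 1) (psi b + (\<Sum>a\<in>idx N. vstar \<tau> a * Kq a b)) (vstar \<tau> b)"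
    unfolding vstar_def[of \<tau>, OF \<tau>_0] b prod.case by (intro fps_cong_add psi_cong)
  then show ?thesis by (rule fps_cong_sym)
qed

lemma psi_geom: "b \<in> idx N \<Longrightarrow> fps_cong (2 * N + 1) (\<Sum>a\<in>idx N. psi a * pmat_geom N Kq a b) (vstar \<tau> b)"
  by (rule geom_fixpoint[OF Kq_dvd vstar_fixpoint])

end

section \<open>The formula\<close>

lemma idx_snd_le: "(r, t) \<in> idx N \<Longrightarrow> r + t + 2 \<le> 2 * N"
  by (auto simp: idx_def)

text \<open>The pair lowers the first index of T2 by at most 2N - 1. The remaining order still grows
  with k2 + k3, which is enough for summability.\<close>

lemma Phi_dvd: "b \<in> idx N \<Longrightarrow> k3 \<ge> 1 \<Longrightarrow> fps_X ^ (k2 + k3 - 2 * N) dvd Phi N k2 k3 b"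
proof -
  assume b: "b \<in> idx N" and k3: "k3 \<ge> 1"
  obtain r t where [simp]: "b = (r, t)" by (cases b)
  show ?thesis
  proof (cases "k2 < r + t + 2")
    case False
    have "fps_X ^ (k2 - 1 - r - t + k3) dvd T2_full (k2 - 1 - r - t) k3"
      by (rule T2_full_dvd) (use False k3 in auto)
    then have "fps_X ^ (k2 + k3 - 2 * N) dvd T2_full (k2 - 1 - r - t) k3"
      by (rule dvd_trans[rotated]) (use idx_snd_le[of r t N] b False in \<open>auto intro!: le_imp_power_dvd\<close>)
    then show ?thesis using False by (auto simp: Phi_eq intro!: ztrunc_dvd dvd_mult)
  qed (simp add: Phi_eq)
qed

lemma pair_index_finite: "finite {p :: nat \<times> nat. p \<in> A \<times> B \<and> (case p of (k2, k3) \<Rightarrow> k2 + k3) \<le> n}"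
  by (rule finite_subset[of _ "{..n} \<times> {..n}"]) auto

lemma infsum_nth_0:
  fixes F :: "'i \<Rightarrow> complex fps"
  assumes "\<And>x. x \<in> A \<Longrightarrow> fps_nth (F x) n = 0"
  shows "fps_nth (infsum F A) n = 0"
proof (cases "F summable_on A")
  case True
  then show ?thesis using fps_nth_infsum[OF True, of "{}" n] assms by simp
qed (simp add: infsum_not_exists)

section \<open>Summation over the three marks\<close>

context
  fixes \<tau> :: "nat \<Rightarrow> complex" and N :: nat
  assumes \<tau>_0: "\<tau> 0 = 0"
begin

text \<open>The contributions of order i >= 1 to the two-sided sum at a mark with k2 visits, with
  binom(k2 - 1, i) written in factorials as in \<open>Phi\<close>. Order 0 would give T2
  itself.\<close>

definition Esum :: "nat \<Rightarrow> nat \<Rightarrow> complex fps" where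
  "Esum k2 k3 = (\<Sum>i=1..k2-1. fps_const (fact (k2 - 1) / (fact i * fact (k2 - 1 - i))) * centred \<tau> i * T2_full (k2 - i) k3)"

lemma centred_T2_full_dvd: "i < k2 \<Longrightarrow> k3 \<ge> 1 \<Longrightarrow> fps_X ^ (k2 + k3) dvd centred \<tau> i * T2_full (k2 - i) k3"
proof -
  assume i: "i < k2" and "k3 \<ge> 1"
  then have "fps_X ^ (2 * i) * fps_X ^ (k2 - i + k3) dvd centred \<tau> i * T2_full (k2 - i) k3"
    by (intro mult_dvd_mono centred_dvd T2_full_dvd) auto
  then show ?thesis by (rule X_powers_dvdI) (use i in auto)
qed

lemma Esum_dvd: "k3 \<ge> 1 \<Longrightarrow> fps_X ^ (k2 + k3) dvd Esum k2 k3"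
  unfolding Esum_def mult.assoc by (intro dvd_sum dvd_mult centred_T2_full_dvd) auto

lemma Phi_vstar:
  assumes "k2 \<ge> 1"
  shows "fps_cong (2 * N + 1) (\<Sum>b\<in>idx N. vstar \<tau> b * Phi N k2 k3 b) (Esum k2 k3)"
proof -
  define \<phi> where "\<phi> j = (if k2 < j + 1 then 0 else fps_const (fact (k2 - 1) / fact (k2 - 1 - j)) * T2_full (k2 - j) k3)" for j
  have "fps_cong (2 * N + 1) (\<Sum>b\<in>idx N. vstar \<tau> b * Phi N k2 k3 b)
     (\<Sum>(r, t)\<in>idx N. fps_const ((-1) ^ (r + 1) / fact r) * vstar \<tau> (r, t) * \<phi> (r + t + 1))"
  proof (rule fps_cong_sum)
    fix b assume "b \<in> idx N"
    obtain r t where b: "b = (r, t)" by (cases b)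
    have "fps_cong (2 * N + 1) (Phi N k2 k3 (r, t)) (fps_const ((-1) ^ (r + 1) / fact r) * \<phi> (r + t + 1))"
    proof (cases "k2 < r + t + 2")
      case True
      then show ?thesis by (simp add: Phi_eq \<phi>_def)
    next
      case False
      then have "fps_const ((-1) ^ (r + 1) / fact r) * \<phi> (r + t + 1) =
        fps_const ((-1) ^ (r + 1) * fact (k2 - 1) / (fact r * fact (k2 - 2 - r - t))) * T2_full (k2 - 1 - r - t) k3"
        by (simp add: \<phi>_def mult.assoc[symmetric])
      then show ?thesis using False by (simp only: Phi_eq if_False fps_cong_ztrunc)
    qed
    then have "fps_cong (2 * N + 1) (vstar \<tau> (r, t) * Phi N k2 k3 (r, t)) (vstar \<tau> (r, t) * (fps_const ((-1) ^ (r + 1) / fact r) * \<phi> (r + t + 1)))"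
      by (intro fps_cong_mult fps_cong_refl)
    then show "fps_cong (2 * N + 1) (vstar \<tau> b * Phi N k2 k3 b) (case b of (r, t) \<Rightarrow> fps_const ((-1) ^ (r + 1) / fact r) * vstar \<tau> (r, t) * \<phi> (r + t + 1))"
      unfolding b prod.case by (simp only: mult_ac)
  qed
  also have "fps_cong (2 * N + 1) \<dots> (\<Sum>j=1..k2-1. fps_const (1 / fact j) * centred \<tau> j * \<phi> j)"
    by (rule regroup[of \<tau>, OF \<tau>_0]) (use assms in \<open>auto simp: \<phi>_def\<close>)
  also have "\<dots> = Esum k2 k3"
    unfolding Esum_def
  proof (rule sum.cong)
    fix j assume j: "j \<in> {1..k2-1}"
    then have "\<not> k2 < j + 1" by auto
    moreover have "fps_const (1 / fact j) * fps_const (fact (k2 - 1) / fact (k2 - 1 - j)) = fps_const (fact (k2 - 1) / (fact j * fact (k2 - 1 - j)) :: complex)"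
      by simp
    moreover have "a * d * (b * c) = (a * b) * d * c" for a b c d :: "complex fps" by (simp only: mult_ac)
    ultimately show "fps_const (1 / fact j) * centred \<tau> j * \<phi> j =
      fps_const (fact (k2 - 1) / (fact j * fact (k2 - 1 - j))) * centred \<tau> j * T2_full (k2 - j) k3"
      unfolding \<phi>_def by (simp only: if_False)
  qed simp
  finally show ?thesis .
qed

definition Fterm :: "nat \<Rightarrow> nat \<times> nat \<Rightarrow> complex fps" where
  "Fterm k1 = (\<lambda>(k2, k3). fps_const (\<tau> k1 * \<tau> k2 * \<tau> k3) *
     pinner N (Psi N k1) (pmat_vec N (pmat_geom N (Kq \<tau> N)) (Phi N k2 k3)))"

lemma Fterm_eq: "Fterm k1 (k2, k3) = (\<Sum>a\<in>idx N. (\<Sum>b\<in>idx N. fps_const (\<tau> k2 * \<tau> k3) * pmat_geom N (Kq \<tau> N) a b * Phi N k2 k3 b) * (fps_const (\<tau> k1) * Psi N k1 a))"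
proof -
  have "fps_const (\<tau> k1 * \<tau> k2 * \<tau> k3) = fps_const (\<tau> k2 * \<tau> k3) * fps_const (\<tau> k1)" by (simp add: mult_ac)
  then show ?thesis
    unfolding Fterm_def prod.case pinner_def pmat_vec_def sum_distrib_left sum_distrib_right
    by (intro sum.cong refl) (simp only: mult_ac)
qed

lemma Fterm_dvd:
  assumes "k3 \<ge> 1"
  shows "fps_X ^ (k1 + (k2 + k3 - 2 * N)) dvd Fterm k1 (k2, k3)"
proof -
  have "fps_X ^ k1 * fps_X ^ (k2 + k3 - 2 * N) dvd Fterm k1 (k2, k3)"
    unfolding Fterm_def prod.case pinner_def pmat_vec_def
    by (rule dvd_mult, rule dvd_sum, rule mult_dvd_mono, rule Psi_dvd, rule dvd_sum, rule dvd_mult, rule Phi_dvd) (use assms in auto)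
  then show ?thesis by (simp add: power_add)
qed

lemma triple_index_finite: "finite {p :: nat \<times> nat \<times> nat. p \<in> A \<times> B \<times> C \<and> (case p of (k1, k2, k3) \<Rightarrow> k1 + (k2 + k3 - 2 * N)) \<le> n}"
  by (rule finite_subset[of _ "{..n} \<times> {..n + 2 * N} \<times> {..n + 2 * N}"]) auto

text \<open>The sum over k1 is carried out first: it involves only \<open>Psi\<close> and produces
  \<open>psi\<close>. Then \<open>psi_geom\<close> replaces the geometric series by
  \<open>vstar\<close>, and \<open>Phi_vstar\<close> collapses the pairs.\<close>

lemma sum_Fterm:
  "fps_cong (2 * N + 1) (\<Sum>\<^sub>\<infinity>(k1, p)\<in>{1..} \<times> {1..} \<times> {1..}. ztrunc (2 * N) (Fterm k1 p))
    (\<Sum>\<^sub>\<infinity>(k2, k3)\<in>{1..} \<times> {1..}. fps_const (\<tau> k2 * \<tau> k3) * Esum k2 k3)"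
proof -
  let ?A = "{1::nat..}"
  have sm: "(\<lambda>(k1, p). Fterm k1 p) summable_on ?A \<times> ?A \<times> ?A"
    by (rule fps_summable_onI[where h = "\<lambda>(k1, k2, k3). k1 + (k2 + k3 - 2 * N)"])
       (use Fterm_dvd triple_index_finite in auto)
  have smt: "(\<lambda>(k1, p). ztrunc (2 * N) (Fterm k1 p)) summable_on ?A \<times> ?A \<times> ?A"
    by (rule fps_summable_onI[where h = "\<lambda>(k1, k2, k3). k1 + (k2 + k3 - 2 * N)"])
       (use Fterm_dvd triple_index_finite in \<open>auto intro: ztrunc_dvd\<close>)
  have smswap: "(\<lambda>(p, k1). Fterm k1 p) summable_on (?A \<times> ?A) \<times> ?A"
    using sm fps_summable_on_swap[of "\<lambda>(k1, p). Fterm k1 p" ?A "?A \<times> ?A"] by simp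
  have smpsi: "(\<lambda>k1. fps_const (\<tau> k1) * Psi N k1 a) summable_on ?A" for a
    by (intro fps_summable_on_natI dvd_mult Psi_dvd)
  have "fps_cong (2 * N + 1) (\<Sum>\<^sub>\<infinity>(k1, p)\<in>?A \<times> ?A \<times> ?A. ztrunc (2 * N) (Fterm k1 p)) (\<Sum>\<^sub>\<infinity>(k1, p)\<in>?A \<times> ?A \<times> ?A. Fterm k1 p)"
  proof (rule fps_cong_infsum[OF _ smt sm])
    fix x :: "nat \<times> nat \<times> nat"
    show "fps_cong (2 * N + 1) (case x of (k1, p) \<Rightarrow> ztrunc (2 * N) (Fterm k1 p)) (case x of (k1, p) \<Rightarrow> Fterm k1 p)"
      by (cases x) (simp only: prod.case fps_cong_ztrunc)
  qed
  also have "(\<Sum>\<^sub>\<infinity>(k1, p)\<in>?A \<times> ?A \<times> ?A. Fterm k1 p) = (\<Sum>\<^sub>\<infinity>k1\<in>?A. \<Sum>\<^sub>\<infinity>p\<in>?A \<times> ?A. Fterm k1 p)"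
    using fps_infsum_iterated[OF sm] by simp
  also have "\<dots> = (\<Sum>\<^sub>\<infinity>p\<in>?A \<times> ?A. \<Sum>\<^sub>\<infinity>k1\<in>?A. Fterm k1 p)"
    by (rule fps_infsum_swap[OF sm])
  also have "fps_cong (2 * N + 1) \<dots> (\<Sum>\<^sub>\<infinity>(k2, k3)\<in>?A \<times> ?A. fps_const (\<tau> k2 * \<tau> k3) * Esum k2 k3)"
  proof (rule fps_cong_infsum)
    show "(\<lambda>p. \<Sum>\<^sub>\<infinity>k1\<in>?A. Fterm k1 p) summable_on ?A \<times> ?A"
      using fps_has_sum_iterated[OF smswap] by (auto intro: has_sum_imp_summable)
    show "(\<lambda>(k2, k3). fps_const (\<tau> k2 * \<tau> k3) * Esum k2 k3) summable_on ?A \<times> ?A"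
      by (rule fps_summable_onI[where h = "\<lambda>(k2, k3). k2 + k3"])
         (use Esum_dvd pair_index_finite in auto)
    fix p assume "p \<in> ?A \<times> ?A"
    then obtain k2 k3 where p: "p = (k2, k3)" "k2 \<ge> 1" "k3 \<ge> 1" by auto
    have "(\<Sum>\<^sub>\<infinity>k1\<in>?A. Fterm k1 p) = (\<Sum>a\<in>idx N. (\<Sum>b\<in>idx N. fps_const (\<tau> k2 * \<tau> k3) * pmat_geom N (Kq \<tau> N) a b * Phi N k2 k3 b) * psi \<tau> N a)"
      unfolding p Fterm_eq
    proof (subst infsum_sum(1))
      show "(\<Sum>a\<in>idx N. \<Sum>\<^sub>\<infinity>k1\<in>?A. (\<Sum>b\<in>idx N. fps_const (\<tau> k2 * \<tau> k3) * pmat_geom N (Kq \<tau> N) a b * Phi N k2 k3 b) * (fps_const (\<tau> k1) * Psi N k1 a))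
        = (\<Sum>a\<in>idx N. (\<Sum>b\<in>idx N. fps_const (\<tau> k2 * \<tau> k3) * pmat_geom N (Kq \<tau> N) a b * Phi N k2 k3 b) * psi \<tau> N a)"
        unfolding psi_def[of \<tau>, OF \<tau>_0] by (intro sum.cong refl infsum_cmult_right smpsi)
    qed (rule summable_on_cmult_right smpsi | simp add: idx_def)+
    also have "\<dots> = fps_const (\<tau> k2 * \<tau> k3) * (\<Sum>b\<in>idx N. (\<Sum>a\<in>idx N. psi \<tau> N a * pmat_geom N (Kq \<tau> N) a b) * Phi N k2 k3 b)"
      unfolding sum_distrib_left sum_distrib_right
      by (subst sum.swap) (simp only: mult_ac)
    also have "fps_cong (2 * N + 1) \<dots> (fps_const (\<tau> k2 * \<tau> k3) * (\<Sum>b\<in>idx N. vstar \<tau> b * Phi N k2 k3 b))"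
      by (intro fps_cong_mult fps_cong_sum fps_cong_refl psi_geom \<tau>_0)
    also have "fps_cong (2 * N + 1) \<dots> (fps_const (\<tau> k2 * \<tau> k3) * Esum k2 k3)"
      by (intro fps_cong_mult fps_cong_refl Phi_vstar p)
    finally show "fps_cong (2 * N + 1) (\<Sum>\<^sub>\<infinity>k1\<in>?A. Fterm k1 p) (case p of (k2, k3) \<Rightarrow> fps_const (\<tau> k2 * \<tau> k3) * Esum k2 k3)"
      by (simp add: p)
  qed
  finally show ?thesis .
qed

text \<open>Walks rooted at a second largest mark with k visits, any marks on the left and one mark
  on the right.\<close>

definition Mterm :: "nat \<Rightarrow> complex fps" where
  "Mterm k = (\<Sum>i\<le>k. of_nat (k choose i) * (forest_gf (wt \<tau>) i * forest_gf (mk \<tau>) (k - i)))"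

lemma Mterm_dvd: "fps_X ^ k dvd Mterm k"
  unfolding Mterm_def
proof (intro dvd_sum)
  fix i assume "i \<in> {..k}"
  then have "fps_X ^ k = (fps_X ^ i * fps_X ^ (k - i) :: complex fps)" by (simp flip: power_add)
  then show "fps_X ^ k dvd of_nat (k choose i) * (forest_gf (wt \<tau>) i * forest_gf (mk \<tau>) (k - i))"
    by (metis dvd_mult mult_dvd_mono forest_gf_dvd')
qed

text \<open>\<open>marked_excursions\<close> expands \<open>Mterm\<close> by the order i of the
  centred moment. Order 0 gives the T2 sum because that moment is 1, orders from 1 to k - 1 give
  \<open>Esum\<close>, and i = k drops out through the factor k - i.\<close>

lemma sum_T2_full_Esum:
  "(\<Sum>\<^sub>\<infinity>(k2, k3)\<in>{1..} \<times> {1..}. fps_const (\<tau> k2 * \<tau> k3) * T2_full k2 k3) +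
   (\<Sum>\<^sub>\<infinity>(k2, k3)\<in>{1..} \<times> {1..}. fps_const (\<tau> k2 * \<tau> k3) * Esum k2 k3) =
   (\<Sum>\<^sub>\<infinity>k\<in>{1..}. fps_const (\<tau> k / of_nat k) * Mterm k)"
proof -
  let ?A = "{1::nat..}"
  define c where "c k i = (fact (k - 1) / (fact i * fact (k - 1 - i)) :: complex)" for k i :: nat
  define E where "E k2 k3 = (\<Sum>i=0..k2-1. fps_const (c k2 i) * centred \<tau> i * T2_full (k2 - i) k3)" for k2 k3
  have E: "E k2 k3 = T2_full k2 k3 + Esum k2 k3" for k2 k3
    unfolding E_def by (subst sum.atLeast_Suc_atMost) (simp_all add: Esum_def c_def centred_0)
  have Edvd: "fps_X ^ (k2 + k3) dvd fps_const x * (fps_const (c k2 i) * centred \<tau> i * T2_full (k2 - i) k3)" if "i < k2" "k3 \<ge> 1" for x k2 i k3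
    using centred_T2_full_dvd[OF that] by (simp add: mult.assoc)
  have sm1: "(\<lambda>(k2, k3). fps_const (\<tau> k2 * \<tau> k3) * T2_full k2 k3) summable_on ?A \<times> ?A"
    by (rule fps_summable_onI[where h = "\<lambda>(k2, k3). k2 + k3"]) (use T2_full_dvd pair_index_finite in auto)
  have sm2: "(\<lambda>(k2, k3). fps_const (\<tau> k2 * \<tau> k3) * Esum k2 k3) summable_on ?A \<times> ?A"
    by (rule fps_summable_onI[where h = "\<lambda>(k2, k3). k2 + k3"]) (use Esum_dvd pair_index_finite in auto)
  have add: "(\<Sum>\<^sub>\<infinity>(k2, k3)\<in>?A \<times> ?A. fps_const (\<tau> k2 * \<tau> k3) * T2_full k2 k3) + (\<Sum>\<^sub>\<infinity>(k2, k3)\<in>?A \<times> ?A. fps_const (\<tau> k2 * \<tau> k3) * Esum k2 k3)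
     = (\<Sum>\<^sub>\<infinity>(k2, k3)\<in>?A \<times> ?A. fps_const (\<tau> k2 * \<tau> k3) * E k2 k3)"
    unfolding infsum_add[OF sm1 sm2, symmetric] by (rule infsum_cong) (auto simp: E distrib_left)
  have sm3: "(\<lambda>(k2, k3). fps_const (\<tau> k2 * \<tau> k3) * E k2 k3) summable_on ?A \<times> ?A"
    using summable_on_add[OF sm1 sm2] by (simp add: E distrib_left case_prod_unfold)
  have "(\<Sum>\<^sub>\<infinity>(k2, k3)\<in>?A \<times> ?A. fps_const (\<tau> k2 * \<tau> k3) * E k2 k3) = (\<Sum>\<^sub>\<infinity>k\<in>?A. \<Sum>\<^sub>\<infinity>k3\<in>?A. fps_const (\<tau> k * \<tau> k3) * E k k3)"
    using fps_infsum_iterated[OF sm3] by simp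
  also have "\<dots> = (\<Sum>\<^sub>\<infinity>k\<in>?A. fps_const (\<tau> k / of_nat k) * Mterm k)"
  proof (rule infsum_cong)
    fix k assume "k \<in> ?A"
    then have k: "k \<ge> 1" by simp
    have smT: "(\<lambda>k3. fps_const (\<tau> k3) * T2_full (k - i) k3) summable_on ?A" if "i < k" for i
    proof (intro fps_summable_on_natI dvd_mult)
      fix k3 assume "k3 \<in> ?A"
      then have "fps_X ^ (k - i + k3) dvd T2_full (k - i) k3" using that by (intro T2_full_dvd) auto
      then show "fps_X ^ k3 dvd T2_full (k - i) k3" by (rule dvd_trans[rotated]) (simp add: le_imp_power_dvd)
    qed
    have "(\<Sum>\<^sub>\<infinity>k3\<in>?A. fps_const (\<tau> k * \<tau> k3) * E k k3) =
       (\<Sum>\<^sub>\<infinity>k3\<in>?A. \<Sum>i=0..k-1. fps_const (\<tau> k * c k i) * centred \<tau> i * (fps_const (\<tau> k3) * T2_full (k - i) k3))"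
      unfolding E_def sum_distrib_left fps_const_mult[symmetric] by (intro infsum_cong sum.cong refl) (simp only: mult_ac)
    also have "\<dots> = (\<Sum>i=0..k-1. fps_const (\<tau> k * c k i) * centred \<tau> i * (\<Sum>\<^sub>\<infinity>k3\<in>?A. fps_const (\<tau> k3) * T2_full (k - i) k3))"
    proof (subst infsum_sum(1))
      fix i assume "i \<in> {0..k-1}"
      then show "(\<lambda>k3. fps_const (\<tau> k * c k i) * centred \<tau> i * (fps_const (\<tau> k3) * T2_full (k - i) k3)) summable_on ?A"
        using k by (intro summable_on_cmult_right smT) auto
    next
      show "(\<Sum>i=0..k-1. \<Sum>\<^sub>\<infinity>k3\<in>?A. fps_const (\<tau> k * c k i) * centred \<tau> i * (fps_const (\<tau> k3) * T2_full (k - i) k3)) =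
        (\<Sum>i=0..k-1. fps_const (\<tau> k * c k i) * centred \<tau> i * (\<Sum>\<^sub>\<infinity>k3\<in>?A. fps_const (\<tau> k3) * T2_full (k - i) k3))"
        using k by (intro sum.cong refl infsum_cmult_right smT) auto
    qed simp
    also have "\<dots> = (\<Sum>i\<le>k. fps_const (\<tau> k / of_nat k) * (of_nat (k choose i) * (centred \<tau> i * (of_nat (k - i) * (\<Sum>\<^sub>\<infinity>k3\<in>?A. fps_const (\<tau> k3) * T2_full (k - i) k3)))))"
    proof (rule sum.mono_neutral_cong_left)
      fix i assume "i \<in> {0..k-1}"
      then have i: "i < k" using k by auto
      \<comment> \<open>The factor k - i from the right side and the 1/k from rerooting combine with
        binom(k, i) to binom(k - 1, i).\<close>
      have "\<tau> k * c k i = \<tau> k / of_nat k * of_nat (k choose i) * of_nat (k - i)"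
      proof -
        have "(fact (k - i) :: complex) = of_nat (k - i) * fact (k - i - 1)" "(fact k :: complex) = of_nat k * fact (k - 1)"
          using i by (simp_all add: fact_reduce)
        moreover have "of_nat k \<noteq> (0 :: complex)" "of_nat (k - i) \<noteq> (0 :: complex)" using i by auto
        moreover have "k - i - 1 = k - 1 - i" by simp
        ultimately show ?thesis
          using i by (simp add: c_def binomial_fact divide_simps del: of_nat_diff)
      qed
      then have "fps_const (\<tau> k * c k i) = fps_const (\<tau> k / of_nat k) * of_nat (k choose i) * of_nat (k - i)"
        by (simp only: fps_const_mult[symmetric] fps_of_nat)
      then show "fps_const (\<tau> k * c k i) * centred \<tau> i * (\<Sum>\<^sub>\<infinity>k3\<in>?A. fps_const (\<tau> k3) * T2_full (k - i) k3) =
        fps_const (\<tau> k / of_nat k) * (of_nat (k choose i) * (centred \<tau> i * (of_nat (k - i) * (\<Sum>\<^sub>\<infinity>k3\<in>?A. fps_const (\<tau> k3) * T2_full (k - i) k3))))"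
        by (simp only: mult_ac)
    qed (use k in \<open>auto simp: not_le\<close>)
    also have "\<dots> = fps_const (\<tau> k / of_nat k) * Mterm k"
      unfolding Mterm_def marked_excursions[of \<tau>, OF \<tau>_0] by (simp only: sum_distrib_left)
    finally show "(\<Sum>\<^sub>\<infinity>k3\<in>?A. fps_const (\<tau> k * \<tau> k3) * E k k3) = fps_const (\<tau> k / of_nat k) * Mterm k" .
  qed
  finally show ?thesis unfolding add .
qed

end

text \<open>The series is log \<nu>, and differentiating \<nu> (1 - \<lambda>) = 1 gives its
  derivative as \<nu> \<lambda>'. Differentiating z^2 = \<lambda> (1 - \<lambda>) gives A \<lambda>'
  = 2 z, so A z \<nu> \<lambda>' = 2 \<nu> z^2 = 2 \<lambda> = 1 - A.\<close>

lemma X_deriv_log: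
  "A_ser * (fps_X * fps_deriv (log_ser (2 / (1 + A_ser))) + 1) = 1"
proof -
  have nu0: "fps_nth nu 0 = 1" using arg_cong[OF nu_lam, of "\<lambda>f. fps_nth f 0"] by (simp add: fps_mult_nth_0 lam_0)
  have "1 + A_ser = 2 * (1 - lam)" by (simp add: A_lam)
  have "2 / (1 + A_ser) = 2 * inverse (1 + A_ser)" by (rule fps_divide_unit) (simp add: A_ser_nth_0)
  moreover have "inverse (1 + A_ser) * (1 + A_ser) = 1" by (rule inverse_mult_eq_1) (simp add: A_ser_nth_0)
  ultimately have "2 / (1 + A_ser) * (1 - lam) = 1"
    unfolding \<open>1 + A_ser = 2 * (1 - lam)\<close> by algebra
  then have "2 / (1 + A_ser) * ((1 - lam) * nu) = nu" by (simp add: mult.assoc[symmetric])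
  then have nu: "2 / (1 + A_ser) = nu" using nu_lam by (simp add: mult.commute)
  have "fps_deriv (log_ser nu) = (inverse (1 + fps_X) oo (nu - 1)) * fps_deriv (nu - 1)"
    unfolding log_ser_def by (subst fps_compose_deriv) (simp_all add: nu0 fps_ln_deriv)
  also have "inverse (1 + fps_X) oo (nu - 1) = inverse nu"
    by (subst fps_inverse_compose) (simp_all add: nu0 fps_compose_add_distrib)
  also have "inverse nu = 1 - lam"
  proof -
    have "inverse nu * nu = 1" by (rule inverse_mult_eq_1) (simp add: nu0)
    then have "inverse nu * (nu * (1 - lam)) = 1 - lam" by (simp add: mult.assoc[symmetric])
    then show ?thesis by (simp add: nu_lam)
  qed
  finally have L: "fps_deriv (log_ser nu) = (1 - lam) * fps_deriv nu" by simp
  have "fps_deriv (nu * (1 - lam)) = 0" by (simp add: nu_lam)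
  then have d1: "(1 - lam) * fps_deriv nu = nu * fps_deriv lam" by (simp add: algebra_simps)
  have "fps_deriv (lam * (1 - lam)) = 2 * fps_X"
    unfolding X2[symmetric] by (simp add: power2_eq_square)
  then have d2: "A_ser * fps_deriv lam = 2 * fps_X" by (simp add: A_lam algebra_simps)
  have "A_ser * (fps_X * (nu * fps_deriv lam)) = fps_X * nu * (A_ser * fps_deriv lam)" by (simp only: mult_ac)
  also have "\<dots> = 2 * (nu * fps_X ^ 2)" by (simp add: d2 power2_eq_square mult_ac)
  also have "\<dots> = 1 - A_ser" by (simp add: nu_X2 one_minus_A)
  finally show ?thesis unfolding nu L d1 by (simp add: distrib_left)
qed

text \<open>Sorting closed walks by their k visits to the origin gives the sum of (1 - A)^k, that is
  1/A, which \<open>X_deriv_log\<close> identifies as 1 plus z d/dz of the logarithm.\<close>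

lemma card_cwalks_log:
  assumes "n \<ge> 1"
  shows "of_nat (card (cwalks n)) = of_nat n * fps_nth (log_ser (2 / (1 + A_ser))) n"
proof -
  have l: "fps_nth (1 - A_ser) 0 = 0" by (simp add: A_ser_nth_0)
  have dvd: "fps_X ^ k dvd (1 - A_ser) ^ k" for k by (intro dvd_power_same) (simp add: fps_X_dvd_iff A_ser_nth_0)
  have "(\<Sum>\<^sub>\<infinity>k. (1 - A_ser) ^ k) = inverse A_ser"
    using infsum_negative_binomial[OF l, of 1] by simp
  also have "inverse A_ser = fps_X * fps_deriv (log_ser (2 / (1 + A_ser))) + 1"
  proof -
    have "inverse A_ser * A_ser = 1" by (rule inverse_mult_eq_1) (simp add: A_ser_nth_0)
    then have "inverse A_ser * (A_ser * y) = y" for y by (simp only: mult.assoc[symmetric] mult_1_left)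
    from this[of "fps_X * fps_deriv (log_ser (2 / (1 + A_ser))) + 1"] show ?thesis
      unfolding X_deriv_log by (simp only: mult_1_right)
  qed
  finally have S: "(\<Sum>\<^sub>\<infinity>k. (1 - A_ser) ^ k) = fps_X * fps_deriv (log_ser (2 / (1 + A_ser))) + 1" .
  have "of_nat (card (cwalks n)) = (\<Sum>k\<le>n. fps_nth ((1 - A_ser) ^ k) n)"
    unfolding card_cwalks unmarked_excursions ..
  also have "\<dots> = fps_nth (\<Sum>\<^sub>\<infinity>k. (1 - A_ser) ^ k) n"
    by (rule fps_nth_infsum[symmetric]) (use dvd in \<open>auto simp: fps_X_power_dvd_iff intro!: fps_summable_on_natI\<close>)
  also have "\<dots> = of_nat n * fps_nth (log_ser (2 / (1 + A_ser))) n"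
    unfolding S using assms by (cases n) auto
  finally show ?thesis .
qed

theorem theorem3p1:
  fixes \<Lambda> :: "nat \<Rightarrow> complex" and N :: nat
  assumes "N \<ge> 1"
  shows "(\<Sum>w\<in>walks0 (2 * N).
            fps_const (exp (\<Sum>\<^sub>\<infinity>k\<in>{1..}. \<Lambda> k * of_nat (num_mult (2 * k) w))) * fps_X ^ walk_length w)
         = fps_X * fps_deriv
             (T0 N
              + (\<Sum>\<^sub>\<infinity>k\<in>{1..}. fps_const (tvar \<Lambda> k) * T1 N k)
              + (\<Sum>\<^sub>\<infinity>(k1, k2)\<in>{1..} \<times> {1..}.
                   fps_const (tvar \<Lambda> k1 * tvar \<Lambda> k2) * T2 N k1 k2)
              + (\<Sum>\<^sub>\<infinity>(k1, k2, k3)\<in>{1..} \<times> {1..} \<times> {1..}.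
                   fps_const (tvar \<Lambda> k1 * tvar \<Lambda> k2 * tvar \<Lambda> k3) * T3 \<Lambda> N k1 k2 k3))"
proof (rule fps_ext, goal_cases)
  case (1 n)
  \<comment> \<open>\<open>tvar \<Lambda> 0\<close> is arbitrary, whereas an unvisited point must
    not carry a mark. The sums in the statement start at 1 and do not see the change.\<close>
  define \<tau> where "\<tau> k = (if k = 0 then 0 else tvar \<Lambda> k)" for k
  have \<tau>_0: "\<tau> 0 = 0" by (simp add: \<tau>_def)
  have \<tau>: "tvar \<Lambda> k = \<tau> k" if "k \<ge> 1" for k using that by (simp add: \<tau>_def)
  define S1 where "S1 = (\<Sum>\<^sub>\<infinity>k\<in>{1..}. fps_const (tvar \<Lambda> k) * T1 N k)"
  define S2 where "S2 = (\<Sum>\<^sub>\<infinity>(k1, k2)\<in>{1..} \<times> {1..}. fps_const (tvar \<Lambda> k1 * tvar \<Lambda> k2) * T2 N k1 k2)"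
  define S3 where "S3 = (\<Sum>\<^sub>\<infinity>(k1, k2, k3)\<in>{1..} \<times> {1..} \<times> {1..}. fps_const (tvar \<Lambda> k1 * tvar \<Lambda> k2 * tvar \<Lambda> k3) * T3 \<Lambda> N k1 k2 k3)"
  have rhs: "fps_nth (fps_X * fps_deriv (T0 N + S1 + S2 + S3)) n = of_nat n * (fps_nth (T0 N) n + fps_nth S1 n + fps_nth S2 n + fps_nth S3 n)"
    by (cases n) (simp_all add: distrib_left)
  have lhs: "fps_nth (\<Sum>w\<in>walks0 (2 * N). fps_const (exp (\<Sum>\<^sub>\<infinity>k\<in>{1..}. \<Lambda> k * of_nat (num_mult (2 * k) w))) * fps_X ^ walk_length w) n
    = of_nat n * (fps_nth (T0 N) n + fps_nth S1 n + fps_nth S2 n + fps_nth S3 n)"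
  \<comment> \<open>Above 2N every summand on the right is truncated, and no walk is that long. At n
    = 0 the factor n meets the absence of the empty walk.\<close>
  proof (cases "1 \<le> n \<and> n \<le> 2 * N")
    case False
    show ?thesis
    proof (cases "n = 0")
      case False
      then have n: "n > 2 * N" using \<open>\<not> (1 \<le> n \<and> n \<le> 2 * N)\<close> by auto
      have "fps_nth (T0 N) n = 0" using n by (simp add: T0_def ztrunc_nth_big)
      moreover have "fps_nth S1 n = 0" unfolding S1_def
        by (rule infsum_nth_0) (use n in \<open>simp add: T1_def ztrunc_nth_big\<close>)
      moreover have "fps_nth S2 n = 0" unfolding S2_def
        by (rule infsum_nth_0) (use n in \<open>auto simp: T2_def ztrunc_nth_big\<close>)
      moreover have "fps_nth S3 n = 0" unfolding S3_def
        by (rule infsum_nth_0) (use n in \<open>auto simp: T3_def ztrunc_nth_big\<close>)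
      ultimately show ?thesis unfolding walks_lhs_nth using n by simp
    qed (simp only: walks_lhs_nth, simp)
  next
    case True
    then have n: "n \<ge> 1" "n < 2 * N + 1" by auto
    have "fps_nth (\<Sum>w\<in>walks0 (2 * N). fps_const (exp (\<Sum>\<^sub>\<infinity>k\<in>{1..}. \<Lambda> k * of_nat (num_mult (2 * k) w))) * fps_X ^ walk_length w) n
      = (\<Sum>s\<in>cwalks n. exp (\<Sum>\<^sub>\<infinity>k\<in>{1..}. \<Lambda> k * of_nat (num_mult (2 * k) (0, s))))"
      unfolding walks_lhs_nth using True by simp
    also have "\<dots> = (\<Sum>s\<in>cwalks n. \<Prod>q\<in>{- int n..int n}. 1 + \<tau> (vis 0 s q))"
      using exp_sum_num_mult n(1) by (intro sum.cong refl) (simp add: \<tau>_def)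
    also have "\<dots> = of_nat n * fps_nth (log_ser (2 / (1 + A_ser))) n + of_nat n * (\<Sum>k\<le>n. \<tau> k / of_nat k * (fps_nth ((1 - A_ser) ^ k) n + fps_nth (Mterm \<tau> k) n))"
      unfolding sum_cwalks_prod[of \<tau>, OF \<tau>_0] card_cwalks_log[OF n(1)] unmarked_excursions Mterm_def[of \<tau>, OF \<tau>_0] ..
    also have "fps_nth (log_ser (2 / (1 + A_ser))) n = fps_nth (T0 N) n"
      using n(2) fps_cong_ztrunc[of N "log_ser (2 / (1 + A_ser))"] by (simp add: T0_def fps_cong_iff)
    also have "(\<Sum>k\<le>n. \<tau> k / of_nat k * (fps_nth ((1 - A_ser) ^ k) n + fps_nth (Mterm \<tau> k) n)) =
      (\<Sum>k\<le>n. fps_nth (fps_const (\<tau> k / of_nat k) * (1 - A_ser) ^ k) n) + (\<Sum>k\<le>n. fps_nth (fps_const (\<tau> k / of_nat k) * Mterm \<tau> k) n)"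
      by (simp add: sum.distrib distrib_left)
    also have "(\<Sum>k\<le>n. fps_nth (fps_const (\<tau> k / of_nat k) * (1 - A_ser) ^ k) n) = fps_nth S1 n"
    proof -
      have d: "fps_X ^ k dvd (1 - A_ser) ^ k" for k
        by (intro dvd_power_same) (simp add: fps_X_dvd_iff A_ser_nth_0)
      have sm: "(\<lambda>k. fps_const (\<tau> k / of_nat k) * (1 - A_ser) ^ k) summable_on {1..}"
        by (intro fps_summable_on_natI dvd_mult d)
      have "S1 = (\<Sum>\<^sub>\<infinity>k\<in>{1..}. fps_const (\<tau> k) * ztrunc (2 * N) (fps_const (1 / of_nat k) * (1 - A_ser) ^ k))"
        unfolding S1_def T1_def by (rule infsum_cong) (simp add: \<tau>)
      also have "fps_cong (2 * N + 1) \<dots> (\<Sum>\<^sub>\<infinity>k\<in>{1..}. fps_const (\<tau> k / of_nat k) * (1 - A_ser) ^ k)"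
      proof (rule fps_cong_infsum[OF _ _ sm])
        show "(\<lambda>k. fps_const (\<tau> k) * ztrunc (2 * N) (fps_const (1 / of_nat k) * (1 - A_ser) ^ k)) summable_on {1..}"
          by (intro fps_summable_on_natI dvd_mult ztrunc_dvd d)
        fix k
        have "fps_const (\<tau> k / of_nat k) * (1 - A_ser) ^ k = fps_const (\<tau> k) * (fps_const (1 / of_nat k) * (1 - A_ser) ^ k)"
          by (simp add: mult.assoc[symmetric])
        then show "fps_cong (2 * N + 1) (fps_const (\<tau> k) * ztrunc (2 * N) (fps_const (1 / of_nat k) * (1 - A_ser) ^ k)) (fps_const (\<tau> k / of_nat k) * (1 - A_ser) ^ k)"
          by (simp only: fps_cong_mult fps_cong_refl fps_cong_ztrunc)
      qed
      finally have "fps_nth S1 n = fps_nth (\<Sum>\<^sub>\<infinity>k\<in>{1..}. fps_const (\<tau> k / of_nat k) * (1 - A_ser) ^ k) n"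
        using n(2) by (simp only: fps_cong_iff)
      also have "\<dots> = (\<Sum>k\<in>{1..n}. fps_nth (fps_const (\<tau> k / of_nat k) * (1 - A_ser) ^ k) n)"
        by (rule fps_nth_infsum[OF sm]) (use d in \<open>auto simp: fps_X_power_dvd_iff\<close>)
      also have "\<dots> = (\<Sum>k\<le>n. fps_nth (fps_const (\<tau> k / of_nat k) * (1 - A_ser) ^ k) n)"
        by (rule sum.mono_neutral_left) (auto simp: \<tau>_0 not_less_eq_eq)
      finally show ?thesis by simp
    qed
    also have "(\<Sum>k\<le>n. fps_nth (fps_const (\<tau> k / of_nat k) * Mterm \<tau> k) n) = fps_nth S2 n + fps_nth S3 n"
    proof -
      have "fps_nth S2 n = fps_nth (\<Sum>\<^sub>\<infinity>(k2, k3)\<in>{1..} \<times> {1..}. fps_const (\<tau> k2 * \<tau> k3) * T2_full k2 k3) n"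
      proof -
        have "S2 = (\<Sum>\<^sub>\<infinity>(k2, k3)\<in>{1..} \<times> {1..}. fps_const (\<tau> k2 * \<tau> k3) * ztrunc (2 * N) (T2_full k2 k3))"
          unfolding S2_def T2_eq by (rule infsum_cong) (auto simp: \<tau>)
        also have "fps_cong (2 * N + 1) \<dots> (\<Sum>\<^sub>\<infinity>(k2, k3)\<in>{1..} \<times> {1..}. fps_const (\<tau> k2 * \<tau> k3) * T2_full k2 k3)"
        proof (rule fps_cong_infsum)
          show "(\<lambda>(k2, k3). fps_const (\<tau> k2 * \<tau> k3) * ztrunc (2 * N) (T2_full k2 k3)) summable_on {1..} \<times> {1..}"
            by (rule fps_summable_onI[where h = "\<lambda>(k2, k3). k2 + k3"]) (use T2_full_dvd pair_index_finite in \<open>auto intro!: dvd_mult ztrunc_dvd\<close>)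
          show "(\<lambda>(k2, k3). fps_const (\<tau> k2 * \<tau> k3) * T2_full k2 k3) summable_on {1..} \<times> {1..}"
            by (rule fps_summable_onI[where h = "\<lambda>(k2, k3). k2 + k3"]) (use T2_full_dvd pair_index_finite in auto)
          fix p :: "nat \<times> nat"
          show "fps_cong (2 * N + 1) (case p of (k2, k3) \<Rightarrow> fps_const (\<tau> k2 * \<tau> k3) * ztrunc (2 * N) (T2_full k2 k3))
            (case p of (k2, k3) \<Rightarrow> fps_const (\<tau> k2 * \<tau> k3) * T2_full k2 k3)"
            by (cases p) (simp only: prod.case fps_cong_mult fps_cong_refl fps_cong_ztrunc)
        qed
        finally show ?thesis using n(2) by (simp only: fps_cong_iff)
      qed
      moreover have "fps_nth S3 n = fps_nth (\<Sum>\<^sub>\<infinity>(k2, k3)\<in>{1..} \<times> {1..}. fps_const (\<tau> k2 * \<tau> k3) * Esum \<tau> k2 k3) n"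
      proof -
        have K: "(\<lambda>a b. \<Sum>\<^sub>\<infinity>k\<in>{1..}. fps_const (tvar \<Lambda> k) * Q_mat N k a b) = Kq \<tau> N"
          unfolding Kq_def[of \<tau>, OF \<tau>_0] by (intro ext infsum_cong) (simp add: \<tau>)
        have "S3 = (\<Sum>\<^sub>\<infinity>(k1, p)\<in>{1..} \<times> {1..} \<times> {1..}. ztrunc (2 * N) (Fterm \<tau> N k1 p))"
          unfolding S3_def
        proof (rule infsum_cong)
          fix x :: "nat \<times> nat \<times> nat" assume "x \<in> {1..} \<times> {1..} \<times> {1..}"
          then obtain k1 k2 k3 where x: "x = (k1, k2, k3)" "k1 \<ge> 1" "k2 \<ge> 1" "k3 \<ge> 1" by auto
          have "fps_const c * ztrunc (2 * N) y = ztrunc (2 * N) (fps_const c * y)" for c y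
            by (auto simp: fps_eq_iff ztrunc_def)
          then show "(case x of (k1, k2, k3) \<Rightarrow> fps_const (tvar \<Lambda> k1 * tvar \<Lambda> k2 * tvar \<Lambda> k3) * T3 \<Lambda> N k1 k2 k3) =
            (case x of (k1, p) \<Rightarrow> ztrunc (2 * N) (Fterm \<tau> N k1 p))"
            unfolding x(1) prod.case T3_def K Fterm_def[of \<tau>, OF \<tau>_0] \<tau>[OF x(2)] \<tau>[OF x(3)] \<tau>[OF x(4)] by (simp only:)
        qed
        also have "fps_cong (2 * N + 1) \<dots> (\<Sum>\<^sub>\<infinity>(k2, k3)\<in>{1..} \<times> {1..}. fps_const (\<tau> k2 * \<tau> k3) * Esum \<tau> k2 k3)"
          by (rule sum_Fterm[of \<tau>, OF \<tau>_0])
        finally show ?thesis using n(2) by (simp only: fps_cong_iff)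
      qed
      ultimately have "fps_nth S2 n + fps_nth S3 n = fps_nth (\<Sum>\<^sub>\<infinity>k\<in>{1..}. fps_const (\<tau> k / of_nat k) * Mterm \<tau> k) n"
        by (simp only: fps_add_nth[symmetric] sum_T2_full_Esum[of \<tau>, OF \<tau>_0])
      also have "\<dots> = (\<Sum>k\<in>{1..n}. fps_nth (fps_const (\<tau> k / of_nat k) * Mterm \<tau> k) n)"
      proof (rule fps_nth_infsum)
        show "(\<lambda>k. fps_const (\<tau> k / of_nat k) * Mterm \<tau> k) summable_on {1..}"
          by (intro fps_summable_on_natI dvd_mult Mterm_dvd \<tau>_0)
      qed (use Mterm_dvd[of \<tau>, OF \<tau>_0] in \<open>auto simp: fps_X_power_dvd_iff\<close>)
      also have "\<dots> = (\<Sum>k\<le>n. fps_nth (fps_const (\<tau> k / of_nat k) * Mterm \<tau> k) n)"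
        by (rule sum.mono_neutral_left) (auto simp: \<tau>_0 not_less_eq_eq)
      finally show ?thesis by simp
    qed
    finally show ?thesis by (simp add: algebra_simps)
  qed
  show ?case
    unfolding lhs S1_def[symmetric] S2_def[symmetric] S3_def[symmetric] rhs ..
qed

end
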